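(* The $A_\infty$ morphisms $$\lambda:\Omega^*([0,1])\to C^*_\cup([0,1]),\qquad \exp=\lambda\circ\mu:C^*_\infty([0,1])\to C^*_\cup([0,1]),\qquad \varphi=\log\circ\lambda:\Omega^*([0,1])\to C^*_\infty([0,1])$$ are the only $A_\infty$ morphisms (between the respective $A_\infty$ algebras) with linear parts equal to $\pi$, $\mathrm{id}$ and $\pi$ respectively, and the property that their higher order Taylor coefficients (those of order $n\ge2$) vanish whenever one of the arguments is a zero-form.
   Context: **$A_\infty$ conventions.** $\Bbbk$ is a field of characteristic zero. For a graded vector space $V$, $\mathbf{s}V$ is the suspension, $(\mathbf{s}V)^i=V^{i+1}$. $\overline{T}(V)=\bigoplus_{n\ge1}V^{\otimes n}$ carries the deconcatenation coproduct. An $A_\infty$ algebra structure on $V$ is a degree $1$ coderivation $Q$ of $\overline{T}(\mathbf{s}V)$ with $Q^2=0$; it is determined by its Taylor coefficients $Q_n:(\mathbf{s}V)^{\otimes n}\to\mathbf{s}V$. An $A_\infty$ morphism $F:V\to W$ is a morphism of dg coalgebras $\overline{T}(\mathbf{s}V)\to\overline{T}(\mathbf{s}W)$, determined by its Taylor coefficients $F_n:(\mathbf{s}V)^{\otimes n}\to\mathbf{s}W$ ($F_1$ is the linear part); the composition has coefficients $(G\circ F)_n=\sum_{k}\sum_{i_1+\cdots+i_k=n}G_k(F_{i_1}\otimes\cdots\otimes F_{i_k})$. A dg algebra is an $A_\infty$ algebra via $Q_1(\mathbf{s}a)=-\mathbf{s}(da)$, $Q_2(\mathbf{s}a\otimes\mathbf{s}b)=(-1)^{|a|}\mathbf{s}(ab)$,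 $Q_n=0$ for $n\ge3$. **Forms and cochains.** $\Omega^*([0,1])$ is either the commutative dg algebra of smooth real forms on $[0,1]$ ($\Bbbk=\mathbb{R}$) or that of polynomial forms $\Bbbk[t]\oplus\Bbbk[t]dt$ (with polynomial integrals over simplices evaluated formally). $C^*([0,1])\subset\Omega^*([0,1])$ is the subcomplex of Whitney forms $\{at+b(1-t)\}\oplus\{c\,dt\}$, $a,b,c\in\Bbbk$. $C^*_\cup([0,1])$ is the dg algebra $(C^*([0,1]),d,\cup)$ with unit the constant function $1$ and $t\cup t=t$, $t\cup dt=0$, $dt\cup t=dt$. $C^*_\infty([0,1])$ is $C^*([0,1])$ with the $C_\infty$ (in particular $A_\infty$) structure, strictly unital with respect to $1$, with Taylor coefficients: $m_1(\mathbf{s}t)=-\mathbf{s}dt$, $m_2(\mathbf{s}t\otimes\mathbf{s}t)=\mathbf{s}t$, $m_2(\mathbf{s}t\otimes\mathbf{s}dt)=\frac12\mathbf{s}dt=-m_2(\mathbf{s}dt\otimes\mathbf{s}t)$, and for $n>1$, $m_{n+1}$ vanishes unless precisely one argument is a function, with $m_{n+1}((\mathbf{s}dt)^{\otimes i}\otimes\mathbf{s}t\otimes(\mathbf{s}dt)^{\otimes n-i})=(-1)^{i+1}\binom{n}{i}\frac{B_n}{n!}\mathbf{s}dt$, where $\frac{z}{e^z-1}=\sum_{n\ge0}\frac{B_n}{n!}z^n$. **The morphism $\mu$** is the unital $C_\infty$ morphism $C^*_\infty([0,1])\to\Omega^*([0,1])$ with $\mu_1$ the inclusion and, for $n\ge1$,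 $\mu_{n+1}$ vanishing unless precisely one input is a function, with $\mu_{n+1}((\mathbf{s}dt)^{\otimes i}\otimes\mathbf{s}t\otimes(\mathbf{s}dt)^{\otimes n-i})=\mathbf{s}\left((-1)^i\binom{n}{i}\frac{B_{n+1}(t)-B_{n+1}}{(n+1)!}\right)$, where $\frac{ze^{tz}}{e^z-1}=\sum_{n\ge0}\frac{B_n(t)}{n!}z^n$ (unital: $\mu_n$, $n\ge2$, vanishes if an argument is $\mathbf{s}1$). **The morphism $\lambda$** is the $A_\infty$ morphism $\Omega^*([0,1])\to C^*_\cup([0,1])$ with $\lambda_1=\pi$, where $\pi(f)=f(1)t+f(0)(1-t)$ on functions and $\pi(a(t)dt)=\left(\int_0^1a(\tau)d\tau\right)dt$; for $n>1$, $\lambda_n$ vanishes if some factor is a zero-form; and $\lambda_n(\mathbf{s}a_1(t)dt\otimes\cdots\otimes\mathbf{s}a_n(t)dt)=\left(\int_{0\le t_1\le\cdots\le t_n\le1}a_1(t_1)\cdots a_n(t_n)dt_1\cdots dt_n\right)\mathbf{s}dt$ for $n\ge1$. **The morphism $\log$** $:C^*_\cup([0,1])\to C^*_\infty([0,1])$ is the inverse of the $A_\infty$ isomorphism $\exp$; it has $\log_1=\mathrm{id}$, $\log_n$ ($n>1$) vanishing if some factor is a zero-form, and $\log_n((\mathbf{s}dt)^{\otimes n})=\frac{(-1)^{n+1}}{n}\mathbf{s}dt$ for $n\ge1$. *)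

theory Defs
  imports
    "HOL-Analysis.Analysis"
    "HOL-Library.Poly_Mapping"
    "HOL-Computational_Algebra.Polynomial"
    "HOL-Computational_Algebra.Formal_Power_Series"
begin

section \<open>Tensor coalgebras\<close>

text \<open>
  The vector space with basis \<^typ>\<open>'a\<close> over \<^typ>\<open>'k\<close> is the type \<^typ>\<open>'a \<Rightarrow>\<^sub>0 'k\<close>.
\<close>

definition free_scale :: "'k \<Rightarrow> ('a \<Rightarrow>\<^sub>0 'k) \<Rightarrow> ('a \<Rightarrow>\<^sub>0 'k::field)"
  where "free_scale c = Poly_Mapping.map ((*) c)"

definition free_lin :: "('a \<Rightarrow> ('b \<Rightarrow>\<^sub>0 'k)) \<Rightarrow> ('a \<Rightarrow>\<^sub>0 'k) \<Rightarrow> ('b \<Rightarrow>\<^sub>0 'k::field)"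
  where "free_lin g x = (\<Sum>a\<in>Poly_Mapping.keys x. free_scale (Poly_Mapping.lookup x a) (g a))"

abbreviation free_of :: "'a \<Rightarrow> ('a \<Rightarrow>\<^sub>0 'k::field)"
  where "free_of a \<equiv> Poly_Mapping.single a 1"

text \<open>
  A graded space on the type \<^typ>\<open>'v\<close>: the scalar multiplication, and for each degree \<open>i\<close> the
  projection onto the component of degree \<open>i\<close>. The suspension \<open>\<^bold>sV\<close> has the same underlying
  type as \<open>V\<close>, an element of degree \<open>i\<close> in \<open>V\<close> having degree \<open>i - 1\<close> in \<open>\<^bold>sV\<close>;
  \<open>scal\<close> and \<open>proj\<close> always refer to the unsuspended space \<open>V\<close>.
\<close>

record ('k, 'v) graded_space =
  scal :: "'k \<Rightarrow> 'v \<Rightarrow> 'v"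
  proj :: "int \<Rightarrow> 'v \<Rightarrow> 'v"

text \<open>The linear map \<open>v \<mapsto> (-1)\<^sup>|\<^sup>v\<^sup>| v\<close>, with \<open>|v|\<close> the degree in \<open>V\<close>.\<close>

definition deg_sign :: "('k, 'v::ab_group_add, 'm) graded_space_scheme \<Rightarrow> 'v \<Rightarrow> 'v"
  where "deg_sign V v =
    (\<Sum>i | proj V i v \<noteq> 0. if even i then proj V i v else - proj V i v)"

text \<open>
  A word \<open>[v\<^sub>1, \<dots>, v\<^sub>n]\<close>, \<open>n \<ge> 1\<close>, stands for \<open>\<^bold>sv\<^sub>1 \<otimes> \<dots> \<otimes> \<^bold>sv\<^sub>n\<close>. The reduced tensor
  coalgebra of \<open>\<^bold>sV\<close> is the quotient of the space of combinations of nonempty words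
  (\<open>words\<close>) by the subspace \<open>tensor_null V\<close> which imposes multilinearity. A linear map out of
  the quotient is represented by a linear map on combinations of words which preserves the
  null subspaces; two representatives are the same map if they agree modulo \<open>tensor_null\<close>.
\<close>

definition words :: "('v list \<Rightarrow>\<^sub>0 'k::field) set"
  where "words = {x. [] \<notin> Poly_Mapping.keys x}"

definition multilinear_relations ::
    "('k::field, 'v::ab_group_add, 'm) graded_space_scheme \<Rightarrow> ('v list \<Rightarrow>\<^sub>0 'k) set"
  where "multilinear_relations V =
    {free_of (u @ [x + y] @ v) - free_of (u @ [x] @ v) - free_of (u @ [y] @ v) | u v x y. True} \<union>
    {free_of (u @ [scal V c x] @ v) - free_scale c (free_of (u @ [x] @ v)) | u v c x. True}"

definition tensor_null ::
    "('k::field, 'v::ab_group_add, 'm) graded_space_scheme \<Rightarrow> ('v list \<Rightarrow>\<^sub>0 'k) set"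
  where "tensor_null V = module.span free_scale (multilinear_relations V)"

text \<open>
  The tensor square of the tensor coalgebra is the space of combinations of pairs of words
  modulo \<open>tensor_null V \<otimes> words + words \<otimes> tensor_null V\<close>.
\<close>

definition tensor :: "('a \<Rightarrow>\<^sub>0 'k) \<Rightarrow> ('b \<Rightarrow>\<^sub>0 'k) \<Rightarrow> ('a \<times> 'b \<Rightarrow>\<^sub>0 'k::field)"
  where "tensor x y = (\<Sum>a\<in>Poly_Mapping.keys x. \<Sum>b\<in>Poly_Mapping.keys y.
    Poly_Mapping.single (a, b) (Poly_Mapping.lookup x a * Poly_Mapping.lookup y b))"

definition tensor_null2 ::
    "('k::field, 'v::ab_group_add, 'm) graded_space_scheme \<Rightarrow> ('v list \<times> 'v list \<Rightarrow>\<^sub>0 'k) set"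
  where "tensor_null2 V = module.span free_scale
    ({tensor r x | r x. r \<in> tensor_null V \<and> x \<in> words} \<union>
     {tensor x r | r x. r \<in> tensor_null V \<and> x \<in> words})"

definition deconcatenation :: "('v list \<Rightarrow>\<^sub>0 'k) \<Rightarrow> ('v list \<times> 'v list \<Rightarrow>\<^sub>0 'k::field)"
  where "deconcatenation =
    free_lin (\<lambda>w. \<Sum>p | fst p @ snd p = w \<and> fst p \<noteq> [] \<and> snd p \<noteq> []. free_of p)"

text \<open>Combinations of homogeneous words of degree \<open>d\<close> in the tensor coalgebra of \<open>\<^bold>sV\<close>.\<close>

definition tensor_degree ::
    "('k::field, 'v::ab_group_add, 'm) graded_space_scheme \<Rightarrow> int \<Rightarrow> ('v list \<Rightarrow>\<^sub>0 'k) set"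
  where "tensor_degree V d = module.span free_scale
    {free_of w | w. w \<noteq> [] \<and>
      (\<exists>is. list_all2 (\<lambda>i v. proj V i v = v) is w \<and> (\<Sum>i\<leftarrow>is. i - 1) = d)}"

definition same_map ::
    "('k::field, 'w::ab_group_add, 'm) graded_space_scheme \<Rightarrow>
      (('v list \<Rightarrow>\<^sub>0 'k) \<Rightarrow> ('w list \<Rightarrow>\<^sub>0 'k)) \<Rightarrow> (('v list \<Rightarrow>\<^sub>0 'k) \<Rightarrow> ('w list \<Rightarrow>\<^sub>0 'k)) \<Rightarrow> bool"
  where "same_map W F G \<longleftrightarrow> (\<forall>x\<in>words. F x - G x \<in> tensor_null W)"

definition coalgebra_morphism ::
    "('k::field, 'v::ab_group_add, 'm) graded_space_scheme \<Rightarrow>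
     ('k, 'w::ab_group_add, 'n) graded_space_scheme \<Rightarrow>
      (('v list \<Rightarrow>\<^sub>0 'k) \<Rightarrow> ('w list \<Rightarrow>\<^sub>0 'k)) \<Rightarrow> bool"
  where "coalgebra_morphism V W F \<longleftrightarrow>
    Vector_Spaces.linear free_scale free_scale F \<and>
    (\<forall>x\<in>words. F x \<in> words) \<and>
    (\<forall>x\<in>tensor_null V. F x \<in> tensor_null W) \<and>
    (\<forall>d. \<forall>x\<in>tensor_degree V d. \<exists>y\<in>tensor_degree W d. F x - y \<in> tensor_null W) \<and>
    (\<forall>x\<in>words. deconcatenation (F x) -
        free_lin (\<lambda>(u, v). tensor (F (free_of u)) (F (free_of v))) (deconcatenation x)
      \<in> tensor_null2 W)"

text \<open>The \<open>n\<close>-th Taylor coefficient of \<open>F\<close> is \<open>taylor W F\<close> restricted to lists of length \<open>n\<close>.\<close>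

definition corestriction ::
    "('k::field, 'v::ab_group_add, 'm) graded_space_scheme \<Rightarrow> ('v list \<Rightarrow>\<^sub>0 'k) \<Rightarrow> 'v"
  where "corestriction V x =
    (\<Sum>w | w \<in> Poly_Mapping.keys x \<and> length w = 1. scal V (Poly_Mapping.lookup x w) (hd w))"

definition taylor ::
    "('k::field, 'w::ab_group_add, 'm) graded_space_scheme \<Rightarrow>
      (('v list \<Rightarrow>\<^sub>0 'k) \<Rightarrow> ('w list \<Rightarrow>\<^sub>0 'k)) \<Rightarrow> 'v list \<Rightarrow> 'w"
  where "taylor W F vs = corestriction W (F (free_of vs))"

text \<open>
  The coalgebra morphism with Taylor coefficients \<open>f\<close>:
  \<open>F(v\<^sub>1 \<otimes> \<dots> \<otimes> v\<^sub>n) = \<Sum> f(block\<^sub>1) \<otimes> \<dots> \<otimes> f(block\<^sub>k)\<close>, over all ways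
  of cutting the word into nonempty consecutive blocks.
\<close>

definition morphism_of :: "('v list \<Rightarrow> 'w) \<Rightarrow> ('v list \<Rightarrow>\<^sub>0 'k) \<Rightarrow> ('w list \<Rightarrow>\<^sub>0 'k::field)"
  where "morphism_of f =
    free_lin (\<lambda>w. \<Sum>bs | concat bs = w \<and> [] \<notin> set bs. free_of (map f bs))"


section \<open>\<open>A\<^sub>\<infinity>\<close> algebras and morphisms\<close>

text \<open>
  \<open>coeff_Q A [v\<^sub>1, \<dots>, v\<^sub>n]\<close> is the Taylor coefficient \<open>Q\<^sub>n(\<^bold>sv\<^sub>1 \<otimes> \<dots> \<otimes> \<^bold>sv\<^sub>n)\<close>.
\<close>

record ('k, 'v) ainf = "('k, 'v) graded_space" +
  coeff_Q :: "'v list \<Rightarrow> 'v"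

text \<open>
  The coderivation \<open>Q = \<Sum> 1\<^sup>\<otimes>\<^sup>i \<otimes> Q\<^sub>j \<otimes> 1\<^sup>\<otimes>\<^sup>k\<close>. As \<open>Q\<close> has degree 1, moving it past a
  factor \<open>\<^bold>sv\<close> produces the sign \<open>(-1)\<^sup>|\<^sup>v\<^sup>|\<^sup>-\<^sup>1\<close>, that is \<open>v \<mapsto> - deg_sign v\<close>.
\<close>

definition codiff ::
    "('k::field, 'v::ab_group_add, 'm) ainf_scheme \<Rightarrow> ('v list \<Rightarrow>\<^sub>0 'k) \<Rightarrow> ('v list \<Rightarrow>\<^sub>0 'k)"
  where "codiff A = free_lin (\<lambda>w.
    \<Sum>(u, b, v) | u @ b @ v = w \<and> b \<noteq> [].
      free_of (map (\<lambda>x. - deg_sign A x) u @ [coeff_Q A b] @ v))"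

definition ainf_morphism ::
    "('k::field, 'v::ab_group_add, 'm) ainf_scheme \<Rightarrow> ('k, 'w::ab_group_add, 'n) ainf_scheme \<Rightarrow>
      (('v list \<Rightarrow>\<^sub>0 'k) \<Rightarrow> ('w list \<Rightarrow>\<^sub>0 'k)) \<Rightarrow> bool"
  where "ainf_morphism A B F \<longleftrightarrow>
    coalgebra_morphism A B F \<and> same_map B (F \<circ> codiff A) (codiff B \<circ> F)"

definition ainf_of_dga ::
    "('k, 'v::ab_group_add) graded_space \<Rightarrow> ('v \<Rightarrow> 'v) \<Rightarrow> ('v \<Rightarrow> 'v \<Rightarrow> 'v) \<Rightarrow> ('k, 'v) ainf"
  where "ainf_of_dga V d m = \<lparr>scal = scal V, proj = proj V,
    coeff_Q = (\<lambda>vs. case vs of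
        [a] \<Rightarrow> - d a
      | [a, b] \<Rightarrow> m (deg_sign V a) b
      | _ \<Rightarrow> 0)\<rparr>"


section \<open>Forms on the interval\<close>

text \<open>
  Both algebras of forms, and the Whitney forms, live in degrees 0 and 1; a form is a pair of
  its 0-form part and its 1-form part.
\<close>

definition proj01 :: "int \<Rightarrow> 'p::zero \<times> 'q::zero \<Rightarrow> 'p \<times> 'q"
  where "proj01 i x = (if i = 0 then (fst x, 0) else if i = 1 then (0, snd x) else (0, 0))"

definition zero_form :: "'p \<times> 'q::zero \<Rightarrow> bool"
  where "zero_form x \<longleftrightarrow> snd x = 0"

text \<open>
  The functions on the interval: scalar multiplication, derivative, evaluation at a point,
  \<open>\<integral>\<^sub>0\<^sup>1 a(t) dt\<close>, the integral of \<open>a\<^sub>1(t\<^sub>1) \<cdots> a\<^sub>n(t\<^sub>n)\<close> over the simplex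
  \<open>0 \<le> t\<^sub>1 \<le> \<dots> \<le> t\<^sub>n \<le> 1\<close>, and the function given by a polynomial.
\<close>

record (overloaded) ('k, 'f) interval_functions =
  fn_scale :: "'k \<Rightarrow> 'f \<Rightarrow> 'f"
  fn_deriv :: "'f \<Rightarrow> 'f"
  fn_eval :: "'f \<Rightarrow> 'k \<Rightarrow> 'k"
  fn_integral :: "'f \<Rightarrow> 'k"
  fn_simplex_integral :: "'f list \<Rightarrow> 'k"
  fn_of_poly :: "'k poly \<Rightarrow> 'f"

subsection \<open>Polynomial functions\<close>

definition poly_antideriv :: "'k::field_char_0 poly \<Rightarrow> 'k poly"
  where "poly_antideriv p = (\<Sum>i\<le>degree p. monom (coeff p i / of_nat (Suc i)) (Suc i))"

text \<open>
  The formal simplex integral is computed from the innermost variable \<open>t\<^sub>1\<close> outwards: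
  \<open>I\<^sub>0 = 1\<close>, \<open>I\<^sub>k(x) = \<integral>\<^sub>0\<^sup>x I\<^sub>k\<^sub>-\<^sub>1(t) a\<^sub>k(t) dt\<close>, and the value is \<open>I\<^sub>n(1)\<close>.
\<close>

definition polynomial_functions :: "('k::field_char_0, 'k poly) interval_functions"
  where "polynomial_functions = \<lparr>
    fn_scale = smult,
    fn_deriv = pderiv,
    fn_eval = poly,
    fn_integral = (\<lambda>a. poly (poly_antideriv a) 1),
    fn_simplex_integral = (\<lambda>as. poly (foldl (\<lambda>I a. poly_antideriv (I * a)) 1 as) 1),
    fn_of_poly = (\<lambda>p. p)\<rparr>"

subsection \<open>Smooth functions\<close>

text \<open>
  Derivatives at the end points are one-sided. Functions on \<open>[0,1]\<close> are represented by their
  extension by 0, so that equality in the type is equality on \<open>[0,1]\<close>.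
\<close>

definition smooth01 :: "(real \<Rightarrow> real) \<Rightarrow> bool"
  where "smooth01 f \<longleftrightarrow> (\<exists>D. D 0 = f \<and>
    (\<forall>n. \<forall>x\<in>{0..1}. (D n has_real_derivative D (Suc n) x) (at x within {0..1})))"

lemma smooth01_cong:
  assumes "smooth01 f" "\<And>x. x \<in> {0..1} \<Longrightarrow> f x = g x"
  shows "smooth01 g"
proof -
  obtain D where D: "D 0 = f"
    "\<And>n x. x \<in> {0..1} \<Longrightarrow> (D n has_real_derivative D (Suc n) x) (at x within {0..1})"
    using assms(1) unfolding smooth01_def by blast
  define E where "E n = (if n = 0 then g else D n)" for n
  have "(E n has_real_derivative E (Suc n) x) (at x within {0..1})" if "x \<in> {0..1}" for n x
  proof (cases n)
    case 0
    show ?thesis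
      using has_field_derivative_transform_within[OF D(2)[OF that, of 0] zero_less_one that]
        D(1) assms(2) by (simp add: E_def 0)
  next
    case (Suc m)
    then show ?thesis using D(2)[OF that] by (simp add: E_def)
  qed
  then show ?thesis unfolding smooth01_def by (intro exI[of _ E]) (simp add: E_def)
qed

lemma smooth01_0: "smooth01 (\<lambda>x. 0)"
  unfolding smooth01_def by (rule exI[of _ "\<lambda>n x. 0"]) auto

lemma smooth01_add:
  assumes "smooth01 f" "smooth01 g" shows "smooth01 (\<lambda>x. f x + g x)"
proof -
  obtain D E where "D 0 = f" "E 0 = g"
    "\<And>n x. x \<in> {0..1} \<Longrightarrow> (D n has_real_derivative D (Suc n) x) (at x within {0..1})"
    "\<And>n x. x \<in> {0..1} \<Longrightarrow> (E n has_real_derivative E (Suc n) x) (at x within {0..1})"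
    using assms unfolding smooth01_def by blast
  then show ?thesis unfolding smooth01_def
    by (intro exI[of _ "\<lambda>n x. D n x + E n x"]) (auto intro: DERIV_add)
qed

lemma smooth01_cmult:
  assumes "smooth01 f" shows "smooth01 (\<lambda>x. c * f x)"
proof -
  obtain D where "D 0 = f"
    "\<And>n x. x \<in> {0..1} \<Longrightarrow> (D n has_real_derivative D (Suc n) x) (at x within {0..1})"
    using assms unfolding smooth01_def by blast
  then show ?thesis unfolding smooth01_def
    by (intro exI[of _ "\<lambda>n x. c * D n x"]) (auto intro: DERIV_cmult)
qed

lemma smooth01_mult:
  assumes "smooth01 f" "smooth01 g" shows "smooth01 (\<lambda>x. f x * g x)"
proof -
  obtain D E where D: "D 0 = f" and E: "E 0 = g"
    and D': "\<And>n x. x \<in> {0..1} \<Longrightarrow> (D n has_real_derivative D (Suc n) x) (at x within {0..1})"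
    and E': "\<And>n x. x \<in> {0..1} \<Longrightarrow> (E n has_real_derivative E (Suc n) x) (at x within {0..1})"
    using assms unfolding smooth01_def by blast
  define S where "S ps x = (\<Sum>(i, j)\<leftarrow>ps. D i x * E j x)" for ps :: "(nat \<times> nat) list" and x
  define step where "step ps = concat (map (\<lambda>(i, j). [(Suc i, j), (i, Suc j)]) ps)"
    for ps :: "(nat \<times> nat) list"
  have der: "(S ps has_real_derivative S (step ps) x) (at x within {0..1})"
    if "x \<in> {0..1}" for ps x
  proof (induction ps)
    case Nil
    show ?case by (simp add: S_def step_def)
  next
    case (Cons p ps)
    obtain i j where p: "p = (i, j)" by (cases p)
    have "((\<lambda>x. D i x * E j x + S ps x) has_real_derivative
        (D (Suc i) x * E j x + E (Suc j) x * D i x) + S (step ps) x) (at x within {0..1})"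
      by (rule DERIV_add[OF DERIV_mult[OF D'[OF that] E'[OF that]] Cons.IH])
    moreover have "S (p # ps) = (\<lambda>x. D i x * E j x + S ps x)"
      by (simp add: S_def p fun_eq_iff)
    moreover have "S (step (p # ps)) x =
        (D (Suc i) x * E j x + E (Suc j) x * D i x) + S (step ps) x"
      by (simp add: S_def step_def p)
    ultimately show ?case by simp
  qed
  have "S [(0, 0)] = (\<lambda>x. f x * g x)" by (simp add: S_def D E fun_eq_iff)
  then show ?thesis unfolding smooth01_def
    by (intro exI[of _ "\<lambda>n. S ((step ^^ n) [(0, 0)])"]) (auto intro: der)
qed

lemma smooth01_deriv:
  assumes "smooth01 f"
  shows "smooth01 (\<lambda>x. if x \<in> {0..1} then vector_derivative f (at x within {0..1}) else 0)"
proof -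
  obtain D where D: "D 0 = f"
    "\<And>n x. x \<in> {0..1} \<Longrightarrow> (D n has_real_derivative D (Suc n) x) (at x within {0..1})"
    using assms unfolding smooth01_def by blast
  have smooth: "smooth01 (D (Suc 0))"
    unfolding smooth01_def using D(2) by (intro exI[of _ "\<lambda>n. D (Suc n)"]) auto
  have "D (Suc 0) x = vector_derivative f (at x within {0..1})" if "x \<in> {0..1}" for x
    using vector_derivative_within_cbox[of 0 1 x f "D (Suc 0) x"] D(2)[OF that, of 0] D(1) that
    by (simp add: has_real_derivative_iff_has_vector_derivative)
  then show ?thesis by (intro smooth01_cong[OF smooth]) simp
qed

lemma smooth01_poly: "smooth01 (poly p)"
  unfolding smooth01_def
  by (rule exI[of _ "\<lambda>n. poly ((pderiv ^^ n) p)"])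
    (auto intro: has_field_derivative_at_within poly_DERIV)

typedef smooth = "{f. smooth01 f \<and> (\<forall>x. x \<notin> {0..1} \<longrightarrow> f x = 0)}"
  morphisms smooth_eval Abs_smooth
  using smooth01_0 by blast

setup_lifting type_definition_smooth

instantiation smooth :: comm_ring
begin

lift_definition zero_smooth :: smooth is "\<lambda>x. 0" by (simp add: smooth01_0)

lift_definition plus_smooth :: "smooth \<Rightarrow> smooth \<Rightarrow> smooth" is "\<lambda>f g x. f x + g x"
  by (simp add: smooth01_add)

lift_definition uminus_smooth :: "smooth \<Rightarrow> smooth" is "\<lambda>f x. - f x"
  using smooth01_cmult[of _ "-1"] by simp

lift_definition minus_smooth :: "smooth \<Rightarrow> smooth \<Rightarrow> smooth" is "\<lambda>f g x. f x - g x"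
  using smooth01_add[OF _ smooth01_cmult[of _ "-1"]] by simp

lift_definition times_smooth :: "smooth \<Rightarrow> smooth \<Rightarrow> smooth" is "\<lambda>f g x. f x * g x"
  by (simp add: smooth01_mult)

instance
  by standard (transfer, simp add: fun_eq_iff algebra_simps)+

end

lift_definition smooth_scale :: "real \<Rightarrow> smooth \<Rightarrow> smooth" is "\<lambda>c f x. c * f x"
  by (simp add: smooth01_cmult)

lift_definition smooth_deriv :: "smooth \<Rightarrow> smooth"
  is "\<lambda>f x. if x \<in> {0..1} then vector_derivative f (at x within {0..1}) else 0"
  using smooth01_deriv by auto

lift_definition smooth_of_poly :: "real poly \<Rightarrow> smooth"
  is "\<lambda>p x. if x \<in> {0..1} then poly p x else 0"
  by (auto intro: smooth01_cong[OF smooth01_poly])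

definition ordered_simplex :: "nat \<Rightarrow> (nat \<Rightarrow> real) set"
  where "ordered_simplex n = {t. (\<forall>i<n. 0 \<le> t i \<and> t i \<le> 1) \<and> (\<forall>i<n. \<forall>j<n. i \<le> j \<longrightarrow> t i \<le> t j)}"

definition smooth_functions :: "(real, smooth) interval_functions"
  where "smooth_functions = \<lparr>
    fn_scale = smooth_scale,
    fn_deriv = smooth_deriv,
    fn_eval = smooth_eval,
    fn_integral = (\<lambda>a. integral {0..1} (smooth_eval a)),
    fn_simplex_integral = (\<lambda>as. LINT t | PiM {..<length as} (\<lambda>_. lborel).
      indicator (ordered_simplex (length as)) t * (\<Prod>i<length as. smooth_eval (as ! i) (t i))),
    fn_of_poly = smooth_of_poly\<rparr>"

subsection \<open>The algebra of forms\<close>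

text \<open>The pair \<open>(f, g)\<close> is the form \<open>f + g dt\<close>.\<close>

definition forms :: "('k, 'f::comm_ring) interval_functions \<Rightarrow> ('k, 'f \<times> 'f) ainf"
  where "forms M = ainf_of_dga
    \<lparr>scal = (\<lambda>c x. (fn_scale M c (fst x), fn_scale M c (snd x))), proj = proj01\<rparr>
    (\<lambda>x. (0, fn_deriv M (fst x)))
    (\<lambda>x y. (fst x * fst y, fst x * snd y + snd x * fst y))"


section \<open>The two structures on Whitney forms\<close>

text \<open>The element \<open>((a, b), c)\<close> is the Whitney form \<open>a t + b (1 - t) + c dt\<close>.\<close>

type_synonym 'k whitney = "('k \<times> 'k) \<times> 'k"

definition whitney_space :: "('k::field_char_0, 'k whitney) graded_space"
  where "whitney_space = \<lparr>scal = (\<lambda>r ((a, b), c). ((r * a, r * b), r * c)), proj = proj01\<rparr>"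

definition whitney_incl ::
    "('k::field_char_0, 'f::comm_ring) interval_functions \<Rightarrow> 'k whitney \<Rightarrow> 'f \<times> 'f"
  where "whitney_incl M = (\<lambda>((a, b), c).
    (fn_of_poly M (smult a [:0, 1:] + smult b [:1, -1:]), fn_of_poly M [:c:]))"

text \<open>
  The cup product is determined by \<open>t \<union> t = t\<close>, \<open>t \<union> dt = 0\<close>, \<open>dt \<union> t = dt\<close> and the unit
  \<open>1 = t + (1 - t)\<close>; hence \<open>(1 - t) \<union> dt = dt\<close> and \<open>dt \<union> (1 - t) = 0\<close>.
\<close>

definition C_cup :: "('k::field_char_0, 'k whitney) ainf"
  where "C_cup = ainf_of_dga whitney_space
    (\<lambda>((a, b), c). ((0, 0), a - b))
    (\<lambda>((a, b), c) ((a', b'), c'). ((a * a', b * b'), b * c' + c * a'))"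

text \<open>\<open>B\<^sub>n\<close> and \<open>B\<^sub>n(t)\<close>, from \<open>z / (e\<^sup>z - 1)\<close> and \<open>z e\<^sup>t\<^sup>z / (e\<^sup>z - 1)\<close>.\<close>

definition bernoulli_fps :: "'k::field_char_0 fps"
  where "bernoulli_fps = fps_X / (fps_exp 1 - 1)"

definition bernoulli_number :: "nat \<Rightarrow> 'k::field_char_0"
  where "bernoulli_number n = fact n * fps_nth bernoulli_fps n"

definition bernoulli_poly :: "nat \<Rightarrow> 'k::field_char_0 poly"
  where "bernoulli_poly n = smult (fact n) (fps_nth
    (Abs_fps (\<lambda>j. [:fps_nth bernoulli_fps j:]) * Abs_fps (\<lambda>j. monom (1 / fact j) j)) n)"

text \<open>
  In the basis \<open>1, t, dt\<close> the form \<open>a t + b (1 - t) + c dt\<close> is \<open>b 1 + (a - b) t + c dt\<close>.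
  The multilinear form below is \<open>wt n i\<close> on the arguments \<open>dt\<^sup>\<otimes>\<^sup>i \<otimes> t \<otimes> dt\<^sup>\<otimes>\<^sup>n\<^sup>-\<^sup>i\<close> and
  vanishes on all other words of length \<open>n + 1\<close> in these basis elements.
\<close>

definition coeff_t :: "'k::field_char_0 whitney \<Rightarrow> 'k"
  where "coeff_t x = fst (fst x) - snd (fst x)"

definition coeff_dt :: "'k::field_char_0 whitney \<Rightarrow> 'k"
  where "coeff_dt x = snd x"

definition one_function_form :: "(nat \<Rightarrow> nat \<Rightarrow> 'k) \<Rightarrow> 'k::field_char_0 whitney list \<Rightarrow> 'k"
  where "one_function_form wt xs = (let n = length xs - 1 in
    \<Sum>i\<le>n. wt n i * coeff_t (xs ! i) * (\<Prod>j\<in>{..n} - {i}. coeff_dt (xs ! j)))"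

text \<open>
  In \<open>C_inf\<close> the case of two arguments is, in the basis above, given by
  \<open>m\<^sub>2(1,x) = x\<close>, \<open>m\<^sub>2(x,1) = (-1)\<^sup>|\<^sup>x\<^sup>| x\<close>, \<open>m\<^sub>2(t,t) = t\<close>,
  \<open>m\<^sub>2(t,dt) = dt/2\<close>, \<open>m\<^sub>2(dt,t) = - dt/2\<close>.
\<close>

definition C_inf :: "('k::field_char_0, 'k whitney) ainf"
  where "C_inf = \<lparr>scal = scal whitney_space, proj = proj01,
    coeff_Q = (\<lambda>xs. case xs of
        [] \<Rightarrow> 0
      | [x] \<Rightarrow> ((0, 0), - coeff_t x)
      | [((a, b), c), ((a', b'), c')] \<Rightarrow>
          ((a * a', b * b'), (b * c' + (a - b) * c' / 2) - (c * b' + c * (a' - b') / 2))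
      | _ \<Rightarrow> ((0, 0), one_function_form
          (\<lambda>n i. (-1) ^ (i + 1) * of_nat (n choose i) * bernoulli_number n / fact n) xs))\<rparr>"


section \<open>The morphisms\<close>

definition mu ::
    "('k::field_char_0, 'f::comm_ring) interval_functions \<Rightarrow>
      ('k whitney list \<Rightarrow>\<^sub>0 'k) \<Rightarrow> (('f \<times> 'f) list \<Rightarrow>\<^sub>0 'k)"
  where "mu M = morphism_of (\<lambda>xs. case xs of
        [] \<Rightarrow> 0
      | [x] \<Rightarrow> whitney_incl M x
      | _ \<Rightarrow> let n = length xs - 1 in
          (fn_of_poly M (smult
            (one_function_form (\<lambda>n i. (-1) ^ i * of_nat (n choose i)) xs / fact (n + 1))
            (bernoulli_poly (n + 1) - [:bernoulli_number (n + 1):])), 0))"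

definition whitney_proj ::
    "('k::field_char_0, 'f::comm_ring) interval_functions \<Rightarrow> 'f \<times> 'f \<Rightarrow> 'k whitney"
  where "whitney_proj M x =
    ((fn_eval M (fst x) 1, fn_eval M (fst x) 0), fn_integral M (snd x))"

text \<open>
  For two or more factors only the 1-form parts contribute, so that the coefficient vanishes
  if some factor is a 0-form.
\<close>

definition lam ::
    "('k::field_char_0, 'f::comm_ring) interval_functions \<Rightarrow>
      (('f \<times> 'f) list \<Rightarrow>\<^sub>0 'k) \<Rightarrow> ('k whitney list \<Rightarrow>\<^sub>0 'k)"
  where "lam M = morphism_of (\<lambda>xs. case xs of
        [] \<Rightarrow> 0
      | [x] \<Rightarrow> whitney_proj M x
      | _ \<Rightarrow> ((0, 0), fn_simplex_integral M (map snd xs)))"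

definition exp_mor ::
    "('k::field_char_0, 'f::comm_ring) interval_functions \<Rightarrow>
      ('k whitney list \<Rightarrow>\<^sub>0 'k) \<Rightarrow> ('k whitney list \<Rightarrow>\<^sub>0 'k)"
  where "exp_mor M = lam M \<circ> mu M"

text \<open>The inverse is unique up to \<^const>\<open>same_map\<close>.\<close>

definition log_mor ::
    "('k::field_char_0, 'f::comm_ring) interval_functions \<Rightarrow>
      ('k whitney list \<Rightarrow>\<^sub>0 'k) \<Rightarrow> ('k whitney list \<Rightarrow>\<^sub>0 'k)"
  where "log_mor M = (SOME L. ainf_morphism C_cup C_inf L \<and>
    same_map C_inf (L \<circ> exp_mor M) id \<and> same_map C_cup (exp_mor M \<circ> L) id)"

definition phi ::
    "('k::field_char_0, 'f::comm_ring) interval_functions \<Rightarrow>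
      (('f \<times> 'f) list \<Rightarrow>\<^sub>0 'k) \<Rightarrow> ('k whitney list \<Rightarrow>\<^sub>0 'k)"
  where "phi M = log_mor M \<circ> lam M"


section \<open>The characterising property\<close>

definition ainf_with_linear_part ::
    "('k::field, 'p::ab_group_add \<times> 'q::ab_group_add, 'm) ainf_scheme \<Rightarrow>
     ('k, 'w::ab_group_add, 'n) ainf_scheme \<Rightarrow> ('p \<times> 'q \<Rightarrow> 'w) \<Rightarrow>
      ((('p \<times> 'q) list \<Rightarrow>\<^sub>0 'k) \<Rightarrow> ('w list \<Rightarrow>\<^sub>0 'k)) \<Rightarrow> bool"
  where "ainf_with_linear_part A B l F \<longleftrightarrow>
    ainf_morphism A B F \<and>
    (\<forall>x. taylor B F [x] = l x) \<and>
    (\<forall>xs. length xs \<ge> 2 \<and> (\<exists>x\<in>set xs. zero_form x) \<longrightarrow> taylor B F xs = 0)"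

definition is_the_only ::
    "('k::field, 'p::ab_group_add \<times> 'q::ab_group_add, 'm) ainf_scheme \<Rightarrow>
     ('k, 'w::ab_group_add, 'n) ainf_scheme \<Rightarrow> ('p \<times> 'q \<Rightarrow> 'w) \<Rightarrow>
      ((('p \<times> 'q) list \<Rightarrow>\<^sub>0 'k) \<Rightarrow> ('w list \<Rightarrow>\<^sub>0 'k)) \<Rightarrow> bool"
  where "is_the_only A B l G \<longleftrightarrow>
    ainf_with_linear_part A B l G \<and>
    (\<forall>F. ainf_with_linear_part A B l F \<longrightarrow> same_map B F G)"

end

theory Submission
  imports Defs
begin

text \<open>
  The uniqueness statements all come from that of \<open>\<lambda>\<close>. Let \<open>F\<close> be an \<open>A\<^sub>\<infinity>\<close> morphism from forms
  to \<open>C\<^sub>\<union>\<close> with linear part \<open>\<pi>\<close> whose higher coefficients vanish on 0-forms. Write the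
  morphism equation for the word \<open>f \<otimes> a\<^sub>2 dt \<otimes> \<dots> \<otimes> a\<^sub>n dt\<close> with \<open>f\<close> a function. Nearly every
  term contains a coefficient of order at least two with a 0-form among its arguments, and if
  \<open>f(0) = 0\<close> what remains is \<open>F\<^sub>n(f' dt, a\<^sub>2 dt, a\<^sub>3 dt, \<dots>) = F\<^sub>n\<^sub>-\<^sub>1(f a\<^sub>2 dt, a\<^sub>3 dt, \<dots>)\<close>.
  Taking for \<open>f\<close> the antiderivative of \<open>a\<^sub>1\<close> removes one argument at a time, so that \<open>F\<^sub>n\<close> has
  to be the iterated integral over the ordered simplex (\<open>taylor_unique\<close>). Conversely, for the
  iterated integrals the morphism equation on an arbitrary word is Stokes' theorem on the
  simplex (\<open>stokes\<close>, \<open>lam_coeffs_equation\<close>).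

  For \<open>n \<ge> 2\<close> the coefficient \<open>\<mu>\<^sub>n\<close> takes values in functions that vanish at both end points,
  since \<open>B\<^sub>n(1) = B\<^sub>n(0)\<close>. Hence only \<open>\<mu>\<^sub>1\<close> contributes to \<open>\<lambda> \<circ> \<mu>\<close>, and the coefficients of
  \<open>exp\<close> are \<open>dt\<^sup>\<otimes>\<^sup>n \<mapsto> dt / n!\<close> (\<open>exp_coeffs\<close>). That these define an \<open>A\<^sub>\<infinity>\<close> morphism is a family
  of identities between Bernoulli numbers, the coefficients of \<open>(y / (e\<^sup>y - 1)) (e\<^sup>z - e\<^sup>x\<^sup>z)
  = y e\<^sup>x\<^sup>z\<close>, where \<open>y = (1 - x) z\<close> (\<open>bernoulli_convolution_eq\<close>, \<open>exp_coeffs_equation\<close>).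
  Coefficients that are scalar multiples of \<open>dt\<close> on \<open>dt\<^sup>\<otimes>\<^sup>n\<close> compose like power series
  (\<open>dt_coeffs_compose\<close>), so the inverse of \<open>exp\<close> has the coefficients of \<open>log (1 + z)\<close>.

  The remaining statements follow formally (\<open>exp_log_phi_only\<close>), because the vanishing
  property is preserved by composition. If \<open>F\<close> from forms to \<open>C\<^sub>\<infinity>\<close> has it, then so does \<open>exp \<circ>
  F\<close>, which is therefore \<open>\<lambda>\<close>, and \<open>F = log \<circ> \<lambda>\<close>. If \<open>F\<close> from \<open>C\<^sub>\<infinity>\<close> to \<open>C\<^sub>\<union>\<close> has it, then \<open>F \<circ>
  log \<circ> \<lambda> = \<lambda>\<close>, and composing with \<open>\<mu>\<close> gives \<open>F = exp\<close>.

  Tensor coalgebras are represented by combinations of words modulo multilinearity. Two facts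
  make this manageable: a coalgebra morphism agrees modulo multilinearity with the sum over
  cuttings into blocks given by its Taylor coefficients (\<open>coalgebra_morphism_determined\<close>), and
  the commutation with the codifferentials may be checked after projection to words of length
  one (\<open>ainf_morphism_morphism_of\<close>, \<open>ainf_morphism_taylor\<close>).
\<close>

section \<open>Linear maps between free vector spaces\<close>

lemma lookup_free_scale [simp]:
  "Poly_Mapping.lookup (free_scale c x) a = c * Poly_Mapping.lookup x a"
  by (simp add: free_scale_def Poly_Mapping.map.rep_eq when_def)

interpretation free: vector_space "free_scale :: 'k::field \<Rightarrow> ('a \<Rightarrow>\<^sub>0 'k) \<Rightarrow> _"
  by unfold_locales (auto simp: poly_mapping_eq_iff fun_eq_iff lookup_add algebra_simps)

lemma free_scale_single [simp]:
  "free_scale c (Poly_Mapping.single a d) = Poly_Mapping.single a (c * d)"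
  by (rule poly_mapping_eqI) (simp add: lookup_single when_def)

abbreviation free_linear :: "(('a \<Rightarrow>\<^sub>0 'k::field) \<Rightarrow> ('b \<Rightarrow>\<^sub>0 'k)) \<Rightarrow> bool"
  where "free_linear \<equiv> Vector_Spaces.linear free_scale free_scale"

lemma free_linearI:
  assumes "\<And>x y. F (x + y) = F x + F y" "\<And>c x. F (free_scale c x) = free_scale c (F x)"
  shows "free_linear F"
  using assms by unfold_locales auto

lemma free_linear_add: "free_linear F \<Longrightarrow> F (x + y) = F x + F y"
  and free_linear_scale: "free_linear F \<Longrightarrow> F (free_scale c x) = free_scale c (F x)"
  and free_linear_diff: "free_linear F \<Longrightarrow> F (x - y) = F x - F y"
  and free_linear_sum: "free_linear F \<Longrightarrow> F (\<Sum>i\<in>I. h i) = (\<Sum>i\<in>I. F (h i))"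
  and free_linear_0: "free_linear F \<Longrightarrow> F 0 = 0"
proof -
  assume "free_linear F"
  then interpret Vector_Spaces.linear free_scale free_scale F .
  show "F (x + y) = F x + F y" "F (free_scale c x) = free_scale c (F x)" "F (x - y) = F x - F y"
    "F (\<Sum>i\<in>I. h i) = (\<Sum>i\<in>I. F (h i))" "F 0 = 0"
    by (rule add scale diff sum zero)+
qed

lemma free_expand: "x = (\<Sum>a\<in>Poly_Mapping.keys x. free_scale (Poly_Mapping.lookup x a) (free_of a))"
  by (rule poly_mapping_eqI) (simp add: lookup_sum lookup_single when_def in_keys_iff)

lemma free_lin_superset:
  assumes "finite A" "Poly_Mapping.keys x \<subseteq> A"
  shows "free_lin g x = (\<Sum>a\<in>A. free_scale (Poly_Mapping.lookup x a) (g a))"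
  unfolding free_lin_def using assms
  by (intro sum.mono_neutral_left) (auto simp: in_keys_iff)

lemma free_linear_free_lin: "free_linear (free_lin (g :: 'a \<Rightarrow> ('b \<Rightarrow>\<^sub>0 'k::field)))"
proof (rule free_linearI)
  fix x y :: "'a \<Rightarrow>\<^sub>0 'k" and c
  let ?A = "Poly_Mapping.keys x \<union> Poly_Mapping.keys y"
  have A: "finite ?A" "Poly_Mapping.keys x \<subseteq> ?A" "Poly_Mapping.keys y \<subseteq> ?A"
    "Poly_Mapping.keys (x + y) \<subseteq> ?A"
    using keys_add[of x y] by auto
  show "free_lin g (x + y) = free_lin g x + free_lin g y"
    unfolding free_lin_superset[OF A(1,2)] free_lin_superset[OF A(1,3)] free_lin_superset[OF A(1,4)]
    by (simp add: lookup_add free.scale_left_distrib sum.distrib)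
  have B: "Poly_Mapping.keys (free_scale c x) \<subseteq> Poly_Mapping.keys x"
    by (auto simp: in_keys_iff)
  show "free_lin g (free_scale c x) = free_scale c (free_lin g x)"
    unfolding free_lin_superset[OF finite_keys B] free_lin_def[of g x]
    by (simp add: free.scale_sum_right)
qed

lemma free_lin_of [simp]: "free_lin g (free_of a) = g a"
  by (simp add: free_lin_def)

lemma free_linear_expand:
  "free_linear F \<Longrightarrow>
    F x = (\<Sum>a\<in>Poly_Mapping.keys x. free_scale (Poly_Mapping.lookup x a) (F (free_of a)))"
  by (subst (1) free_expand) (simp only: free_linear_sum free_linear_scale)

text \<open>
  Applied to a difference of two maps, this reduces congruences between linear maps modulo a
  subspace to the basis.
\<close>

lemma free_linear_in_subspace:
  assumes "free_linear F" "free.subspace S" "\<And>a. a \<in> Poly_Mapping.keys x \<Longrightarrow> F (free_of a) \<in> S"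
  shows "F x \<in> S"
proof -
  have "F x = (\<Sum>a\<in>Poly_Mapping.keys x. free_scale (Poly_Mapping.lookup x a) (F (free_of a)))"
    by (rule free_linear_expand[OF assms(1)])
  also have "\<dots> \<in> S"
    by (intro free.subspace_sum[OF assms(2)] free.subspace_scale[OF assms(2)] assms(3))
  finally show ?thesis .
qed

lemma free_linear_diff_fun:
  "free_linear F \<Longrightarrow> free_linear G \<Longrightarrow> free_linear (\<lambda>x. F x - G x)"
  by (intro free_linearI)
    (simp_all add: free_linear_add free_linear_scale free.scale_right_diff_distrib)

lemma free_linear_scale_fun: "free_linear F \<Longrightarrow> free_linear (\<lambda>x. free_scale c (F x))"
  by (intro free_linearI)
    (simp_all add: free_linear_add free_linear_scale free.scale_right_distrib mult.commute)

lemma free_linear_compose: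
  "free_linear F \<Longrightarrow> free_linear G \<Longrightarrow> free_linear (\<lambda>x. F (G x))"
  by (intro free_linearI) (simp_all add: free_linear_add free_linear_scale)

lemma free_linear_eqI:
  assumes "free_linear F" "free_linear G"
    "\<And>a. a \<in> Poly_Mapping.keys x \<Longrightarrow> F (free_of a) = G (free_of a)"
  shows "F x = G x"
  using free_linear_in_subspace[OF free_linear_diff_fun[OF assms(1,2)], of "{0}" x] assms(3)
  by simp

lemma free_linear_span:
  assumes "free_linear F" "free.subspace S" "\<And>x. x \<in> R \<Longrightarrow> F x \<in> S" "x \<in> free.span R"
  shows "F x \<in> S"
proof -
  interpret Vector_Spaces.linear free_scale free_scale F by fact
  have "R \<subseteq> {x. F x \<in> S}" using assms(3) by auto
  then have "free.span R \<subseteq> {x. F x \<in> S}"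
    by (rule free.span_minimal) (rule subspace_vimage[unfolded vimage_def, OF assms(2)])
  then show ?thesis using assms(4) by auto
qed

lemma tensor_bilinear:
  fixes x :: "'a \<Rightarrow>\<^sub>0 'k::field" and y :: "'b \<Rightarrow>\<^sub>0 'k"
  shows "free_linear (\<lambda>y :: 'b \<Rightarrow>\<^sub>0 'k. tensor x y)" and "free_linear (\<lambda>x :: 'a \<Rightarrow>\<^sub>0 'k. tensor x y)"
proof -
  have t1: "tensor x y = free_lin (\<lambda>a. free_lin (\<lambda>b. free_of (a, b)) y) x"
    for x :: "'a \<Rightarrow>\<^sub>0 'k::field" and y :: "'b \<Rightarrow>\<^sub>0 'k"
    by (simp add: tensor_def free_lin_def free.scale_sum_right)
  have t2: "tensor x y = free_lin (\<lambda>b. free_lin (\<lambda>a. free_of (a, b)) x) y"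
    for x :: "'a \<Rightarrow>\<^sub>0 'k::field" and y :: "'b \<Rightarrow>\<^sub>0 'k"
    by (simp add: tensor_def free_lin_def free.scale_sum_right mult.commute)
       (rule sum.swap)
  have "(tensor x :: ('b \<Rightarrow>\<^sub>0 'k) \<Rightarrow> _) = free_lin (\<lambda>b. free_lin (\<lambda>a. free_of (a, b)) x)"
    by (rule ext) (rule t2)
  then show "free_linear (\<lambda>y :: 'b \<Rightarrow>\<^sub>0 'k. tensor x y)" by (simp only: free_linear_free_lin)
  show "free_linear (\<lambda>x :: 'a \<Rightarrow>\<^sub>0 'k. tensor x y)" unfolding t1 by (rule free_linear_free_lin)
qed

lemma tensor_of [simp]: "tensor (free_of a) (free_of b) = free_of (a, b)"
  by (simp add: tensor_def)

section \<open>Sums over the ways of cutting a word\<close>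

text \<open>
  Four kinds of sums over decompositions of a word \<open>w\<close> recur: over \<open>w = uv\<close>; over \<open>w = uv\<close>
  with \<open>u\<close> nonempty; over \<open>w = ubv\<close> with \<open>b\<close> nonempty; and over the cuttings of \<open>w\<close> into
  nonempty blocks. A fifth, over the letters of \<open>w\<close>, appears below. All exchanges of such sums
  are obtained from their recursions along the first letter or the first block.
\<close>

definition cut_sum :: "('a list \<Rightarrow> 'a list \<Rightarrow> 'c::comm_monoid_add) \<Rightarrow> 'a list \<Rightarrow> 'c"
  where "cut_sum g w = (\<Sum>(u, v) | u @ v = w. g u v)"

definition head_sum :: "('a list \<Rightarrow> 'a list \<Rightarrow> 'c::comm_monoid_add) \<Rightarrow> 'a list \<Rightarrow> 'c"
  where "head_sum g w = (\<Sum>(u, v) | u @ v = w \<and> u \<noteq> []. g u v)"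

definition infix_sum :: "('a list \<Rightarrow> 'a list \<Rightarrow> 'a list \<Rightarrow> 'c::comm_monoid_add) \<Rightarrow> 'a list \<Rightarrow> 'c"
  where "infix_sum g w = (\<Sum>(u, b, v) | u @ b @ v = w \<and> b \<noteq> []. g u b v)"

definition block_sum :: "('a list list \<Rightarrow> 'c::comm_monoid_add) \<Rightarrow> 'a list \<Rightarrow> 'c"
  where "block_sum g w = (\<Sum>bs | concat bs = w \<and> [] \<notin> set bs. g bs)"

lemma length_le_concat: "[] \<notin> set bs \<Longrightarrow> length bs \<le> length (concat bs)"
proof (induction bs)
  case (Cons b bs)
  then show ?case by (cases b) auto
qed simp

lemma finite_splits: "finite {(u, v). u @ v = w}"
proof (rule finite_subset)
  have "(u, v) \<in> (\<lambda>i. (take i w, drop i w)) ` {..length w}" if "u @ v = w" for u v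
    using that by (intro image_eqI[where x = "length u"]) auto
  then show "{(u, v). u @ v = w} \<subseteq> (\<lambda>i. (take i w, drop i w)) ` {..length w}"
    by auto
qed simp

lemma finite_first: "finite {(u, v). u @ v = w \<and> u \<noteq> []}"
  by (rule finite_subset[OF _ finite_splits[of w]]) auto

lemma finite_sub: "finite {(u, b, v). u @ b @ v = w \<and> b \<noteq> []}"
proof (rule finite_subset)
  let ?f = "\<lambda>(i, j). (take i w, take j (drop i w), drop j (drop i w))"
  have "(u, b, v) \<in> ?f ` ({..length w} \<times> {..length w})" if "u @ b @ v = w" for u b v
    using that by (intro image_eqI[where x = "(length u, length b)"]) auto
  then show "{(u, b, v). u @ b @ v = w \<and> b \<noteq> []} \<subseteq> ?f ` ({..length w} \<times> {..length w})"
    by auto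
qed simp

lemma finite_blocks: "finite {bs. concat bs = w \<and> [] \<notin> set bs}"
proof (rule finite_subset)
  let ?B = "{b. set b \<subseteq> set w \<and> length b \<le> length w}"
  have "length b \<le> length (concat bs)" if "b \<in> set bs" for b :: "'a list" and bs
    using that by (induction bs) auto
  then show "{bs. concat bs = w \<and> [] \<notin> set bs} \<subseteq> {bs. set bs \<subseteq> ?B \<and> length bs \<le> length w}"
    using length_le_concat by auto
  show "finite {bs. set bs \<subseteq> ?B \<and> length bs \<le> length w}"
    by (intro finite_lists_length_le) auto
qed

lemma head_sum_Nil [simp]: "head_sum g [] = 0"
  unfolding head_sum_def by (rule sum.neutral) auto

lemma cut_sum_Nil [simp]: "cut_sum g [] = g [] []"
proof -
  have "{(u, v). u @ v = ([] :: 'a list)} = {([], [])}" by auto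
  then show ?thesis by (simp add: cut_sum_def)
qed

lemma infix_sum_Nil [simp]: "infix_sum g [] = 0"
  unfolding infix_sum_def by (rule sum.neutral) auto

lemma block_sum_Nil [simp]:
  fixes g :: "'a list list \<Rightarrow> 'c::comm_monoid_add"
  shows "block_sum g [] = g []"
proof -
  have "bs = []" if "concat bs = []" "[] \<notin> set bs" for bs :: "'a list list"
    using that by (cases bs) auto
  then have eq: "{bs. concat bs = ([] :: 'a list) \<and> [] \<notin> set bs} = {[]}" by auto
  show ?thesis unfolding block_sum_def eq by simp
qed

lemma head_sum_Cons: "head_sum g (x # w) = cut_sum (\<lambda>u v. g (x # u) v) w"
proof -
  have "{(u, v). u @ v = x # w \<and> u \<noteq> []} = (\<lambda>(u, v). (x # u, v)) ` {(u, v). u @ v = w}"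
    by (auto simp: Cons_eq_append_conv append_eq_Cons_conv)
  then show ?thesis
    by (simp add: head_sum_def cut_sum_def sum.reindex inj_on_def split_beta)
qed

lemma cut_sum_first: "cut_sum g w = g [] w + head_sum g w"
proof -
  have "{(u, v). u @ v = w} = insert ([], w) {(u, v). u @ v = w \<and> u \<noteq> []}" by auto
  then show ?thesis
    by (simp add: cut_sum_def head_sum_def finite_first)
qed

lemma infix_sum_Cons:
  "infix_sum g (x # w) = head_sum (g []) (x # w) + infix_sum (\<lambda>u b v. g (x # u) b v) w"
proof -
  let ?A = "{(u, b, v). u @ b @ v = x # w \<and> b \<noteq> []}"
  let ?B = "(\<lambda>(b, v). ([], b, v)) ` {(b, v). b @ v = x # w \<and> b \<noteq> []}"
  let ?C = "(\<lambda>(u, b, v). (x # u, b, v)) ` {(u, b, v). u @ b @ v = w \<and> b \<noteq> []}"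
  have eq: "?A = ?B \<union> ?C"
  proof (intro equalityI subsetI)
    fix t assume "t \<in> ?A"
    then obtain u b v where t: "t = (u, b, v)" "u @ b @ v = x # w" "b \<noteq> []" by auto
    then show "t \<in> ?B \<union> ?C"
      by (cases u) (auto intro: image_eqI[where x = "(b, v)"] image_eqI[where x = "(tl u, b, v)"])
  qed auto
  have dis: "?B \<inter> ?C = {}" by auto
  have fin: "finite ?B" "finite ?C" using finite_first finite_sub by auto
  have "infix_sum g (x # w) = (\<Sum>(u, b, v)\<in>?B. g u b v) + (\<Sum>(u, b, v)\<in>?C. g u b v)"
    unfolding infix_sum_def eq by (rule sum.union_disjoint[OF fin dis])
  then show ?thesis
    by (simp add: head_sum_def infix_sum_def sum.reindex inj_on_def split_beta)
qed

lemma cut_sum_cong: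
  "(\<And>u v. u @ v = w \<Longrightarrow> g u v = h u v) \<Longrightarrow> cut_sum g w = cut_sum h w"
  unfolding cut_sum_def by (intro sum.cong) auto

lemma head_sum_cong:
  "(\<And>u v. u @ v = w \<Longrightarrow> u \<noteq> [] \<Longrightarrow> g u v = h u v) \<Longrightarrow> head_sum g w = head_sum h w"
  unfolding head_sum_def by (intro sum.cong) auto

lemma infix_sum_cong:
  "(\<And>u b v. u @ b @ v = w \<Longrightarrow> b \<noteq> [] \<Longrightarrow> g u b v = h u b v) \<Longrightarrow> infix_sum g w = infix_sum h w"
  unfolding infix_sum_def by (intro sum.cong) auto

lemma block_sum_cong:
  "(\<And>bs. concat bs = w \<Longrightarrow> [] \<notin> set bs \<Longrightarrow> g bs = h bs) \<Longrightarrow> block_sum g w = block_sum h w"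
  unfolding block_sum_def by (intro sum.cong) auto

lemma cut_sum_add: "cut_sum (\<lambda>u v. g u v + h u v) w = cut_sum g w + cut_sum h w"
  by (simp add: cut_sum_def sum.distrib split_beta)

lemma head_sum_add: "head_sum (\<lambda>u v. g u v + h u v) w = head_sum g w + head_sum h w"
  by (simp add: head_sum_def sum.distrib split_beta)

lemma infix_sum_add: "infix_sum (\<lambda>u b v. g u b v + h u b v) w = infix_sum g w + infix_sum h w"
  by (simp add: infix_sum_def sum.distrib split_beta)

lemma block_sum_add: "block_sum (\<lambda>bs. g bs + h bs) w = block_sum g w + block_sum h w"
  by (simp add: block_sum_def sum.distrib)

lemma head_sum_0 [simp]: "head_sum (\<lambda>u v. 0) w = 0"
  by (simp add: head_sum_def split_beta)

lemma infix_sum_0 [simp]: "infix_sum (\<lambda>u b v. 0) w = 0"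
  by (simp add: infix_sum_def split_beta)

lemma block_sum_0 [simp]: "block_sum (\<lambda>bs. 0) w = 0"
  by (simp add: block_sum_def)

lemma head_sum_hom:
  assumes "H 0 = 0" "\<And>x y. H (x + y) = H x + H y"
  shows "H (head_sum g w) = head_sum (\<lambda>u v. H (g u v)) w"
  unfolding head_sum_def by (subst sum_comp_morphism[OF assms, symmetric]) (auto intro: sum.cong)

lemma block_sum_hom:
  assumes "H 0 = 0" "\<And>x y. H (x + y) = H x + H y"
  shows "H (block_sum g w) = block_sum (\<lambda>bs. H (g bs)) w"
  unfolding block_sum_def by (subst sum_comp_morphism[OF assms, symmetric]) (auto intro: sum.cong)

lemma infix_sum_hom:
  assumes "H 0 = 0" "\<And>x y. H (x + y) = H x + H y"
  shows "H (infix_sum g w) = infix_sum (\<lambda>u b v. H (g u b v)) w"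
  unfolding infix_sum_def by (subst sum_comp_morphism[OF assms, symmetric]) (auto intro: sum.cong)

lemma free_linear_head_sum:
    "free_linear H \<Longrightarrow> H (head_sum g w) = head_sum (\<lambda>u v. H (g u v)) w"
  and free_linear_block_sum:
    "free_linear H \<Longrightarrow> H (block_sum h w) = block_sum (\<lambda>bs. H (h bs)) w"
  and free_linear_infix_sum:
    "free_linear H \<Longrightarrow> H (infix_sum k w) = infix_sum (\<lambda>u b v. H (k u b v)) w"
  by (intro head_sum_hom block_sum_hom infix_sum_hom; simp add: free_linear_0 free_linear_add)+

lemma head_sum_map: "head_sum g (map f w) = head_sum (\<lambda>u v. g (map f u) (map f v)) w"
  by (induction w arbitrary: g) (simp_all add: head_sum_Cons cut_sum_first)

text \<open>
  Coassociativity of deconcatenation.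
\<close>

lemma head_sum_assoc:
  "head_sum (\<lambda>b v. cut_sum (\<lambda>v1 v2. h b v1 v2) v) w =
    head_sum (\<lambda>w1 w2. head_sum (\<lambda>b v1. h b v1 w2) w1) w"
proof (induction w arbitrary: h)
  case (Cons x w)
  have "head_sum (\<lambda>b v. cut_sum (\<lambda>v1 v2. h b v1 v2) v) (x # w) =
      cut_sum (h [x]) w + head_sum (\<lambda>w1 w2. head_sum (\<lambda>b v1. h (x # b) v1 w2) w1) w"
    unfolding head_sum_Cons cut_sum_first[of "\<lambda>u v. cut_sum (h (x # u)) v"] Cons.IH ..
  then show ?case
    by (simp add: head_sum_Cons cut_sum_first head_sum_add add.assoc)
qed simp

lemma head_sum_insert:
  "head_sum g (u @ x # v) =
    head_sum (\<lambda>u1 u2. g u1 (u2 @ x # v)) u + cut_sum (\<lambda>v1 v2. g (u @ x # v1) v2) v"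
  by (induction u arbitrary: g) (simp_all add: head_sum_Cons cut_sum_first add.assoc)

text \<open>
  A further cut in front of the distinguished factor \<open>b\<close> may be made first.
\<close>

lemma infix_sum_first_before:
  "infix_sum (\<lambda>u b v. head_sum (\<lambda>u1 u2. h u1 u2 b v) u) w =
    head_sum (\<lambda>u1 w'. infix_sum (\<lambda>u2 b v. h u1 u2 b v) w') w"
  by (induction w arbitrary: h)
    (simp_all add: infix_sum_Cons infix_sum_add head_sum_Cons cut_sum_first)

text \<open>
  Likewise for a cut behind the distinguished factor; here \<open>b\<close> belongs to the first part.
\<close>

lemma infix_sum_first_after:
  "infix_sum (\<lambda>u b v. cut_sum (\<lambda>v1 v2. h u b v1 v2) v) w =
    head_sum (\<lambda>w1 w2. infix_sum (\<lambda>u b v1. h u b v1 w2) w1) w"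
proof (induction w arbitrary: h)
  case (Cons x w)
  have "infix_sum (\<lambda>u b v. cut_sum (\<lambda>v1 v2. h u b v1 v2) v) (x # w) =
      head_sum (\<lambda>w1 w2. head_sum (\<lambda>b v1. h [] b v1 w2) w1) (x # w) +
      head_sum (\<lambda>w1 w2. infix_sum (\<lambda>u b v1. h (x # u) b v1 w2) w1) w"
    unfolding infix_sum_Cons Cons.IH head_sum_assoc ..
  then show ?case
    by (simp add: head_sum_Cons infix_sum_Cons cut_sum_first head_sum_add add_ac)
qed simp

lemma block_sum_first_block:
  assumes "w \<noteq> []"
  shows "block_sum g w = head_sum (\<lambda>u v. block_sum (\<lambda>bs. g (u # bs)) v) w"
proof -
  have "head_sum (\<lambda>u v. block_sum (\<lambda>bs. g (u # bs)) v) w =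
      (\<Sum>(p, bs)\<in>Sigma {(u, v). u @ v = w \<and> u \<noteq> []} (\<lambda>p. {bs. concat bs = snd p \<and> [] \<notin> set bs}).
        g (fst p # bs))"
    unfolding head_sum_def block_sum_def
    by (subst sum.Sigma[symmetric]) (auto simp: finite_first finite_blocks split_beta)
  also have "\<dots> = block_sum g w"
    unfolding block_sum_def
  proof (rule sum.reindex_bij_witness[where
        j = "\<lambda>(p, bs). fst p # bs" and i = "\<lambda>bs. ((hd bs, concat (tl bs)), tl bs)"])
    fix bs assume "bs \<in> {bs. concat bs = w \<and> [] \<notin> set bs}"
    with assms show "(case ((hd bs, concat (tl bs)), tl bs) of (p, bs) \<Rightarrow> fst p # bs) = bs"
      "((hd bs, concat (tl bs)), tl bs) \<in> Sigma {(u, v). u @ v = w \<and> u \<noteq> []}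
        (\<lambda>p. {bs. concat bs = snd p \<and> [] \<notin> set bs})"
      by (cases bs; auto)+
  qed auto
  finally show ?thesis ..
qed

text \<open>
  Cutting a list of blocks in two is the same as cutting the word in two and then cutting both
  parts into blocks: deconcatenation is compatible with \<^const>\<open>morphism_of\<close>.
\<close>

lemma block_sum_first:
  "block_sum (\<lambda>bs. head_sum h bs) w = head_sum (\<lambda>u v. block_sum (\<lambda>b. block_sum (h b) v) u) w"
proof (induction w arbitrary: h rule: length_induct)
  case (1 w)
  show ?case
  proof (cases "w = []")
    case False
    have "block_sum (\<lambda>bs. head_sum h bs) w =
        head_sum (\<lambda>u v. block_sum (\<lambda>bs. h [u] bs + head_sum (\<lambda>b c. h (u # b) c) bs) v) w"
      by (simp add: block_sum_first_block[OF False] head_sum_Cons cut_sum_first)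
    also have "\<dots> = head_sum (\<lambda>u v. block_sum (h [u]) v +
        head_sum (\<lambda>v1 v2. block_sum (\<lambda>b. block_sum (h (u # b)) v2) v1) v) w"
      unfolding block_sum_add
      by (intro head_sum_cong) (use "1.IH" in \<open>auto simp: neq_Nil_conv\<close>)
    also have "\<dots> = head_sum (\<lambda>u v.
        cut_sum (\<lambda>v1 v2. block_sum (\<lambda>b. block_sum (h (u # b)) v2) v1) v) w"
      by (simp add: cut_sum_first)
    also have "\<dots> = head_sum (\<lambda>u v. block_sum (\<lambda>b. block_sum (h b) v) u) w"
      unfolding head_sum_assoc by (intro head_sum_cong) (simp add: block_sum_first_block)
    finally show ?thesis .
  qed simp
qed

lemma head_sum_whole:
  fixes w :: "'a list"
  shows "w \<noteq> [] \<Longrightarrow> head_sum (\<lambda>u v. if v = [] then g u else 0) w = g w"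
proof -
  assume "w \<noteq> []"
  then have "head_sum (\<lambda>u v. if v = [] then g u else 0) w = (\<Sum>(u, v)\<in>{(w, [] :: 'a list)}. g u)"
    unfolding head_sum_def by (intro sum.mono_neutral_cong_right[OF finite_first]) auto
  then show ?thesis by simp
qed

lemma cut_sum_whole: "cut_sum (\<lambda>u v. if v = [] then g u else 0) w = g w"
  by (cases "w = []") (simp_all add: cut_sum_first head_sum_whole)

lemma head_sum_last:
  "length w \<ge> 2 \<Longrightarrow> head_sum (\<lambda>u v. if length v = 1 then g u v else 0) w = g (butlast w) [last w]"
proof -
  assume "length w \<ge> 2"
  then obtain u x where w: "w = u @ [x]" "u \<noteq> []"
    by (cases w rule: rev_cases; cases "butlast w") auto
  have "head_sum (\<lambda>u v. if length v = 1 then g u v else 0) w =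
      (\<Sum>(u, v)\<in>{(butlast w, [last w])}. g u v)"
    unfolding head_sum_def
    by (rule sum.mono_neutral_cong_right[OF finite_first])
      (use w in \<open>auto simp: length_Suc_conv split: if_splits\<close>)
  then show ?thesis by simp
qed

lemma head_sum_snoc: "head_sum g (w @ [x]) = head_sum (\<lambda>u v. g u (v @ [x])) w + g (w @ [x]) []"
  by (induction w arbitrary: g) (simp_all add: head_sum_Cons cut_sum_first add.assoc)

lemma cut_sum_snoc: "cut_sum g (w @ [x]) = cut_sum (\<lambda>u v. g u (v @ [x])) w + g (w @ [x]) []"
  by (simp add: cut_sum_first head_sum_snoc add.assoc)

lemma infix_sum_snoc: "infix_sum g (w @ [x]) =
    infix_sum (\<lambda>u b v. g u b (v @ [x])) w + cut_sum (\<lambda>u b. g u (b @ [x]) []) w"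
proof (induction w arbitrary: g)
  case Nil
  show ?case by (simp add: infix_sum_Cons head_sum_Cons)
next
  case (Cons y w)
  show ?case
    using head_sum_snoc[of "g []" "y # w" x]
    by (simp add: infix_sum_Cons Cons.IH cut_sum_first[of _ "y # w"] head_sum_Cons add_ac)
qed

lemma cut_sum_lengths: "cut_sum (\<lambda>u v. g (length u) (length v)) w = (\<Sum>i\<le>length w. g i (length w -
    i))"
proof (induction w arbitrary: g)
  case (Cons x w)
  have "cut_sum (\<lambda>u v. g (length u) (length v)) (x # w) =
      g 0 (Suc (length w)) + cut_sum (\<lambda>u v. g (Suc (length u)) (length v)) w"
    by (simp add: cut_sum_first[of _ "x # w"] head_sum_Cons)
  then show ?case
    by (simp only: Cons.IH[of "\<lambda>i. g (Suc i)"] sum.atMost_Suc_shift length_Cons) simp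
qed simp

lemma cut_sum_lengths_rev:
  "cut_sum (\<lambda>u v. g (length u) (length v)) w = (\<Sum>i\<le>length w. g (length w - i) i)"
  unfolding cut_sum_lengths
  by (rule sum.reindex_bij_witness[where i = "\<lambda>i. length w - i" and j = "\<lambda>i. length w - i"]) auto

definition letter_sum :: "('a list \<Rightarrow> 'a \<Rightarrow> 'a list \<Rightarrow> 'c::comm_monoid_add) \<Rightarrow> 'a list \<Rightarrow> 'c"
  where "letter_sum g w = (\<Sum>(p, x, s) | p @ x # s = w. g p x s)"

lemma finite_letters: "finite {(p, x, s). p @ x # s = w}"
proof (rule finite_subset)
  let ?f = "\<lambda>i. (take i w, w ! i, drop (Suc i) w)"
  have "(p, x, s) \<in> ?f ` {..<length w}" if "p @ x # s = w" for p x s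
    using that by (intro image_eqI[where x = "length p"]) auto
  then show "{(p, x, s). p @ x # s = w} \<subseteq> ?f ` {..<length w}" by auto
qed simp

lemma letter_sum_nth:
  "letter_sum g w = (\<Sum>i<length w. g (take i w) (w ! i) (drop (Suc i) w))"
  unfolding letter_sum_def
  by (rule sum.reindex_bij_witness[where
        i = "\<lambda>i. (take i w, w ! i, drop (Suc i) w)" and j = "\<lambda>(p, x, s). length p"])
    (auto simp: id_take_nth_drop[symmetric])

lemma letter_sum_Nil [simp]: "letter_sum g [] = 0"
  by (simp add: letter_sum_nth)

lemma letter_sum_Cons: "letter_sum g (x # w) = g [] x w + letter_sum (\<lambda>p. g (x # p)) w"
  by (simp only: letter_sum_nth length_Cons sum.lessThan_Suc_shift) simp

lemma letter_sum_cong: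
  "(\<And>p x s. p @ x # s = w \<Longrightarrow> g p x s = h p x s) \<Longrightarrow> letter_sum g w = letter_sum h w"
  unfolding letter_sum_def by (intro sum.cong) auto

lemma letter_sum_insert:
  "letter_sum g (u @ z # v) = letter_sum (\<lambda>p x s. g p x (s @ z # v)) u + g u z v +
    letter_sum (\<lambda>p x s. g (u @ z # p) x s) v"
  by (induction u arbitrary: g) (simp_all add: letter_sum_Cons add.assoc)

lemma letter_sum_last:
  "w \<noteq> [] \<Longrightarrow> letter_sum (\<lambda>p x s. if s = [] then g p x else 0) w = g (butlast w) (last w)"
  by (induction w arbitrary: g) (auto simp: letter_sum_Cons)

text \<open>
  Choosing a factor and then a letter in it amounts to choosing a letter and extending it to
  both sides.
\<close>

lemma infix_sum_letter_sum:
  "infix_sum (\<lambda>u b v. letter_sum (\<lambda>p x s. h u p x s v) b) w =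
    letter_sum (\<lambda>P x S. cut_sum (\<lambda>u p. cut_sum (\<lambda>s v. h u p x s v) S) P) w"
proof -
  have "infix_sum (\<lambda>u b v. letter_sum (\<lambda>p x s. h u p x s v) b) w =
    (\<Sum>((u, b, v), (p, x, s)) \<in> Sigma {(u, b, v). u @ b @ v = w \<and> b \<noteq> []}
      (\<lambda>(u, b, v). {(p, x, s). p @ x # s = b}). h u p x s v)"
    unfolding infix_sum_def letter_sum_def
    by (subst sum.Sigma[symmetric]) (auto simp: finite_sub finite_letters split_beta)
  also have "\<dots> = (\<Sum>((P, x, S), ((u, p), (s, v))) \<in> Sigma {(P, x, S). P @ x # S = w}
      (\<lambda>(P, x, S). {(u, p). u @ p = P} \<times> {(s, v). s @ v = S}). h u p x s v)"
    by (rule sum.reindex_bij_witness[where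
        i = "\<lambda>((P, x, S), ((u, p), (s, v))). ((u, p @ x # s, v), (p, x, s))" and
        j = "\<lambda>((u, b, v), (p, x, s)). ((u @ p, x, s @ v), ((u, p), (s, v)))"]) auto
  also have "\<dots> = letter_sum (\<lambda>P x S. cut_sum (\<lambda>u p. cut_sum (\<lambda>s v. h u p x s v) S) P) w"
    unfolding cut_sum_def letter_sum_def
    by (subst sum.Sigma[symmetric])
      (auto simp: finite_splits finite_letters split_beta sum.cartesian_product intro!: sum.cong)
  finally show ?thesis .
qed

section \<open>Combinations of words modulo multilinearity\<close>

lemma subspace_tensor_null: "free.subspace (tensor_null V)"
  unfolding tensor_null_def by (rule free.subspace_span)

text \<open>
  Equality in the tensor coalgebra.
\<close>

definition null_eq :: "('k::field, 'v::ab_group_add, 'm) graded_space_scheme \<Rightarrow>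
    ('v list \<Rightarrow>\<^sub>0 'k) \<Rightarrow> ('v list \<Rightarrow>\<^sub>0 'k) \<Rightarrow> bool"
  where "null_eq V x y \<longleftrightarrow> x - y \<in> tensor_null V"

lemma null_eq_refl [simp]: "null_eq V x x"
  by (simp add: null_eq_def free.subspace_0[OF subspace_tensor_null])

lemma null_eq_sym: "null_eq V x y \<Longrightarrow> null_eq V y x"
  using free.subspace_neg[OF subspace_tensor_null, of "x - y" V] by (simp add: null_eq_def)

lemma null_eq_trans [trans]: "null_eq V x y \<Longrightarrow> null_eq V y z \<Longrightarrow> null_eq V x z"
  using free.subspace_add[OF subspace_tensor_null, of "x - y" V "y - z"] by (simp add: null_eq_def)

lemma null_eq_add: "null_eq V x y \<Longrightarrow> null_eq V x' y' \<Longrightarrow> null_eq V (x + x') (y + y')"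
  using free.subspace_add[OF subspace_tensor_null, of "x - y" V "x' - y'"]
  by (simp add: null_eq_def algebra_simps)

lemma null_eq_sum: "(\<And>i. i \<in> I \<Longrightarrow> null_eq V (f i) (g i)) \<Longrightarrow> null_eq V (sum f I) (sum g I)"
  unfolding null_eq_def sum_subtractf[symmetric]
  by (rule free.subspace_sum[OF subspace_tensor_null])

lemma null_eq_cut_sum:
  "(\<And>u v. u @ v = w \<Longrightarrow> null_eq V (f u v) (g u v)) \<Longrightarrow>
    null_eq V (cut_sum f w) (cut_sum g w)"
  unfolding cut_sum_def by (rule null_eq_sum) auto

lemma null_eq_head_sum:
  "(\<And>u v. u @ v = w \<Longrightarrow> u \<noteq> [] \<Longrightarrow> null_eq V (f u v) (g u v)) \<Longrightarrow>
    null_eq V (head_sum f w) (head_sum g w)"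
  unfolding head_sum_def by (rule null_eq_sum) auto

lemma null_eq_0: "null_eq V x 0 \<longleftrightarrow> x \<in> tensor_null V"
  by (simp add: null_eq_def)

text \<open>
  The map \<open>x \<mapsto> \<^bold>sa \<otimes> x\<close>.
\<close>

definition prepend :: "'v \<Rightarrow> ('v list \<Rightarrow>\<^sub>0 'k) \<Rightarrow> ('v list \<Rightarrow>\<^sub>0 'k::field)"
  where "prepend a = free_lin (\<lambda>w. free_of (a # w))"

lemma prepend_of [simp]: "prepend a (free_of w) = free_of (a # w)"
  by (simp add: prepend_def)

lemma free_linear_prepend: "free_linear (prepend a)"
  unfolding prepend_def by (rule free_linear_free_lin)

lemma relation_in_null:
  "free_of (u @ [x + y] @ v) - free_of (u @ [x] @ v) - free_of (u @ [y] @ v) \<in> tensor_null V"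
  "free_of (u @ [scal V c x] @ v) - free_scale c (free_of (u @ [x] @ v)) \<in> tensor_null V"
  unfolding tensor_null_def multilinear_relations_def
  by (rule free.span_base; blast)+

text \<open>
  Unlike the general span principle this asks only for the values of \<open>F\<close> on words, where it is
  usually given by an explicit formula.
\<close>

lemma linear_null_into:
  assumes "free_linear F" "free.subspace S"
    "\<And>u v x y. F (free_of (u @ [x + y] @ v)) - F (free_of (u @ [x] @ v)) -
        F (free_of (u @ [y] @ v)) \<in> S"
    "\<And>u v c x. F (free_of (u @ [scal V c x] @ v)) - free_scale c (F (free_of (u @ [x] @ v))) \<in> S"
    "x \<in> tensor_null V"
  shows "F x \<in> S"
proof (rule free_linear_span[OF assms(1,2)])
  show "x \<in> free.span (multilinear_relations V)" using assms(5) by (simp add: tensor_null_def)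
  fix r assume "r \<in> multilinear_relations V"
  then show "F r \<in> S"
    using assms(3,4)
    by (auto simp: multilinear_relations_def free_linear_diff[OF assms(1)]
        free_linear_scale[OF assms(1)] simp del: free_scale_single)
qed

lemma prepend_null: "x \<in> tensor_null V \<Longrightarrow> prepend a x \<in> tensor_null V"
proof (rule linear_null_into[OF free_linear_prepend subspace_tensor_null])
  fix u v :: "'a list" and x y c
  show "prepend a (free_of (u @ [x + y] @ v)) - prepend a (free_of (u @ [x] @ v)) -
      prepend a (free_of (u @ [y] @ v)) \<in> tensor_null V"
    using relation_in_null(1)[of "a # u" x y v V] by simp
  show "prepend a (free_of (u @ [scal V c x] @ v)) - free_scale c (prepend a (free_of (u @ [x] @
      v)))
      \<in> tensor_null V"
    using relation_in_null(2)[of "a # u" V c x v] by simp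
qed

lemma null_eq_prepend: "null_eq V x y \<Longrightarrow> null_eq V (prepend a x) (prepend a y)"
  unfolding null_eq_def free_linear_diff[OF free_linear_prepend, symmetric] by (rule prepend_null)

lemma prepend_add: "null_eq V (prepend (a + b) x) (prepend a x + prepend b x)"
proof -
  have "prepend (a + b) x - prepend a x - prepend b x \<in> tensor_null V"
    by (rule free_linear_in_subspace[where F = "\<lambda>x. prepend (a + b) x - prepend a x - prepend b x",
          OF _ subspace_tensor_null])
      (use relation_in_null(1)[of "[]" a b _ V] in
        \<open>auto intro!: free_linear_diff_fun free_linear_prepend\<close>)
  then show ?thesis by (simp add: null_eq_def diff_diff_eq)
qed

lemma prepend_scale: "null_eq V (prepend (scal V c a) x) (free_scale c (prepend a x))"
proof -
  have "prepend (scal V c a) x - free_scale c (prepend a x) \<in> tensor_null V"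
    by (rule free_linear_in_subspace[where F = "\<lambda>x. prepend (scal V c a) x - free_scale c (prepend
        a x)",
          OF _ subspace_tensor_null])
      (use relation_in_null(2)[of "[]" V c a] in
        \<open>auto intro!: free_linear_diff_fun free_linear_prepend free_linear_scale_fun\<close>)
  then show ?thesis by (simp add: null_eq_def)
qed

lemma prepend_0: "null_eq V (prepend 0 x) 0"
  using prepend_add[of V 0 0 x] null_eq_sym[of V "prepend 0 x"]
  by (simp add: null_eq_def) (metis add.inverse_inverse free.subspace_neg subspace_tensor_null)

lemma prepend_sum: "null_eq V (prepend (\<Sum>i\<in>I. f i) x) (\<Sum>i\<in>I. prepend (f i) x)"
proof (induction I rule: infinite_finite_induct)
  case (insert i I)
  have "null_eq V (prepend (f i + sum f I) x) (prepend (f i) x + prepend (sum f I) x)"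
    by (rule prepend_add)
  also have "null_eq V \<dots> (prepend (f i) x + (\<Sum>i\<in>I. prepend (f i) x))"
    by (intro null_eq_add null_eq_refl insert.IH)
  finally show ?case using insert.hyps by simp
qed (simp_all add: prepend_0)

lemma prepend_infix_sum:
  "null_eq V (prepend (infix_sum g w) x) (infix_sum (\<lambda>u b v. prepend (g u b v) x) w)"
  unfolding infix_sum_def split_beta by (rule prepend_sum)

lemma prepend_block_sum:
  "null_eq V (prepend (block_sum g w) x) (block_sum (\<lambda>bs. prepend (g bs) x) w)"
  unfolding block_sum_def by (rule prepend_sum)

abbreviation scalars :: "('k::field, 'v::ab_group_add, 'm) graded_space_scheme \<Rightarrow> bool"
  where "scalars V \<equiv> vector_space (scal V)"

lemma scal_simps:
  assumes "scalars V"
  shows "scal V c (x + y) = scal V c x + scal V c y" "scal V (c + d) x = scal V c x + scal V d x"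
    "scal V c (scal V d x) = scal V (c * d) x" "scal V 1 x = x" "scal V 0 x = 0" "scal V c 0 = 0"
    "scal V c (\<Sum>i\<in>I. f i) = (\<Sum>i\<in>I. scal V c (f i))" "scal V (-1) x = - x"
    "scal V c (- x) = - scal V c x"
proof -
  interpret vector_space "scal V" by fact
  show "scal V c (x + y) = scal V c x + scal V c y" "scal V (c + d) x = scal V c x + scal V d x"
    "scal V c (scal V d x) = scal V (c * d) x" "scal V 1 x = x" "scal V 0 x = 0" "scal V c 0 = 0"
    "scal V c (\<Sum>i\<in>I. f i) = (\<Sum>i\<in>I. scal V c (f i))" "scal V (-1) x = - x"
    "scal V c (- x) = - scal V c x"
    by (simp_all add: scale_right_distrib scale_left_distrib scale_sum_right)
qed

lemma corestriction_superset:
  assumes "scalars V" "finite A" "Poly_Mapping.keys x \<subseteq> A"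
  shows "corestriction V x = (\<Sum>w | w \<in> A \<and> length w = 1. scal V (Poly_Mapping.lookup x w) (hd w))"
  unfolding corestriction_def using assms
  by (intro sum.mono_neutral_left) (auto simp: in_keys_iff scal_simps)

lemma corestriction_add:
  assumes "scalars V"
  shows "corestriction V (x + y) = corestriction V x + corestriction V y"
proof -
  let ?A = "Poly_Mapping.keys x \<union> Poly_Mapping.keys y"
  have A: "finite ?A" "Poly_Mapping.keys x \<subseteq> ?A" "Poly_Mapping.keys y \<subseteq> ?A"
    "Poly_Mapping.keys (x + y) \<subseteq> ?A"
    using keys_add[of x y] by auto
  show ?thesis
    unfolding corestriction_superset[OF assms A(1,2)] corestriction_superset[OF assms A(1,3)]
      corestriction_superset[OF assms A(1,4)]
    by (simp add: lookup_add scal_simps[OF assms] sum.distrib)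
qed

lemma corestriction_scale:
  assumes "scalars V"
  shows "corestriction V (free_scale c x) = scal V c (corestriction V x)"
proof -
  have B: "Poly_Mapping.keys (free_scale c x) \<subseteq> Poly_Mapping.keys x"
    by (auto simp: in_keys_iff)
  show ?thesis
    unfolding corestriction_superset[OF assms finite_keys B] corestriction_def[of V x]
    by (simp add: scal_simps[OF assms])
qed

lemma corestriction_diff:
  assumes "scalars V"
  shows "corestriction V (x - y) = corestriction V x - corestriction V y"
  using corestriction_add[OF assms, of "x - y" y] by simp

lemma corestriction_0 [simp]: "corestriction V 0 = 0"
  by (simp add: corestriction_def)

lemma corestriction_of:
  assumes "scalars V"
  shows "corestriction V (free_of w) = (if length w = 1 then hd w else 0)"
proof -
  have "{u. u = w \<and> length u = 1} = (if length w = 1 then {w} else {})" by auto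
  then show ?thesis
    by (simp add: corestriction_def scal_simps[OF assms] del: One_nat_def)
qed

lemma corestriction_null:
  assumes "scalars V" "x \<in> tensor_null V"
  shows "corestriction V x = 0"
proof -
  have "tensor_null V \<subseteq> {x. corestriction V x = 0}"
    unfolding tensor_null_def
  proof (rule free.span_minimal)
    show "free.subspace {x. corestriction V x = 0}"
      by (rule free.subspaceI)
        (simp_all add: corestriction_add[OF assms(1)] corestriction_scale[OF assms(1)]
            scal_simps[OF assms(1)])
    have l: "length (u @ [x] @ v) = 1 \<longleftrightarrow> u = [] \<and> v = []" for u v :: "'b list" and x by auto
    show "multilinear_relations V \<subseteq> {x. corestriction V x = 0}"
      unfolding multilinear_relations_def
      by (auto simp: corestriction_diff[OF assms(1)] corestriction_scale[OF assms(1)]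
          corestriction_of[OF assms(1)] scal_simps[OF assms(1)]  simp del: free_scale_single)
  qed
  then show ?thesis using assms(2) by auto
qed

lemma corestriction_null_eq:
  "scalars V \<Longrightarrow> null_eq V x y \<Longrightarrow> corestriction V x = corestriction V y"
  using corestriction_null[of V "x - y"] corestriction_diff[of V x y] by (simp add: null_eq_def)

text \<open>
  The map \<open>x \<otimes> y \<mapsto> pr\<^sub>1(x) \<otimes> y\<close>, where \<open>pr\<^sub>1\<close> is the projection to words of length one. It is
  a left inverse of deconcatenation on words of length at least two, and unlike concatenation
  of all pairs it needs no division by the length.
\<close>

definition reassemble :: "('v list \<times> 'v list \<Rightarrow>\<^sub>0 'k) \<Rightarrow> ('v list \<Rightarrow>\<^sub>0 'k::field)"
  where "reassemble = free_lin (\<lambda>(u, v). if length u = 1 then free_of (u @ v) else 0)"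

lemma free_linear_reassemble: "free_linear reassemble"
  unfolding reassemble_def by (rule free_linear_free_lin)

lemma reassemble_of: "reassemble (free_of (u, v)) = (if length u = 1 then free_of (u @ v) else 0)"
  by (simp add: reassemble_def)

lemma reassemble_tensor:
  assumes "scalars V"
  shows "null_eq V (reassemble (tensor x y)) (prepend (corestriction V x) y)"
proof -
  have on_words: "reassemble (tensor (free_of u) y) = (if length u = 1 then prepend (hd u) y else
      0)"
    for u
  proof -
    have lin: "free_linear (\<lambda>y. reassemble (tensor (free_of u) y))"
      by (intro free_linear_compose[OF free_linear_reassemble] tensor_bilinear)
    show ?thesis
    proof (cases "length u = 1")
      case True
      then obtain a where "u = [a]" by (cases u) auto
      then show ?thesis
        using free_linear_eqI[OF lin free_linear_prepend[of "hd u"], of y]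
        by (simp add: reassemble_def)
    next
      case False
      then show ?thesis
        using free_linear_eqI[OF lin free_linear_free_lin[of "\<lambda>_. 0"], of y]
        by (simp add: reassemble_def free_lin_def)
    qed
  qed
  let ?K = "Poly_Mapping.keys x" and ?l = "Poly_Mapping.lookup x"
  have "reassemble (tensor x y) =
      (\<Sum>u\<in>?K. free_scale (?l u) (reassemble (tensor (free_of u) y)))"
    by (rule free_linear_expand[OF free_linear_compose[OF free_linear_reassemble
        tensor_bilinear(2)]])
  also have "\<dots> = (\<Sum>u | u \<in> ?K \<and> length u = 1. free_scale (?l u) (prepend (hd u) y))"
    unfolding on_words by (intro sum.mono_neutral_cong_right) auto
  also have "null_eq V \<dots> (\<Sum>u | u \<in> ?K \<and> length u = 1. prepend (scal V (?l u) (hd u)) y)"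
    by (intro null_eq_sum null_eq_sym[OF prepend_scale])
  also have "null_eq V \<dots> (prepend (corestriction V x) y)"
    unfolding corestriction_def by (rule null_eq_sym[OF prepend_sum])
  finally show ?thesis .
qed

text \<open>
  The corestriction kills the relations, and the relations are stable under prepending a
  letter.
\<close>

lemma reassemble_null:
  assumes "scalars V" "z \<in> tensor_null2 V"
  shows "reassemble z \<in> tensor_null V"
  using assms(2) unfolding tensor_null2_def
proof (rule free_linear_span[OF free_linear_reassemble subspace_tensor_null, rotated])
  fix r assume "r \<in> {tensor r x |r x. r \<in> tensor_null V \<and> x \<in> words} \<union>
    {tensor x r |r x. r \<in> tensor_null V \<and> x \<in> words}"
  then obtain s x where s: "s \<in> tensor_null V" and "r = tensor s x \<or> r = tensor x s" by auto
  then show "reassemble r \<in> tensor_null V"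
  proof (elim disjE)
    assume r: "r = tensor s x"
    have "null_eq V (reassemble r) (prepend 0 x)"
      using reassemble_tensor[OF assms(1), of s x] by (simp add: r corestriction_null[OF assms(1)
          s])
    also have "null_eq V (prepend 0 x) 0" by (rule prepend_0)
    finally show ?thesis by (simp add: null_eq_0)
  next
    assume r: "r = tensor x s"
    have "null_eq V (reassemble r) (prepend (corestriction V x) s)"
      using reassemble_tensor[OF assms(1), of x s] by (simp add: r)
    also have "null_eq V (prepend (corestriction V x) s) 0"
      using prepend_null[OF s] by (simp add: null_eq_0)
    finally show ?thesis by (simp add: null_eq_0)
  qed
qed

lemma free_linear_deconcatenation: "free_linear deconcatenation"
  unfolding deconcatenation_def by (rule free_linear_free_lin)

lemma deconcatenation_of:
  "deconcatenation (free_of w) = head_sum (\<lambda>u v. if v = [] then 0 else free_of (u, v)) w"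
proof -
  have "(\<Sum>p | fst p @ snd p = w \<and> fst p \<noteq> [] \<and> snd p \<noteq> []. free_of p) =
      (\<Sum>(u, v) | u @ v = w \<and> u \<noteq> []. if v = [] then 0 else free_of (u, v))"
    by (rule sum.mono_neutral_cong_left[OF finite_first]) auto
  then show ?thesis by (simp add: deconcatenation_def head_sum_def)
qed

text \<open>
  The first summand is the part of length one: a combination of words is recovered from its
  corestriction and its coproduct. This is the cofreeness of the tensor coalgebra.
\<close>

lemma reassemble_deconcatenation:
  fixes x :: "'v list \<Rightarrow>\<^sub>0 'k::field"
  assumes "x \<in> words"
  shows "x = reassemble (tensor x (free_of [])) + reassemble (deconcatenation x)"
proof -
  have lin: "free_linear (\<lambda>x. x - reassemble (tensor x (free_of [])))"
    by (intro free_linear_diff_fun free_linear_compose[OF free_linear_reassemble] tensor_bilinear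
        free_linearI) auto
  have "(\<lambda>x. x - reassemble (tensor x (free_of []))) x = (\<lambda>x. reassemble (deconcatenation x)) x"
  proof (rule free_linear_eqI[OF lin free_linear_compose[OF free_linear_reassemble
      free_linear_deconcatenation]])
    fix w assume "w \<in> Poly_Mapping.keys x"
    with assms have "w \<noteq> []" by (auto simp: words_def)
    then obtain a v where w: "w = a # v" by (cases w) auto
    have "reassemble (deconcatenation (free_of w :: 'v list \<Rightarrow>\<^sub>0 'k)) =
        head_sum (\<lambda>u v. if v \<noteq> [] \<and> length u = 1 then free_of (u @ v) else 0) w"
      unfolding deconcatenation_of head_sum_def
      by (simp add: free_linear_sum[OF free_linear_reassemble])
        (intro sum.cong, auto simp: reassemble_def free_lin_def)
    also have "\<dots> = (if v \<noteq> [] then free_of w else 0)"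
      unfolding w head_sum_Cons cut_sum_first
      by (subst head_sum_cong[where h = "\<lambda>_ _. 0"]) auto
    finally show "(free_of w :: 'v list \<Rightarrow>\<^sub>0 'k) - reassemble (tensor (free_of w) (free_of [])) =
        reassemble (deconcatenation (free_of w))"
      by (cases "v = []") (simp_all add: w reassemble_of)
  qed
  then show ?thesis by (simp add: algebra_simps)
qed

section \<open>Coalgebra morphisms and their Taylor coefficients\<close>

lemma subspace_words: "free.subspace words"
  using keys_add by (intro free.subspaceI) (auto simp: words_def in_keys_iff lookup_add)

lemma words_of: "w \<noteq> [] \<Longrightarrow> free_of w \<in> words"
  by (simp add: words_def)

lemma words_keys: "x \<in> words \<Longrightarrow> w \<in> Poly_Mapping.keys x \<Longrightarrow> w \<noteq> []"
  by (auto simp: words_def)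

lemma same_mapI:
  fixes F G :: "('v list \<Rightarrow>\<^sub>0 'k::field) \<Rightarrow> ('w::ab_group_add list \<Rightarrow>\<^sub>0 'k)"
  assumes "free_linear F" "free_linear G" "\<And>w. w \<noteq> [] \<Longrightarrow> null_eq W (F (free_of w)) (G (free_of w))"
  shows "same_map W F G"
  unfolding same_map_def
proof
  fix x :: "'v list \<Rightarrow>\<^sub>0 'k" assume "x \<in> words"
  then show "F x - G x \<in> tensor_null W"
    using free_linear_in_subspace[OF free_linear_diff_fun[OF assms(1,2)] subspace_tensor_null,
        of x W]
      assms(3) words_keys by (auto simp: null_eq_def)
qed

lemma same_mapD: "same_map W F G \<Longrightarrow> x \<in> words \<Longrightarrow> null_eq W (F x) (G x)"
  by (simp add: same_map_def null_eq_def)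

lemma same_map_sym: "same_map W F G \<Longrightarrow> same_map W G F"
  by (meson same_mapD null_eq_sym same_map_def null_eq_def)

lemma same_map_trans: "same_map W F G \<Longrightarrow> same_map W G H \<Longrightarrow> same_map W F H"
  by (meson same_mapD null_eq_trans same_map_def null_eq_def)

lemma coalgebra_morphismD:
  assumes "coalgebra_morphism V W F"
  shows "free_linear F" "x \<in> words \<Longrightarrow> F x \<in> words" "null_eq V x y \<Longrightarrow> null_eq W (F x) (F y)"
    "x \<in> tensor_null V \<Longrightarrow> F x \<in> tensor_null W"
    "x \<in> tensor_degree V d \<Longrightarrow> \<exists>y\<in>tensor_degree W d. null_eq W (F x) y"
    "x \<in> words \<Longrightarrow> deconcatenation (F x) -
        free_lin (\<lambda>(u, v). tensor (F (free_of u)) (F (free_of v))) (deconcatenation x)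
      \<in> tensor_null2 W"
proof -
  show lin: "free_linear F" using assms by (simp add: coalgebra_morphism_def)
  show "null_eq V x y \<Longrightarrow> null_eq W (F x) (F y)"
    using assms unfolding coalgebra_morphism_def null_eq_def free_linear_diff[OF lin, symmetric]
    by blast
qed (use assms in \<open>auto simp: coalgebra_morphism_def null_eq_def\<close>)

lemma coalgebra_morphism_id:
  fixes V :: "('k::field, 'v::ab_group_add, 'm) graded_space_scheme"
  shows "coalgebra_morphism V V id"
  unfolding coalgebra_morphism_def
proof (intro conjI ballI allI)
  show "free_linear id" by (rule free_linearI) auto
  show "\<exists>y\<in>tensor_degree V d. id x - y \<in> tensor_null V" if "x \<in> tensor_degree V d" for d x
    using that by (intro bexI[of _ x]) (auto simp: free.subspace_0[OF subspace_tensor_null])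
  fix x :: "'v list \<Rightarrow>\<^sub>0 'k"
  have "free_lin (\<lambda>(u, v). tensor (id (free_of u)) (id (free_of v))) y = y"
      for y :: "'v list \<times> 'v list \<Rightarrow>\<^sub>0 'k"
    by (rule free_linear_eqI[OF free_linear_free_lin, of "\<lambda>y. y"]) (auto intro: free_linearI)
  then show "deconcatenation (id x) -
      free_lin (\<lambda>(u, v). tensor (id (free_of u)) (id (free_of v))) (deconcatenation x) \<in>
          tensor_null2 V"
    by (simp add: tensor_null2_def free.span_zero)
qed auto

lemma coalgebra_morphism_compose:
  fixes F :: "('u::ab_group_add list \<Rightarrow>\<^sub>0 'k::field) \<Rightarrow> ('v::ab_group_add list \<Rightarrow>\<^sub>0 'k)"
    and G :: "('v list \<Rightarrow>\<^sub>0 'k) \<Rightarrow> ('w::ab_group_add list \<Rightarrow>\<^sub>0 'k)"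
  assumes F: "coalgebra_morphism U V F" and G: "coalgebra_morphism V W G"
  shows "coalgebra_morphism U W (G \<circ> F)"
  unfolding coalgebra_morphism_def
proof (intro conjI ballI allI)
  note linF = coalgebra_morphismD(1)[OF F] and linG = coalgebra_morphismD(1)[OF G]
  show "free_linear (G \<circ> F)" using free_linear_compose[OF linG linF] by (simp add: o_def)
  show "x \<in> words \<Longrightarrow> (G \<circ> F) x \<in> words" for x
    by (simp add: coalgebra_morphismD(2)[OF F] coalgebra_morphismD(2)[OF G])
  show "x \<in> tensor_null U \<Longrightarrow> (G \<circ> F) x \<in> tensor_null W" for x
    by (simp add: coalgebra_morphismD(4)[OF F] coalgebra_morphismD(4)[OF G])
  show "\<exists>y\<in>tensor_degree W d. (G \<circ> F) x - y \<in> tensor_null W" if deg: "x \<in> tensor_degree U d" for d x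
  proof -
    obtain y where y: "y \<in> tensor_degree V d" "null_eq V (F x) y"
      using coalgebra_morphismD(5)[OF F deg] by auto
    obtain z where "z \<in> tensor_degree W d" "null_eq W (G y) z"
      using coalgebra_morphismD(5)[OF G y(1)] by auto
    then show ?thesis
      using null_eq_trans[OF coalgebra_morphismD(3)[OF G y(2)]] by (auto simp: null_eq_def)
  qed
  fix x :: "'u list \<Rightarrow>\<^sub>0 'k" assume x: "x \<in> words"
  let ?TF = "free_lin (\<lambda>(u, v). tensor (F (free_of u)) (F (free_of v)))"
  let ?TG = "free_lin (\<lambda>(u, v). tensor (G (free_of u)) (G (free_of v)))"
  let ?TGF = "free_lin (\<lambda>(u, v). tensor ((G \<circ> F) (free_of u)) ((G \<circ> F) (free_of v)))"
  have TG: "?TG (tensor y z) = tensor (G y) (G z)" for y z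
  proof -
    have 1: "?TG (tensor (free_of a) z) = tensor (G (free_of a)) (G z)" for a
      by (rule free_linear_eqI[where F = "\<lambda>z. ?TG (tensor (free_of a) z)"])
        (auto intro!: free_linear_compose[OF free_linear_free_lin tensor_bilinear(1)]
          free_linear_compose[OF tensor_bilinear(1) linG])
    show ?thesis
      by (rule free_linear_eqI[where F = "\<lambda>y. ?TG (tensor y z)"])
        (auto intro!: free_linear_compose[OF free_linear_free_lin tensor_bilinear(2)]
          free_linear_compose[OF tensor_bilinear(2) linG] simp: 1)
  qed
  have "?TGF (deconcatenation x) = ?TG (?TF (deconcatenation x))"
    by (rule free_linear_eqI[OF free_linear_free_lin
          free_linear_compose[OF free_linear_free_lin free_linear_free_lin]])
      (simp add: TG split_beta)
  moreover have "?TG (deconcatenation (F x) - ?TF (deconcatenation x)) \<in> tensor_null2 W"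
  proof (rule free_linear_span[OF free_linear_free_lin])
    show "free.subspace (tensor_null2 W)"
      unfolding tensor_null2_def by (rule free.subspace_span)
    show "deconcatenation (F x) - ?TF (deconcatenation x) \<in> free.span
      ({tensor r x | r x. r \<in> tensor_null V \<and> x \<in> words} \<union>
       {tensor x r | r x. r \<in> tensor_null V \<and> x \<in> words})"
      using coalgebra_morphismD(6)[OF F x] by (simp add: tensor_null2_def)
    fix t assume "t \<in> {tensor r x | r x. r \<in> tensor_null V \<and> x \<in> words} \<union>
       {tensor x r | r x. r \<in> tensor_null V \<and> x \<in> words}"
    then obtain r y where t: "t = tensor r y \<or> t = tensor y r" and "r \<in> tensor_null V" "y \<in> words"
      by auto
    then have "G r \<in> tensor_null W" "G y \<in> words"
      by (simp_all add: coalgebra_morphismD(2,4)[OF G])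
    then have "tensor (G r) (G y) \<in> tensor_null2 W" "tensor (G y) (G r) \<in> tensor_null2 W"
      unfolding tensor_null2_def by (intro free.span_base; blast)+
    with t show "?TG t \<in> tensor_null2 W" by (auto simp: TG)
  qed
  moreover have "deconcatenation (G (F x)) - ?TG (deconcatenation (F x)) \<in> tensor_null2 W"
    by (intro coalgebra_morphismD(6)[OF G] coalgebra_morphismD(2)[OF F] x)
  ultimately have "(deconcatenation (G (F x)) - ?TG (deconcatenation (F x))) +
      (?TG (deconcatenation (F x)) - ?TGF (deconcatenation x)) \<in> tensor_null2 W"
    unfolding tensor_null2_def
    by (intro free.subspace_add[OF free.subspace_span])
      (simp_all add: free_linear_diff[OF free_linear_free_lin])
  then show "deconcatenation ((G \<circ> F) x) - ?TGF (deconcatenation x) \<in> tensor_null2 W"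
    by simp
qed

definition multilinear :: "('k::field, 'v::ab_group_add, 'm) graded_space_scheme \<Rightarrow>
    ('k, 'w::ab_group_add, 'n) graded_space_scheme \<Rightarrow> ('v list \<Rightarrow> 'w) \<Rightarrow> bool"
  where "multilinear V W f \<longleftrightarrow>
    (\<forall>u v x y. f (u @ [x + y] @ v) = f (u @ [x] @ v) + f (u @ [y] @ v)) \<and>
    (\<forall>u v c x. f (u @ [scal V c x] @ v) = scal W c (f (u @ [x] @ v)))"

lemma multilinear_0: "multilinear V W f \<Longrightarrow> f (u @ [0] @ v) = 0"
  unfolding multilinear_def by (metis add_cancel_right_left)

lemma multilinear_zero: "multilinear V W f \<Longrightarrow> 0 \<in> set w \<Longrightarrow> f w = 0"
  using multilinear_0[of V W f] by (auto simp: in_set_conv_decomp)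

lemma multilinear_uminus:
  assumes f: "multilinear V W f"
  shows "f (u @ [- x] @ v) = - f (u @ [x] @ v)"
proof -
  have "f (u @ [x + - x] @ v) = f (u @ [x] @ v) + f (u @ [- x] @ v)"
    using f unfolding multilinear_def by blast
  then show ?thesis using multilinear_0[OF f, of u v] by (simp add: add_eq_0_iff)
qed

lemma multilinear_taylor:
  fixes F :: "('v::ab_group_add list \<Rightarrow>\<^sub>0 'k::field) \<Rightarrow> ('w::ab_group_add list \<Rightarrow>\<^sub>0 'k)"
  assumes "coalgebra_morphism V W F" "scalars W"
  shows "multilinear V W (taylor W F)"
proof -
  note lin = coalgebra_morphismD(1)[OF assms(1)]
  note null = coalgebra_morphismD(4)[OF assms(1)]
  have "taylor W F (u @ [x + y] @ v) = taylor W F (u @ [x] @ v) + taylor W F (u @ [y] @ v)"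
      for u v x y
    using corestriction_null[OF assms(2) null[OF relation_in_null(1)[of u x y v V]]]
    by (simp add: taylor_def free_linear_diff[OF lin] corestriction_diff[OF assms(2)] diff_eq_eq
        add.commute)
  moreover have "taylor W F (u @ [scal V c x] @ v) = scal W c (taylor W F (u @ [x] @ v))"
      for u v c x
    using corestriction_null[OF assms(2) null[OF relation_in_null(2)[of u V c x v]]]
    by (simp add: taylor_def free_linear_diff[OF lin] corestriction_diff[OF assms(2)]
        free_linear_scale[OF lin] corestriction_scale[OF assms(2)] del: free_scale_single)
  ultimately show ?thesis by (simp add: multilinear_def)
qed

lemma morphism_of_of: "morphism_of f (free_of w) = block_sum (\<lambda>bs. free_of (map f bs)) w"
  by (simp add: morphism_of_def block_sum_def)

lemma free_linear_morphism_of: "free_linear (morphism_of f)"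
  unfolding morphism_of_def by (rule free_linear_free_lin)

lemma morphism_of_Nil [simp]: "morphism_of f (free_of []) = free_of []"
  by (simp add: morphism_of_of)

lemma morphism_of_first_block:
  "w \<noteq> [] \<Longrightarrow> morphism_of f (free_of w) =
    head_sum (\<lambda>u v. prepend (f u) (morphism_of f (free_of v))) w"
  by (simp add: morphism_of_of block_sum_first_block[of w]
      free_linear_block_sum[OF free_linear_prepend])

lemma morphism_of_cong:
  assumes "\<And>w. w \<noteq> [] \<Longrightarrow> f w = g w"
  shows "morphism_of f x = morphism_of g x"
proof (rule free_linear_eqI[OF free_linear_morphism_of free_linear_morphism_of])
  fix w :: "'a list"
  show "morphism_of f (free_of w) = morphism_of g (free_of w)"
    unfolding morphism_of_of using assms by (intro block_sum_cong arg_cong[where f =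
        free_of] map_cong) (auto, metis)
qed

text \<open>
  The coproduct of \<open>F w\<close> involves \<open>F\<close> only on shorter words. So by induction on the length, \<open>F
  w\<close> is reassembled from its corestriction and from the values of \<open>F\<close> on proper suffixes of
  \<open>w\<close>, which is the recursion of \<^const>\<open>morphism_of\<close> along the first block.
\<close>

theorem coalgebra_morphism_determined:
  fixes F :: "('v::ab_group_add list \<Rightarrow>\<^sub>0 'k::field) \<Rightarrow> ('w::ab_group_add list \<Rightarrow>\<^sub>0 'k)"
  assumes F: "coalgebra_morphism V W F" and W: "scalars W"
  shows "same_map W F (morphism_of (taylor W F))"
proof (rule same_mapI)
  note lin = coalgebra_morphismD(1)[OF F]
  show "free_linear F" "free_linear (morphism_of (taylor W F))"
    by (rule lin free_linear_morphism_of)+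
  let ?f = "taylor W F"
  show "null_eq W (F (free_of w)) (morphism_of ?f (free_of w))" if "w \<noteq> []" for w
    using that
  proof (induction w rule: length_induct)
    case (1 w)
    have words: "free_of w \<in> words" using 1(2) by (rule words_of)
    let ?T = "free_lin (\<lambda>(u, v). tensor (F (free_of u)) (F (free_of v)))"
    have "F (free_of w) = reassemble (tensor (F (free_of w)) (free_of [])) +
        reassemble (deconcatenation (F (free_of w)))"
      by (intro reassemble_deconcatenation coalgebra_morphismD(2)[OF F] words)
    also have "null_eq W \<dots> (prepend (?f w) (free_of []) + reassemble (?T (deconcatenation (free_of
        w))))"
    proof (rule null_eq_add)
      show "null_eq W (reassemble (tensor (F (free_of w)) (free_of []))) (prepend (?f w) (free_of
          []))"
        unfolding taylor_def by (rule reassemble_tensor[OF W])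
      show "null_eq W (reassemble (deconcatenation (F (free_of w))))
          (reassemble (?T (deconcatenation (free_of w))))"
        unfolding null_eq_def free_linear_diff[OF free_linear_reassemble, symmetric]
        by (intro reassemble_null[OF W] coalgebra_morphismD(6)[OF F] words)
    qed
    also have "reassemble (?T (deconcatenation (free_of w))) =
        head_sum (\<lambda>u v. if v = [] then 0 else reassemble (tensor (F (free_of u)) (F (free_of v))))
            w"
      unfolding deconcatenation_of
      by (simp add: free_linear_head_sum[OF free_linear_free_lin]
          free_linear_head_sum[OF free_linear_reassemble] if_distrib
          free_linear_0[OF free_linear_free_lin] free_linear_0[OF free_linear_reassemble] cong:
              if_cong)
    also have "null_eq W (prepend (?f w) (free_of []) + \<dots>) (prepend (?f w) (free_of []) +
        head_sum (\<lambda>u v. if v = [] then 0 else prepend (?f u) (morphism_of ?f (free_of v))) w)"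
    proof (intro null_eq_add null_eq_refl null_eq_head_sum)
      fix u v assume uv: "u @ v = w" "u \<noteq> []"
      have "null_eq W (reassemble (tensor (F (free_of u)) (F (free_of v))))
          (prepend (?f u) (morphism_of ?f (free_of v)))" if "v \<noteq> []"
      proof -
        have "null_eq W (reassemble (tensor (F (free_of u)) (F (free_of v)))) (prepend (?f u)
            (F (free_of v)))"
          unfolding taylor_def by (rule reassemble_tensor[OF W])
        also have "null_eq W \<dots> (prepend (?f u) (morphism_of ?f (free_of v)))"
          by (rule null_eq_prepend) (use 1(1) uv that in auto)
        finally show ?thesis .
      qed
      then show "null_eq W (if v = [] then 0 else reassemble (tensor (F (free_of u)) (F (free_of
          v))))
          (if v = [] then 0 else prepend (?f u) (morphism_of ?f (free_of v)))"
        by simp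
    qed
    also have "prepend (?f w) (free_of [] :: _ \<Rightarrow>\<^sub>0 'k) +
        head_sum (\<lambda>u v. if v = [] then 0 else prepend (?f u) (morphism_of ?f (free_of v))) w =
        head_sum (\<lambda>u v. prepend (?f u) (morphism_of ?f (free_of v))) w"
    proof -
      have eq: "prepend (?f w) (free_of [] :: _ \<Rightarrow>\<^sub>0 'k) =
          head_sum (\<lambda>u v. if v = [] then prepend (?f u) (free_of []) else 0) w"
        by (simp add: head_sum_whole 1(2))
      show ?thesis
        by (subst eq, subst head_sum_add[symmetric]) (intro head_sum_cong, simp)
    qed
    finally show ?case by (simp add: morphism_of_first_block[OF 1(2)])
  qed
qed

corollary coalgebra_morphism_eqI:
  fixes F :: "('v::ab_group_add list \<Rightarrow>\<^sub>0 'k::field) \<Rightarrow> ('w::ab_group_add list \<Rightarrow>\<^sub>0 'k)"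
  assumes "coalgebra_morphism V W F" "coalgebra_morphism V W G" "scalars W"
    "\<And>w. w \<noteq> [] \<Longrightarrow> taylor W F w = taylor W G w"
  shows "same_map W F G"
proof -
  have "(morphism_of (taylor W F) :: ('v list \<Rightarrow>\<^sub>0 'k) \<Rightarrow> _) = morphism_of (taylor W G)"
    using assms(4) by (intro ext morphism_of_cong)
  then show ?thesis
    using coalgebra_morphism_determined[OF assms(1,3)] coalgebra_morphism_determined[OF assms(2,3)]
      same_map_sym same_map_trans by metis
qed

lemma taylor_same_map:
  "scalars W \<Longrightarrow> same_map W F G \<Longrightarrow> w \<noteq> [] \<Longrightarrow> taylor W F w = taylor W G w"
  unfolding taylor_def by (intro corestriction_null_eq same_mapD words_of)

lemma taylor_id: "scalars V \<Longrightarrow> taylor V id w = (if length w = 1 then hd w else 0)"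
  by (simp add: taylor_def corestriction_of)

lemma taylor_morphism_of:
  assumes "scalars W" "w \<noteq> []"
  shows "taylor W (morphism_of f) w = f w"
proof -
  have "taylor W (morphism_of f) w = block_sum (\<lambda>bs. if length bs = 1 then f (hd bs) else 0) w"
    unfolding taylor_def morphism_of_of
    by (subst block_sum_hom) (auto simp: corestriction_add[OF assms(1)] corestriction_of[OF
        assms(1)]
        length_Suc_conv intro!: block_sum_cong)
  also have "\<dots> = (\<Sum>bs\<in>{[w]}. f (hd bs))"
    unfolding block_sum_def
    by (rule sum.mono_neutral_cong_right[OF finite_blocks]) (use assms(2) in \<open>auto simp:
        length_Suc_conv\<close>)
  finally show ?thesis by simp
qed

lemma taylor_compose:
  assumes F: "coalgebra_morphism U V F" and G: "coalgebra_morphism V W G"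
    and V: "scalars V" and W: "scalars W" and w: "w \<noteq> []"
  shows "taylor W (G \<circ> F) w = block_sum (\<lambda>bs. taylor W G (map (taylor V F) bs)) w"
proof -
  have "null_eq V (F (free_of w)) (morphism_of (taylor V F) (free_of w))"
    by (intro same_mapD coalgebra_morphism_determined[OF F V] words_of w)
  then have "null_eq W (G (F (free_of w))) (G (morphism_of (taylor V F) (free_of w)))"
    by (rule coalgebra_morphismD(3)[OF G])
  then have "taylor W (G \<circ> F) w = corestriction W (G (morphism_of (taylor V F) (free_of w)))"
    using corestriction_null_eq[OF W] by (simp add: taylor_def)
  also have "\<dots> = block_sum (\<lambda>bs. taylor W G (map (taylor V F) bs)) w"
    unfolding morphism_of_of taylor_def
    by (subst free_linear_block_sum[OF coalgebra_morphismD(1)[OF G]], subst block_sum_hom)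
      (auto simp: corestriction_add[OF W])
  finally show ?thesis .
qed

lemma taylor_compose_morphism_of:
  assumes "coalgebra_morphism U V (morphism_of f)" "coalgebra_morphism V W (morphism_of g)"
    "scalars V" "scalars W" "w \<noteq> []"
  shows "taylor W (morphism_of g \<circ> morphism_of f) w = block_sum (\<lambda>bs. g (map f bs)) w"
  unfolding taylor_compose[OF assms]
proof (rule block_sum_cong)
  fix bs assume bs: "concat bs = w" "[] \<notin> set bs"
  have "taylor V (morphism_of f) b = f b" if "b \<in> set bs" for b
    by (rule taylor_morphism_of[OF assms(3)]) (use that bs in auto)
  then have eq: "map (taylor V (morphism_of f)) bs = map f bs" by simp
  show "taylor W (morphism_of g) (map (taylor V (morphism_of f)) bs) = g (map f bs)"
    unfolding eq by (rule taylor_morphism_of[OF assms(4)]) (use bs assms(5) in auto)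
qed

lemma scale_head_sum: "free_scale c (head_sum g w) = head_sum (\<lambda>u v. free_scale c (g u v)) w"
  and scale_cut_sum: "free_scale c (cut_sum g w) = cut_sum (\<lambda>u v. free_scale c (g u v)) w"
  by (simp_all add: head_sum_def cut_sum_def free.scale_sum_right split_beta del: free_scale_single)

text \<open>
  The first block either ends before the distinguished letter or contains it.
\<close>

lemma morphism_of_insert:
  "morphism_of f (free_of (u @ x # v)) =
    head_sum (\<lambda>u1 u2. prepend (f u1) (morphism_of f (free_of (u2 @ x # v)))) u +
    cut_sum (\<lambda>v1 v2. prepend (f (u @ x # v1)) (morphism_of f (free_of v2))) v"
  by (subst morphism_of_first_block) (simp_all add: head_sum_insert)

lemma morphism_of_insert_add:
  assumes f: "multilinear V W f"
  shows "null_eq W (morphism_of f (free_of (u @ (x + y) # v)))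
    (morphism_of f (free_of (u @ x # v)) + morphism_of f (free_of (u @ y # v)))"
proof (induction u rule: length_induct)
  case (1 u)
  let ?M = "morphism_of f"
  have add: "f (u @ (x + y) # v) = f (u @ x # v) + f (u @ y # v)" for u v
    using f by (simp add: multilinear_def)
  have 2: "null_eq W (head_sum (\<lambda>u1 u2. prepend (f u1) (?M (free_of (u2 @ (x + y) # v)))) u)
      (head_sum (\<lambda>u1 u2. prepend (f u1) (?M (free_of (u2 @ x # v))) +
        prepend (f u1) (?M (free_of (u2 @ y # v)))) u)"
    unfolding free_linear_add[OF free_linear_prepend, symmetric]
    by (intro null_eq_head_sum null_eq_prepend) (use 1 in auto)
  have 3: "null_eq W (cut_sum (\<lambda>v1 v2. prepend (f (u @ (x + y) # v1)) (?M (free_of v2))) v)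
      (cut_sum (\<lambda>v1 v2. prepend (f (u @ x # v1)) (?M (free_of v2)) +
        prepend (f (u @ y # v1)) (?M (free_of v2))) v)"
    unfolding add by (intro null_eq_cut_sum prepend_add)
  show ?case
    using null_eq_add[OF 2 3] by (simp add: morphism_of_insert[of f u] head_sum_add cut_sum_add
        add_ac)
qed

lemma morphism_of_insert_scale:
  assumes f: "multilinear V W f"
  shows "null_eq W (morphism_of f (free_of (u @ scal V c x # v)))
    (free_scale c (morphism_of f (free_of (u @ x # v))))"
proof (induction u rule: length_induct)
  case (1 u)
  let ?M = "morphism_of f"
  have scale: "f (u @ scal V c x # v) = scal W c (f (u @ x # v))" for u v
    using f by (simp add: multilinear_def)
  have 2: "null_eq W (head_sum (\<lambda>u1 u2. prepend (f u1) (?M (free_of (u2 @ scal V c x # v)))) u)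
      (head_sum (\<lambda>u1 u2. free_scale c (prepend (f u1) (?M (free_of (u2 @ x # v))))) u)"
    unfolding free_linear_scale[OF free_linear_prepend, symmetric]
    by (intro null_eq_head_sum null_eq_prepend) (use 1 in auto)
  have 3: "null_eq W (cut_sum (\<lambda>v1 v2. prepend (f (u @ scal V c x # v1)) (?M (free_of v2))) v)
      (cut_sum (\<lambda>v1 v2. free_scale c (prepend (f (u @ x # v1)) (?M (free_of v2)))) v)"
    unfolding scale by (intro null_eq_cut_sum prepend_scale)
  show ?case
    using null_eq_add[OF 2 3]
    by (simp add: morphism_of_insert[of f u] free.scale_right_distrib scale_head_sum scale_cut_sum)
qed

lemma block_sum_in_subspace:
  assumes "free.subspace S" "\<And>bs. concat bs = w \<Longrightarrow> [] \<notin> set bs \<Longrightarrow> g bs \<in> S"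
  shows "block_sum g w \<in> S"
  unfolding block_sum_def by (rule free.subspace_sum[OF assms(1)]) (use assms(2) in auto)

lemma infix_sum_in_subspace:
  assumes "free.subspace S" "\<And>u b v. u @ b @ v = w \<Longrightarrow> b \<noteq> [] \<Longrightarrow> g u b v \<in> S"
  shows "infix_sum g w \<in> S"
  unfolding infix_sum_def by (rule free.subspace_sum[OF assms(1)]) (use assms(2) in auto)

text \<open>
  The degree of a word of \<open>\<^bold>sV\<close> is the sum of the \<open>i - 1\<close>; the value of \<open>f\<close> has this degree in
  \<open>\<^bold>sW\<close>, hence one more in \<open>W\<close>.
\<close>

definition degree_preserving :: "('k::field, 'v::ab_group_add, 'm) graded_space_scheme \<Rightarrow>
    ('k, 'w::ab_group_add, 'n) graded_space_scheme \<Rightarrow> ('v list \<Rightarrow> 'w) \<Rightarrow> bool"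
  where "degree_preserving V W f \<longleftrightarrow> (\<forall>is w. w \<noteq> [] \<and> list_all2 (\<lambda>i v. proj V i v = v) is w \<longrightarrow>
    proj W ((\<Sum>i\<leftarrow>is. i - 1) + 1) (f w) = f w)"

lemma degree_preserving_blocks:
  assumes "degree_preserving V W f" "list_all2 (\<lambda>i v. proj V i v = v) is (concat bs)" "[] \<notin> set bs"
  shows "\<exists>js. list_all2 (\<lambda>j v. proj W j v = v) js (map f bs) \<and>
    (\<Sum>j\<leftarrow>js. j - 1) = (\<Sum>i\<leftarrow>is. i - 1)"
  using assms(2,3)
proof (induction bs arbitrary: "is")
  case (Cons b bs)
  from Cons.prems(1) obtain is1 is2 where is': "is = is1 @ is2"
    "list_all2 (\<lambda>i v. proj V i v = v) is1 b" "list_all2 (\<lambda>i v. proj V i v = v) is2 (concat bs)"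
    by (auto simp: list_all2_append2)
  obtain js where js: "list_all2 (\<lambda>j v. proj W j v = v) js (map f bs)"
    "(\<Sum>j\<leftarrow>js. j - 1) = (\<Sum>i\<leftarrow>is2. i - 1)"
    using Cons.IH[OF is'(3)] Cons.prems(2) by auto
  have "proj W ((\<Sum>i\<leftarrow>is1. i - 1) + 1) (f b) = f b"
    using assms(1) is'(2) Cons.prems(2) by (auto simp: degree_preserving_def)
  then show ?case
    using js is'(1) by (intro exI[of _ "((\<Sum>i\<leftarrow>is1. i - 1) + 1) # js"]) simp
qed simp

theorem coalgebra_morphism_morphism_of:
  fixes f :: "'v::ab_group_add list \<Rightarrow> 'w::ab_group_add"
    and V :: "('k::field, 'v, 'm) graded_space_scheme"
  assumes f: "multilinear V W f" and deg: "degree_preserving V W f"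
  shows "coalgebra_morphism V W (morphism_of f)"
  unfolding coalgebra_morphism_def
proof (intro conjI ballI allI)
  let ?M = "morphism_of f :: ('v list \<Rightarrow>\<^sub>0 'k) \<Rightarrow> _"
  show lin: "free_linear ?M" by (rule free_linear_morphism_of)
  show "?M x \<in> words" if "x \<in> words" for x
  proof (rule free_linear_in_subspace[OF lin subspace_words])
    fix w assume "w \<in> Poly_Mapping.keys x"
    then have "w \<noteq> []" using that words_keys by blast
    then show "?M (free_of w) \<in> words"
      unfolding morphism_of_of by (intro block_sum_in_subspace[OF subspace_words] words_of) auto
  qed
  show "?M x \<in> tensor_null W" if "x \<in> tensor_null V" for x
    by (rule linear_null_into[OF lin subspace_tensor_null _ _ that])
      (use morphism_of_insert_add[OF f] morphism_of_insert_scale[OF f] in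
        \<open>auto simp: null_eq_def diff_diff_eq\<close>)
  show "\<exists>y\<in>tensor_degree W d. ?M x - y \<in> tensor_null W" if "x \<in> tensor_degree V d" for d x
  proof (rule bexI[of _ "?M x"])
    show "?M x - ?M x \<in> tensor_null W" by (simp add: free.subspace_0[OF subspace_tensor_null])
    show "?M x \<in> tensor_degree W d"
      using that unfolding tensor_degree_def[of V]
    proof (rule free_linear_span[OF lin, rotated 2])
      show sub: "free.subspace (tensor_degree W d)"
        unfolding tensor_degree_def by (rule free.subspace_span)
      fix y :: "'v list \<Rightarrow>\<^sub>0 'k"
      assume "y \<in> {free_of w | w. w \<noteq> [] \<and>
        (\<exists>is. list_all2 (\<lambda>i v. proj V i v = v) is w \<and> (\<Sum>i\<leftarrow>is. i - 1) = d)}"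
      then obtain w "is" where w: "y = free_of w" "w \<noteq> []"
        "list_all2 (\<lambda>i v. proj V i v = v) is w" "(\<Sum>i\<leftarrow>is. i - 1) = d" by auto
      show "?M y \<in> tensor_degree W d"
        unfolding w(1) morphism_of_of
      proof (rule block_sum_in_subspace[OF sub])
        fix bs assume bs: "concat bs = w" "[] \<notin> set bs"
        show "free_of (map f bs) \<in> tensor_degree W d"
          unfolding tensor_degree_def
          by (rule free.span_base)
            (use degree_preserving_blocks[OF deg, of "is" bs] bs w in auto)
      qed
    qed
  qed
  fix x :: "'v list \<Rightarrow>\<^sub>0 'k" assume "x \<in> words"
  let ?T = "free_lin (\<lambda>(u, v). tensor (?M (free_of u)) (?M (free_of v)))"
  have "deconcatenation (?M x) = ?T (deconcatenation x)"
  proof (rule free_linear_eqI[OF free_linear_compose[OF free_linear_deconcatenation lin]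
        free_linear_compose[OF free_linear_free_lin free_linear_deconcatenation]])
    fix w :: "'v list"
    let ?h = "\<lambda>b c. if c = [] then 0 else free_of (map f b, map f c) :: _ \<Rightarrow>\<^sub>0 'k"
    have "deconcatenation (?M (free_of w)) = block_sum (\<lambda>bs. head_sum ?h bs) w"
      unfolding morphism_of_of free_linear_block_sum[OF free_linear_deconcatenation]
        deconcatenation_of head_sum_map by simp
    also have "\<dots> = head_sum (\<lambda>u v. block_sum (\<lambda>b. block_sum (?h b) v) u) w"
      by (rule block_sum_first)
    also have "\<dots> = head_sum (\<lambda>u v. if v = [] then 0 else tensor (?M (free_of u)) (?M (free_of v)))
        w"
    proof (rule head_sum_cong)
      fix u v :: "'v list"
      have "block_sum (?h b) v = (if v = [] then 0 else tensor (free_of (map f b)) (?M (free_of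
          v)))" for b
      proof (cases "v = []")
        case False
        then have "block_sum (?h b) v = block_sum (\<lambda>c. free_of (map f b, map f c)) v"
          by (intro block_sum_cong) auto
        then show ?thesis
          using False by (simp add: morphism_of_of free_linear_block_sum[OF tensor_bilinear(1)])
      qed simp
      then show "block_sum (\<lambda>b. block_sum (?h b) v) u =
          (if v = [] then 0 else tensor (?M (free_of u)) (?M (free_of v)))"
        by (simp add: morphism_of_of[of f u] free_linear_block_sum[OF tensor_bilinear(2)])
    qed
    also have "\<dots> = ?T (deconcatenation (free_of w))"
      unfolding deconcatenation_of free_linear_head_sum[OF free_linear_free_lin]
      by (intro head_sum_cong) (simp add: free_linear_0[OF free_linear_free_lin])
    finally show "deconcatenation (?M (free_of w)) = ?T (deconcatenation (free_of w))" .
  qed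
  then show "deconcatenation (?M x) - ?T (deconcatenation x) \<in> tensor_null2 W"
    by (simp add: tensor_null2_def free.span_zero)
qed

section \<open>Codifferentials\<close>

abbreviation susp_sign :: "('k, 'v::ab_group_add, 'm) graded_space_scheme \<Rightarrow> 'v \<Rightarrow> 'v"
  where "susp_sign V x \<equiv> - deg_sign V x"

lemma codiff_of:
  "codiff A (free_of w) = infix_sum (\<lambda>u b v. free_of (map (susp_sign A) u @ [coeff_Q A b] @ v)) w"
  by (simp add: codiff_def infix_sum_def)

lemma free_linear_codiff: "free_linear (codiff A)"
  unfolding codiff_def by (rule free_linear_free_lin)

lemma codiff_words: "codiff A x \<in> words"
  by (rule free_linear_in_subspace[OF free_linear_codiff subspace_words])
    (auto simp: codiff_of intro!: infix_sum_in_subspace[OF subspace_words] words_of)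

lemma codiff_Cons:
  "codiff A (free_of (x # w)) = head_sum (\<lambda>b v. free_of (coeff_Q A b # v)) (x # w) +
    prepend (susp_sign A x) (codiff A (free_of w))"
  by (simp add: codiff_of infix_sum_Cons free_linear_infix_sum[OF free_linear_prepend])

text \<open>
  With the recursion of the codifferential along the first letter, a relation at a later
  letter is handled by induction, and only the factors that start at the first letter are new.
\<close>

lemma codiff_null:
  fixes A :: "('k::field, 'v::ab_group_add, 'm) ainf_scheme"
  assumes q: "multilinear A A (coeff_Q A)"
    and add: "\<And>x y. deg_sign A (x + y) = deg_sign A x + deg_sign A y"
    and scale: "\<And>c x. susp_sign A (scal A c x) = scal A c (susp_sign A x)"
    and x: "x \<in> tensor_null A"
  shows "codiff A x \<in> tensor_null A"
proof (rule linear_null_into[OF free_linear_codiff subspace_tensor_null _ _ x])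
  let ?h = "\<lambda>b v. free_of (coeff_Q A b # v) :: 'v list \<Rightarrow>\<^sub>0 'k"
  fix u v x y c
  have sadd: "susp_sign A (x + y) = susp_sign A x + susp_sign A y" by (simp add: add)
  have hadd: "null_eq A (head_sum ?h (u @ (x + y) # v))
      (head_sum ?h (u @ x # v) + head_sum ?h (u @ y # v))" for u
  proof -
    have 1: "null_eq A (head_sum (\<lambda>u1 u2. ?h u1 (u2 @ (x + y) # v)) u)
        (head_sum (\<lambda>u1 u2. ?h u1 (u2 @ x # v) + ?h u1 (u2 @ y # v)) u)"
      using relation_in_null(1)[of "_ # _" x y v A]
      by (intro null_eq_head_sum) (auto simp: null_eq_def diff_diff_eq)
    have 2: "null_eq A (cut_sum (\<lambda>v1 v2. ?h (u @ (x + y) # v1) v2) v)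
        (cut_sum (\<lambda>v1 v2. ?h (u @ x # v1) v2 + ?h (u @ y # v1) v2) v)"
      using prepend_add[of A _ _ "free_of _"] q
          by (intro null_eq_cut_sum) (simp add: multilinear_def)
    show ?thesis
      using null_eq_add[OF 1 2] by (simp add: head_sum_insert head_sum_add cut_sum_add add_ac)
  qed
  have "null_eq A (codiff A (free_of (u @ (x + y) # v)))
      (codiff A (free_of (u @ x # v)) + codiff A (free_of (u @ y # v)))"
  proof (induction u)
    case Nil
    show ?case
      using null_eq_add[OF hadd[of "[]"] prepend_add[of A "susp_sign A x" "susp_sign A y"
          "codiff A (free_of v)"]]
      by (simp add: codiff_Cons sadd add_ac)
  next
    case (Cons a u)
    show ?case
      using null_eq_add[OF hadd[of "a # u"] null_eq_prepend[OF Cons.IH, of "susp_sign A a"]]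
      by (simp add: codiff_Cons free_linear_add[OF free_linear_prepend] add_ac)
  qed
  then show "codiff A (free_of (u @ [x + y] @ v)) - codiff A (free_of (u @ [x] @ v)) -
      codiff A (free_of (u @ [y] @ v)) \<in> tensor_null A"
    by (simp add: null_eq_def diff_diff_eq)
  have hscale: "null_eq A (head_sum ?h (u @ scal A c x # v))
      (free_scale c (head_sum ?h (u @ x # v)))" for u
  proof -
    have 1: "null_eq A (head_sum (\<lambda>u1 u2. ?h u1 (u2 @ scal A c x # v)) u)
        (head_sum (\<lambda>u1 u2. free_scale c (?h u1 (u2 @ x # v))) u)"
      using relation_in_null(2)[of "_ # _" A c x v]
      by (intro null_eq_head_sum) (auto simp: null_eq_def)
    have 2: "null_eq A (cut_sum (\<lambda>v1 v2. ?h (u @ scal A c x # v1) v2) v)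
        (cut_sum (\<lambda>v1 v2. free_scale c (?h (u @ x # v1) v2)) v)"
      using prepend_scale[of A c _ "free_of _"] q
          by (intro null_eq_cut_sum) (simp add: multilinear_def)
    show ?thesis
      using null_eq_add[OF 1 2]
      by (simp add: head_sum_insert free.scale_right_distrib scale_head_sum scale_cut_sum)
  qed
  have "null_eq A (codiff A (free_of (u @ scal A c x # v)))
      (free_scale c (codiff A (free_of (u @ x # v))))"
  proof (induction u)
    case Nil
    show ?case
      using null_eq_add[OF hscale[of "[]"] prepend_scale[of A c "susp_sign A x"
          "codiff A (free_of v)"]]
      by (simp add: codiff_Cons scale free.scale_right_distrib)
  next
    case (Cons a u)
    show ?case
      using null_eq_add[OF hscale[of "a # u"] null_eq_prepend[OF Cons.IH, of "susp_sign A a"]]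
      by (simp add: codiff_Cons free_linear_scale[OF free_linear_prepend] free.scale_right_distrib)
  qed
  then show "codiff A (free_of (u @ [scal A c x] @ v)) -
      free_scale c (codiff A (free_of (u @ [x] @ v))) \<in> tensor_null A"
    by (simp add: null_eq_def)
qed

text \<open>
  The first block of a word \<open>\<epsilon>(u) Q(b) v\<close> either lies in \<open>\<epsilon>(u)\<close>, and the codifferential still
  acts on what follows, or it contains \<open>Q(b)\<close>. In the second case the sum over the positions
  inside the first block is the corestriction of \<open>F Q\<close> on that block.
\<close>

lemma morphism_codiff_first_block:
  fixes A :: "('k::field, 'v::ab_group_add, 'm) ainf_scheme"
    and B :: "('k, 'w::ab_group_add, 'n) ainf_scheme"
  defines "E \<equiv> \<lambda>f. infix_sum (\<lambda>u b v. f (map (susp_sign A) u @ [coeff_Q A b] @ v))"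
  shows "null_eq B (morphism_of f (codiff A (free_of w)))
    (head_sum (\<lambda>u v. prepend (E f u) (morphism_of f (free_of v)) +
      prepend (f (map (susp_sign A) u)) (morphism_of f (codiff A (free_of v)))) w)"
proof -
  let ?M = "morphism_of f :: ('v list \<Rightarrow>\<^sub>0 'k) \<Rightarrow> ('w list \<Rightarrow>\<^sub>0 'k)" and ?s = "susp_sign A" and ?q =
      "coeff_Q A"
  have "?M (codiff A (free_of w)) = infix_sum (\<lambda>u b v. ?M (free_of (map ?s u @ ?q b # v))) w"
    by (simp add: codiff_of free_linear_infix_sum[OF free_linear_morphism_of])
  also have "\<dots> =
      infix_sum (\<lambda>u b v. head_sum (\<lambda>u1 u2. prepend (f (map ?s u1)) (?M (free_of (map ?s u2 @ ?q b
          # v)))) u) w +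
      infix_sum (\<lambda>u b v. cut_sum (\<lambda>v1 v2. prepend (f (map ?s u @ ?q b # v1)) (?M (free_of v2))) v)
          w"
    unfolding infix_sum_add[symmetric]
    by (rule infix_sum_cong) (subst morphism_of_insert, simp add: head_sum_map)
  also have "\<dots> =
      head_sum (\<lambda>u1 w'. prepend (f (map ?s u1)) (?M (codiff A (free_of w')))) w +
      head_sum (\<lambda>w1 w2. infix_sum (\<lambda>u b v1. prepend (f (map ?s u @ ?q b # v1)) (?M (free_of w2)))
          w1) w"
    unfolding infix_sum_first_before infix_sum_first_after
    by (simp add: codiff_of free_linear_infix_sum[OF free_linear_prepend]
        free_linear_infix_sum[OF free_linear_morphism_of])
  also have "null_eq B \<dots> (head_sum (\<lambda>u1 w'. prepend (f (map ?s u1)) (?M (codiff A (free_of w'))))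
      w +
      head_sum (\<lambda>w1 w2. prepend (E f w1) (?M (free_of w2))) w)"
    by (intro null_eq_add null_eq_refl null_eq_head_sum null_eq_sym[OF prepend_infix_sum])
      (simp add: E_def null_eq_sym[OF prepend_infix_sum])
  finally show ?thesis by (simp add: head_sum_add add.commute)
qed

text \<open>
  The codifferential of the image either swallows the first blocks, and what it swallows comes
  from a prefix of the word, or it acts behind the first block.
\<close>

lemma codiff_morphism_first_block:
  fixes B :: "('k::field, 'w::ab_group_add, 'n) ainf_scheme"
  assumes "w \<noteq> []"
  shows "null_eq B (codiff B (morphism_of f (free_of w)))
    (head_sum (\<lambda>u v. prepend (block_sum (\<lambda>bs. coeff_Q B (map f bs)) u) (morphism_of f (free_of v)) +
      prepend (susp_sign B (f u)) (codiff B (morphism_of f (free_of v)))) w)"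
proof -
  let ?M = "morphism_of f :: (_ \<Rightarrow>\<^sub>0 'k) \<Rightarrow> _"
  let ?h = "\<lambda>b c. free_of (coeff_Q B (map f b) # map f c) :: _ \<Rightarrow>\<^sub>0 'k"
  have K: "codiff B (free_of (map f (b # bs))) = head_sum ?h (b # bs) +
      prepend (susp_sign B (f b)) (codiff B (free_of (map f bs)))" for b bs
    using head_sum_map[of "\<lambda>b v. free_of (coeff_Q B b # v) :: _ \<Rightarrow>\<^sub>0 'k" f "b # bs"]
    by (simp add: codiff_Cons)
  have "codiff B (?M (free_of w)) =
      head_sum (\<lambda>u v. block_sum (\<lambda>bs. codiff B (free_of (map f (u # bs)))) v) w"
    unfolding morphism_of_of free_linear_block_sum[OF free_linear_codiff]
    by (rule block_sum_first_block[OF assms])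
  also have "\<dots> = head_sum (\<lambda>u v. block_sum (\<lambda>bs. head_sum ?h (u # bs)) v) w +
      head_sum (\<lambda>u v. prepend (susp_sign B (f u)) (codiff B (?M (free_of v)))) w"
    unfolding K block_sum_add head_sum_add morphism_of_of
    by (simp add: free_linear_block_sum[OF free_linear_prepend] free_linear_block_sum[OF
        free_linear_codiff])
  also have "head_sum (\<lambda>u v. block_sum (\<lambda>bs. head_sum ?h (u # bs)) v) w =
      head_sum (\<lambda>u v. block_sum (\<lambda>b. block_sum (?h b) v) u) w"
    unfolding block_sum_first_block[OF assms, symmetric] by (rule block_sum_first)
  also have "\<dots> = head_sum (\<lambda>u v. block_sum (\<lambda>b. prepend (coeff_Q B (map f b)) (?M (free_of v))) u)
      w"
    by (simp add: morphism_of_of free_linear_block_sum[OF free_linear_prepend])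
  also have "null_eq B (\<dots> + head_sum (\<lambda>u v. prepend (susp_sign B (f u)) (codiff B (?M (free_of
      v)))) w)
      (head_sum (\<lambda>u v. prepend (block_sum (\<lambda>bs. coeff_Q B (map f bs)) u) (?M (free_of v))) w +
        head_sum (\<lambda>u v. prepend (susp_sign B (f u)) (codiff B (?M (free_of v)))) w)"
    by (intro null_eq_add null_eq_refl null_eq_head_sum null_eq_sym[OF prepend_block_sum])
  finally show ?thesis by (simp add: head_sum_add)
qed

text \<open>
  The two preceding recursions for \<open>F Q\<close> and \<open>Q F\<close> coincide if \<open>f\<close> commutes with the signs and
  the corestrictions of both agree on every word, which is the last hypothesis.
\<close>

theorem ainf_morphism_morphism_of:
  fixes A :: "('k::field, 'v::ab_group_add, 'm) ainf_scheme"
    and B :: "('k, 'w::ab_group_add, 'n) ainf_scheme"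
  assumes "multilinear A B f" "degree_preserving A B f"
    and sign: "\<And>w. w \<noteq> [] \<Longrightarrow> f (map (susp_sign A) w) = susp_sign B (f w)"
    and eq: "\<And>w. w \<noteq> [] \<Longrightarrow>
      infix_sum (\<lambda>u b v. f (map (susp_sign A) u @ [coeff_Q A b] @ v)) w =
      block_sum (\<lambda>bs. coeff_Q B (map f bs)) w"
  shows "ainf_morphism A B (morphism_of f)"
  unfolding ainf_morphism_def
proof
  show "coalgebra_morphism A B (morphism_of f)"
    by (rule coalgebra_morphism_morphism_of) fact+
  let ?M = "morphism_of f :: ('v list \<Rightarrow>\<^sub>0 'k) \<Rightarrow> ('w list \<Rightarrow>\<^sub>0 'k)"
  have main: "null_eq B (?M (codiff A (free_of w))) (codiff B (?M (free_of w)))" for w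
  proof (induction w rule: length_induct)
    case (1 w)
    show ?case
    proof (cases "w = []")
      case True
      then show ?thesis
        by (simp add: codiff_of free_linear_0[OF free_linear_morphism_of])
    next
      case False
      have "null_eq B (?M (codiff A (free_of w)))
          (head_sum (\<lambda>u v. prepend (block_sum (\<lambda>bs. coeff_Q B (map f bs)) u) (?M (free_of v)) +
            prepend (susp_sign B (f u)) (?M (codiff A (free_of v)))) w)"
      proof (rule null_eq_trans[OF morphism_codiff_first_block null_eq_head_sum])
        fix u v assume "u @ v = w" "u \<noteq> []"
        then show "null_eq B (prepend (infix_sum (\<lambda>u b v. f (map (susp_sign A) u @ [coeff_Q A b] @
            v)) u) (?M (free_of v)) +
            prepend (f (map (susp_sign A) u)) (?M (codiff A (free_of v))))
          (prepend (block_sum (\<lambda>bs. coeff_Q B (map f bs)) u) (?M (free_of v)) +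
            prepend (susp_sign B (f u)) (?M (codiff A (free_of v))))"
          using eq[of u] sign[of u] by simp
      qed
      also have "null_eq B \<dots>
          (head_sum (\<lambda>u v. prepend (block_sum (\<lambda>bs. coeff_Q B (map f bs)) u) (?M (free_of v)) +
            prepend (susp_sign B (f u)) (codiff B (?M (free_of v)))) w)"
        by (intro null_eq_head_sum null_eq_add null_eq_refl null_eq_prepend) (use 1 in auto)
      also have "null_eq B \<dots> (codiff B (?M (free_of w)))"
        by (rule null_eq_sym[OF codiff_morphism_first_block[OF False]])
      finally show ?thesis .
    qed
  qed
  show "same_map B (?M \<circ> codiff A) (codiff B \<circ> ?M)"
    unfolding o_def
    by (intro same_mapI main free_linear_compose[OF free_linear_morphism_of free_linear_codiff]
        free_linear_compose[OF free_linear_codiff free_linear_morphism_of])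
qed

text \<open>
  This holds if the coefficients are multilinear and the sign is linear (\<open>codiff_null\<close>).
\<close>

definition codiff_respects_null :: "('k::field, 'v::ab_group_add, 'm) ainf_scheme \<Rightarrow> bool"
  where "codiff_respects_null A \<longleftrightarrow> (\<forall>x\<in>tensor_null A. codiff A x \<in> tensor_null A)"

lemma codiff_null_eq:
  "codiff_respects_null A \<Longrightarrow> null_eq A x y \<Longrightarrow> null_eq A (codiff A x) (codiff A y)"
  by (simp add: codiff_respects_null_def null_eq_def free_linear_diff[OF free_linear_codiff,
      symmetric])

lemma ainf_morphismD:
  assumes "ainf_morphism A B F"
  shows "coalgebra_morphism A B F" "x \<in> words \<Longrightarrow> null_eq B (F (codiff A x)) (codiff B (F x))"
  using assms same_mapD[of B "F \<circ> codiff A" "codiff B \<circ> F" x] by (auto simp: ainf_morphism_def)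

lemma ainf_morphismI:
  assumes "coalgebra_morphism A B F" "\<And>x. x \<in> words \<Longrightarrow> null_eq B (F (codiff A x)) (codiff B (F x))"
  shows "ainf_morphism A B F"
  using assms by (auto simp: ainf_morphism_def same_map_def null_eq_def)

lemma ainf_morphism_taylor:
  fixes F :: "('v::ab_group_add list \<Rightarrow>\<^sub>0 'k::field) \<Rightarrow> ('w::ab_group_add list \<Rightarrow>\<^sub>0 'k)"
  assumes F: "ainf_morphism A B F" and B: "scalars B" "codiff_respects_null B" and w: "w \<noteq> []"
  shows "infix_sum (\<lambda>u b v. taylor B F (map (susp_sign A) u @ [coeff_Q A b] @ v)) w =
    block_sum (\<lambda>bs. coeff_Q B (map (taylor B F) bs)) w"
proof -
  note co = ainf_morphismD(1)[OF F]
  let ?M = "morphism_of (taylor B F)"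
  have "null_eq B (F (codiff A (free_of w))) (codiff B (F (free_of w)))"
    by (rule ainf_morphismD(2)[OF F words_of[OF w]])
  also have "null_eq B \<dots> (codiff B (?M (free_of w)))"
    by (intro codiff_null_eq B same_mapD[OF coalgebra_morphism_determined[OF co]] words_of w)
  finally have "corestriction B (F (codiff A (free_of w))) =
      corestriction B (codiff B (?M (free_of w)))"
    by (rule corestriction_null_eq[OF B(1)])
  moreover have "corestriction B (F (codiff A (free_of w))) =
      infix_sum (\<lambda>u b v. taylor B F (map (susp_sign A) u @ [coeff_Q A b] @ v)) w"
    unfolding codiff_of free_linear_infix_sum[OF coalgebra_morphismD(1)[OF co]] taylor_def
    by (rule infix_sum_hom) (auto simp: corestriction_add[OF B(1)])
  moreover have corest: "corestriction B (codiff B (free_of y)) = coeff_Q B y" if "y \<noteq> []" for y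
  proof -
    have "corestriction B (codiff B (free_of y)) =
        infix_sum (\<lambda>u b v. if u = [] \<and> v = [] then coeff_Q B b else 0) y"
      unfolding codiff_of by (subst infix_sum_hom)
        (auto simp: corestriction_add[OF B(1)] corestriction_of[OF B(1)] intro!: infix_sum_cong)
    also have "\<dots> = (\<Sum>(u, b, v)\<in>{([] :: 'w list, y, [] :: 'w list)}. coeff_Q B b)"
      unfolding infix_sum_def
      by (rule sum.mono_neutral_cong_right[OF finite_sub]) (use that in \<open>auto split: if_splits\<close>)
    finally show ?thesis by simp
  qed
  moreover have "corestriction B (codiff B (?M (free_of w))) =
    block_sum (\<lambda>bs. coeff_Q B (map (taylor B F) bs)) w"
  proof -
  have "corestriction B (codiff B (?M (free_of w))) =
      block_sum (\<lambda>bs. corestriction B (codiff B (free_of (map (taylor B F) bs)))) w"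
    unfolding morphism_of_of free_linear_block_sum[OF free_linear_codiff]
    by (rule block_sum_hom) (auto simp: corestriction_add[OF B(1)])
  also have "\<dots> = block_sum (\<lambda>bs. coeff_Q B (map (taylor B F) bs)) w"
  proof (rule block_sum_cong)
    fix bs assume "concat bs = w" "[] \<notin> set bs"
    then have "map (taylor B F) bs \<noteq> []" using w by auto
    then show "corestriction B (codiff B (free_of (map (taylor B F) bs))) =
        coeff_Q B (map (taylor B F) bs)"
      by (rule corest)
  qed
  finally show ?thesis .
  qed
  ultimately show ?thesis by simp
qed

lemma ainf_morphism_compose:
  assumes F: "ainf_morphism A B F" and G: "ainf_morphism B C G"
  shows "ainf_morphism A C (G \<circ> F)"
proof (rule ainf_morphismI)
  note coF = ainf_morphismD(1)[OF F] and coG = ainf_morphismD(1)[OF G]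
  show "coalgebra_morphism A C (G \<circ> F)" by (rule coalgebra_morphism_compose[OF coF coG])
  fix x :: "'b list \<Rightarrow>\<^sub>0 'a" assume x: "x \<in> words"
  have "null_eq C (G (F (codiff A x))) (G (codiff B (F x)))"
    by (rule coalgebra_morphismD(3)[OF coG ainf_morphismD(2)[OF F x]])
  also have "null_eq C \<dots> (codiff C (G (F x)))"
    by (rule ainf_morphismD(2)[OF G coalgebra_morphismD(2)[OF coF x]])
  finally show "null_eq C ((G \<circ> F) (codiff A x)) (codiff C ((G \<circ> F) x))" by simp
qed

lemma ainf_morphism_inverse:
  fixes L :: "('w::ab_group_add list \<Rightarrow>\<^sub>0 'k::field) \<Rightarrow> ('v::ab_group_add list \<Rightarrow>\<^sub>0 'k)"
  assumes F: "ainf_morphism A B F" and L: "coalgebra_morphism B A L"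
    and LF: "same_map A (L \<circ> F) id" and FL: "same_map B (F \<circ> L) id" and B: "codiff_respects_null B"
  shows "ainf_morphism B A L"
proof (rule ainf_morphismI[OF L])
  fix x :: "'w list \<Rightarrow>\<^sub>0 'k" assume x: "x \<in> words"
  note Lx = coalgebra_morphismD(2)[OF L x]
  have "null_eq B (codiff B x) (codiff B (F (L x)))"
    using same_mapD[OF FL x] by (intro codiff_null_eq[OF B]) (simp add: null_eq_sym)
  also have "null_eq B \<dots> (F (codiff A (L x)))"
    by (rule null_eq_sym[OF ainf_morphismD(2)[OF F Lx]])
  finally have "null_eq A (L (codiff B x)) (L (F (codiff A (L x))))"
    by (rule coalgebra_morphismD(3)[OF L])
  also have "null_eq A \<dots> (codiff A (L x))"
    using same_mapD[OF LF codiff_words[of A "L x"]] by simp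
  finally show "null_eq A (L (codiff B x)) (codiff A (L x))" .
qed

text \<open>
  Being an \<open>A\<^sub>\<infinity>\<close> morphism is a property of the represented map.
\<close>

lemma ainf_morphism_same_map:
  fixes F :: "('v::ab_group_add list \<Rightarrow>\<^sub>0 'k::field) \<Rightarrow> ('w::ab_group_add list \<Rightarrow>\<^sub>0 'k)"
  assumes F: "ainf_morphism A B F" and G: "coalgebra_morphism A B G" and FG: "same_map B G F"
    and B: "codiff_respects_null B"
  shows "ainf_morphism A B G"
proof (rule ainf_morphismI[OF G])
  fix x :: "'v list \<Rightarrow>\<^sub>0 'k" assume x: "x \<in> words"
  have "null_eq B (G (codiff A x)) (F (codiff A x))"
    by (rule same_mapD[OF FG codiff_words])
  also have "null_eq B \<dots> (codiff B (F x))" by (rule ainf_morphismD(2)[OF F x])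
  also have "null_eq B \<dots> (codiff B (G x))"
    by (intro codiff_null_eq[OF B] null_eq_sym[OF same_mapD[OF FG x]])
  finally show "null_eq B (G (codiff A x)) (codiff B (G x))" .
qed

text \<open>
  In a cutting of a word with a 0-form, the block containing the 0-form is sent to a 0-form:
  to its image under \<open>l\<close> if the block is a single letter, and to zero otherwise. So the outer
  coefficient vanishes unless there is only one block, and then its argument is zero.
\<close>

lemma ainf_with_linear_part_compose:
  fixes F :: "(('p::ab_group_add \<times> 'q::ab_group_add) list \<Rightarrow>\<^sub>0 'k::field) \<Rightarrow> (('r::ab_group_add \<times>
      's::ab_group_add) list \<Rightarrow>\<^sub>0 'k)"
    and G :: "(('r \<times> 's) list \<Rightarrow>\<^sub>0 'k) \<Rightarrow> ('w::ab_group_add list \<Rightarrow>\<^sub>0 'k)"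
  assumes F: "ainf_with_linear_part A B l F" and G: "ainf_with_linear_part B C m G"
    and B: "scalars B" and C: "scalars C" and l: "\<And>x. zero_form x \<Longrightarrow> zero_form (l x)"
  shows "ainf_with_linear_part A C (m \<circ> l) (G \<circ> F)"
proof -
  have F': "ainf_morphism A B F" "\<And>x. taylor B F [x] = l x"
    "\<And>xs x. length xs \<ge> 2 \<Longrightarrow> x \<in> set xs \<Longrightarrow> zero_form x \<Longrightarrow> taylor B F xs = 0"
    and G': "ainf_morphism B C G" "\<And>x. taylor C G [x] = m x"
    "\<And>xs x. length xs \<ge> 2 \<Longrightarrow> x \<in> set xs \<Longrightarrow> zero_form x \<Longrightarrow> taylor C G xs = 0"
    using F G by (auto simp: ainf_with_linear_part_def)
  note tay = taylor_compose[OF ainf_morphismD(1)[OF F'(1)] ainf_morphismD(1)[OF G'(1)] B C]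
  have lin: "taylor C (G \<circ> F) [x] = (m \<circ> l) x" for x
    by (simp add: tay block_sum_first_block[of "[x]"] head_sum_Cons F' G')
  have van: "taylor C (G \<circ> F) xs = 0" if xs: "length xs \<ge> 2" "x \<in> set xs" "zero_form x" for xs x
  proof -
    have "taylor C G (map (taylor B F) bs) = 0" if bs: "concat bs = xs" "[] \<notin> set bs" for bs
    proof -
      obtain b where b: "b \<in> set bs" "x \<in> set b" using xs bs by auto
      have z: "zero_form (taylor B F b)"
      proof (cases "length b \<ge> 2")
        case True
        then show ?thesis using F'(3)[OF _ b(2) xs(3)] by (simp add: zero_form_def)
      next
        case False
        then have "b = [x]" using b(2) by (cases b) (auto simp: numeral_2_eq_2 Suc_le_eq)
        then show ?thesis using F'(2) l xs(3) by simp
      qed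
      show ?thesis
      proof (cases "length bs \<ge> 2")
        case True
        then show ?thesis using G'(3)[of "map (taylor B F) bs", OF _ _ z] b(1) by simp
      next
        case False
        then have "bs = [xs]" using b(1) bs by (cases bs) (auto simp: numeral_2_eq_2 Suc_le_eq)
        then have "map (taylor B F) bs = [0]" using F'(3)[OF xs] by simp
        moreover have "taylor C G [0] = 0"
          using multilinear_zero[OF multilinear_taylor[OF ainf_morphismD(1)[OF G'(1)] C], of
              "[0]"] by simp
        ultimately show ?thesis by simp
      qed
    qed
    then have "block_sum (\<lambda>bs. taylor C G (map (taylor B F) bs)) xs = block_sum (\<lambda>bs. 0) xs"
      by (rule block_sum_cong)
    moreover have "xs \<noteq> []" using xs(1) by auto
    ultimately show ?thesis by (simp add: tay)
  qed
  show ?thesis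
    unfolding ainf_with_linear_part_def
  proof (intro conjI allI impI)
    show "ainf_morphism A C (G \<circ> F)" by (rule ainf_morphism_compose[OF F'(1) G'(1)])
    show "taylor C (G \<circ> F) [x] = (m \<circ> l) x" for x by (rule lin)
    show "taylor C (G \<circ> F) xs = 0" if "2 \<le> length xs \<and> (\<exists>x\<in>set xs. zero_form x)" for xs
      using that van by blast
  qed
qed

section \<open>Whitney forms\<close>

lemma proj01_simps [simp]: "proj01 0 x = (fst x, 0)" "proj01 1 x = (0, snd x)" "proj01 i 0 = 0"
  by (simp_all add: proj01_def zero_prod_def)

lemma deg_sign_01:
  assumes "proj V = proj01"
  shows "deg_sign V x = (fst x, - snd x)"
proof -
  have "deg_sign V x = (\<Sum>i\<in>{0, 1}. if even i then proj01 i x else - proj01 i x)"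
    unfolding deg_sign_def assms
    by (rule sum.mono_neutral_cong_left) (auto simp: proj01_def zero_prod_def split: if_splits)
  then show ?thesis by simp
qed

lemma C_cup_simps [simp]: "scal C_cup = scal whitney_space" "proj C_cup = proj01"
  and C_inf_simps [simp]: "scal C_inf = scal whitney_space" "proj C_inf = proj01"
  and whitney_scal [simp]: "scal whitney_space r x = ((r * fst (fst x), r * snd (fst x)),
      r * snd x)"
  by (simp_all add: C_cup_def C_inf_def whitney_space_def ainf_of_dga_def split_beta)

lemma whitney_proj01 [simp]: "proj whitney_space = proj01"
  by (simp add: whitney_space_def)

lemma scalars_whitney: "scal V = scal whitney_space \<Longrightarrow> scalars V"
  by unfold_locales (auto simp: algebra_simps)

lemma scalars_C: "scalars C_cup" "scalars C_inf" "scalars whitney_space"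
  by (rule scalars_whitney; simp)+

lemma coeff_Q_C_cup:
  "coeff_Q C_cup [x] = (0, - coeff_t x)"
  "coeff_Q C_cup [x, y] = ((fst (fst x) * fst (fst y), snd (fst x) * snd (fst y)),
    snd (fst x) * snd y - snd x * fst (fst y))"
  "length w > 2 \<Longrightarrow> coeff_Q C_cup w = 0"
  by (auto simp: C_cup_def ainf_of_dga_def deg_sign_01 coeff_t_def split_beta zero_prod_def
      split: list.splits)

lemma susp_sign_01: "proj V = proj01 \<Longrightarrow> susp_sign V x = (- fst x, snd x)"
  by (simp add: deg_sign_01)

lemma codiff_respects_null_C_cup: "codiff_respects_null C_cup"
  unfolding codiff_respects_null_def
proof (intro ballI codiff_null)
  let ?q = "coeff_Q (C_cup :: ('k::field_char_0, 'k whitney) ainf)"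
  have cases: "(u = [] \<and> v = []) \<or> (\<exists>a. u = [a] \<and> v = []) \<or> (\<exists>a. u = [] \<and> v = [a]) \<or>
      (\<forall>x. length (u @ [x] @ v) > 2)" for u v :: "'k whitney list"
    by (cases u; cases v; cases "tl u"; cases "tl v") auto
  show "multilinear C_cup C_cup ?q"
    unfolding multilinear_def
  proof (intro conjI allI)
    show "?q (u @ [x + y] @ v) = ?q (u @ [x] @ v) + ?q (u @ [y] @ v)" for u v x y
      using cases[of u v]
      by (elim disjE exE) (auto simp: coeff_Q_C_cup coeff_t_def algebra_simps)
    show "?q (u @ [scal C_cup c x] @ v) = scal C_cup c (?q (u @ [x] @ v))" for u v c x
      using cases[of u v]
      by (elim disjE exE) (auto simp: coeff_Q_C_cup coeff_t_def algebra_simps zero_prod_def)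
  qed
qed (auto simp: deg_sign_01)

text \<open>
  Coefficients of a dg algebra have order at most two, so only cuttings into one or two blocks
  contribute.
\<close>

lemma block_sum_two:
  assumes "w \<noteq> []" and q: "\<And>y. length y > 2 \<Longrightarrow> q y = 0"
  shows "block_sum (\<lambda>bs. q (map f bs)) w =
    q [f w] + head_sum (\<lambda>u v. if v = [] then 0 else q [f u, f v]) w"
proof -
  have inner: "block_sum (\<lambda>bs. q (f u # map f bs)) v = (if v = [] then q [f u] else q [f u, f v])"
      for u v
  proof (cases "v = []")
    case False
    have "block_sum (\<lambda>bs. q (f u # map f bs)) v =
        head_sum (\<lambda>u' v'. block_sum (\<lambda>bs. q (f u # f u' # map f bs)) v') v"
      by (simp add: block_sum_first_block[OF False])
    also have "\<dots> = head_sum (\<lambda>u' v'. if v' = [] then q [f u, f u'] else 0) v"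
    proof (rule head_sum_cong)
      fix u' v'
      have "block_sum (\<lambda>bs. q (f u # f u' # map f bs)) v' = block_sum (\<lambda>bs. 0) v'" if "v' \<noteq> []"
      proof (rule block_sum_cong)
        fix bs assume "concat bs = v'"
        then have "bs \<noteq> []" using that by auto
        then show "q (f u # f u' # map f bs) = 0" by (intro q) (cases bs; simp)
      qed
      then show "block_sum (\<lambda>bs. q (f u # f u' # map f bs)) v' = (if v' = [] then q [f u, f u']
          else 0)"
        by auto
    qed
    finally show ?thesis using False by (simp add: head_sum_whole)
  qed simp
  have "block_sum (\<lambda>bs. q (map f bs)) w =
      head_sum (\<lambda>u v. (if v = [] then q [f u] else 0) + (if v = [] then 0 else q [f u, f v])) w"
    by (simp add: block_sum_first_block[OF assms(1)] inner) (intro head_sum_cong, simp)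
  then show ?thesis
    by (simp add: head_sum_add head_sum_whole assms(1))
qed

text \<open>
  The right-hand side of the morphism equation into \<open>C\<^sub>\<union>\<close>. As the product of two 1-forms is
  zero, only the cuttings that split off the first or the last letter survive. Since \<open>(1 - t)
  \<union> dt = dt\<close> and \<open>dt \<union> t = dt\<close>, they see the value at 0 of the first and the value at 1 of the
  last letter.
\<close>

lemma C_cup_block_sum:
  assumes w: "length w \<ge> 2" and f: "\<And>w. length w \<ge> 2 \<Longrightarrow> fst (f w) = 0"
  shows "block_sum (\<lambda>bs. coeff_Q C_cup (map f bs)) w =
    (if length w = 2 then (fst (fst (f [hd w])) * fst (fst (f [last w])), snd (fst (f [hd w])) *
        snd (fst (f [last w]))) else 0,
     snd (fst (f [hd w])) * snd (f (tl w)) - snd (f (butlast w)) * fst (fst (f [last w])))"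
proof -
  let ?q = "coeff_Q C_cup"
  obtain x w' where w': "w = x # w'" "w' \<noteq> []" using w by (cases w; cases "tl w") auto
  have q1: "?q [f w] = 0" using f[OF w] by (simp add: coeff_Q_C_cup coeff_t_def zero_prod_def)
  have q2: "?q [f (x # u), f v] = (if length v = 1 then (0, - snd (f (x # u)) * fst (fst (f v)))
      else 0)"
    if "u @ v = w'" "u \<noteq> []" "v \<noteq> []" for u v
  proof -
    have "fst (f (x # u)) = 0" using that by (intro f) (cases u; simp)
    moreover have "length v = 1 \<or> fst (f v) = 0" using that f[of v] by (cases v; cases "tl v") auto
    ultimately show ?thesis by (auto simp: coeff_Q_C_cup zero_prod_def)
  qed
  have "w \<noteq> []" using w'(1) by simp
  then have "block_sum (\<lambda>bs. ?q (map f bs)) w =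
      ?q [f w] + head_sum (\<lambda>u v. if v = [] then 0 else ?q [f u, f v]) w"
    by (rule block_sum_two) (rule coeff_Q_C_cup(3))
  then have "block_sum (\<lambda>bs. ?q (map f bs)) w = head_sum (\<lambda>u v. if v = [] then 0 else ?q [f u,
      f v]) w"
    by (simp only: q1 add_0)
  also have "\<dots> = ?q [f [x], f w'] + head_sum (\<lambda>u v. if v = [] then 0 else ?q [f (x # u), f v]) w'"
    using w' by (simp add: head_sum_Cons cut_sum_first)
  also have "head_sum (\<lambda>u v. if v = [] then 0 else ?q [f (x # u), f v]) w' =
      head_sum (\<lambda>u v. if length v = 1 then (0, - snd (f (x # u)) * fst (fst (f v))) else 0) w'"
    by (rule head_sum_cong) (auto simp: q2)
  also have "\<dots> = (if length w' \<ge> 2 then (0, - snd (f (butlast w)) * fst (fst (f [last w]))) else 0)"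
  proof (cases "length w' \<ge> 2")
    case False
    then obtain y where "w' = [y]" using w' by (cases w'; cases "tl w'") auto
    then show ?thesis by (simp add: head_sum_Cons)
  next
    case True
    then show ?thesis
      using w' head_sum_last[OF True, of "\<lambda>u v. (0, - snd (f (x # u)) * fst (fst (f v)))"] by simp
  qed
  finally have *: "block_sum (\<lambda>bs. ?q (map f bs)) w = ?q [f [x], f w'] +
    (if length w' \<ge> 2 then (0, - snd (f (butlast w)) * fst (fst (f [last w]))) else 0)" .
  show ?thesis
  proof (cases "length w' \<ge> 2")
    case True
    then have "fst (f w') = 0" by (rule f)
    then show ?thesis
      using True w' unfolding * by (simp add: coeff_Q_C_cup zero_prod_def)
  next
    case False
    then obtain y where "w' = [y]" using w' by (cases w'; cases "tl w'") auto
    then show ?thesis using w' unfolding * by (simp add: coeff_Q_C_cup zero_prod_def)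
  qed
qed

lemma degrees_of_one_forms:
  "list_all2 (\<lambda>i v. proj01 i v = v) is w \<Longrightarrow> (\<And>x. x \<in> set w \<Longrightarrow> snd x \<noteq> 0) \<Longrightarrow> (\<Sum>i\<leftarrow>is. i - 1) = 0"
proof (induction rule: list_all2_induct)
  case (Cons i "is" v vs)
  then have "proj01 i v = v" "snd v \<noteq> 0" "(\<Sum>i\<leftarrow>is. i - 1) = 0" by auto
  then show ?case by (cases v) (auto simp: proj01_def split: if_splits)
qed simp

text \<open>
  A homogeneous word on which such a coefficient is not zero consists of 1-forms, and these
  have degree zero in the suspension.
\<close>

lemma degree_preserving_01:
  fixes V :: "('k::field, 'p::ab_group_add \<times> 'q::ab_group_add, 'm) graded_space_scheme"
    and W :: "('k, 'r::ab_group_add \<times> 's::ab_group_add, 'n) graded_space_scheme"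
  assumes V: "proj V = proj01" and W: "proj W = proj01"
    and single: "\<And>x. f [x] = (g (fst x), h (snd x))" and gh: "g 0 = 0" "h 0 = 0"
    and fn: "\<And>w. length w \<ge> 2 \<Longrightarrow> fst (f w) = 0"
    and van: "\<And>w x. length w \<ge> 2 \<Longrightarrow> x \<in> set w \<Longrightarrow> snd x = 0 \<Longrightarrow> f w = 0"
  shows "degree_preserving V W f"
  unfolding degree_preserving_def V W
proof (intro allI impI, elim conjE)
  fix "is" and w :: "('p \<times> 'q) list" assume w: "w \<noteq> []" "list_all2 (\<lambda>i v. proj01 i v = v) is w"
  show "proj01 ((\<Sum>i\<leftarrow>is. i - 1) + 1) (f w) = f w"
  proof (cases "length w = 1")
    case True
    then obtain x where x: "w = [x]" by (auto simp: length_Suc_conv)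
    then obtain i where "is = [i]" "proj01 i x = x" using w(2) by (auto simp: list_all2_Cons2)
    then show ?thesis
      using gh by (cases x) (auto simp: x single proj01_def split: if_splits)
  next
    case False
    then have len: "length w \<ge> 2" using w(1) by (cases w) (auto simp: Suc_le_eq numeral_2_eq_2)
    show ?thesis
    proof (cases "\<exists>x\<in>set w. snd x = 0")
      case True
      then show ?thesis using van[OF len] by auto
    next
      case False
      then have "(\<Sum>i\<leftarrow>is. i - 1) = 0" using degrees_of_one_forms[OF w(2)] by blast
      then show ?thesis using fn[OF len] by (cases "f w") auto
    qed
  qed
qed

section \<open>Coefficients that are multiples of dt on powers of dt\<close>

abbreviation dt_prod :: "'k::field_char_0 whitney list \<Rightarrow> 'k"
  where "dt_prod w \<equiv> \<Prod>x\<leftarrow>w. coeff_dt x"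

text \<open>
  The coefficients \<open>dt\<^sup>\<otimes>\<^sup>n \<mapsto> a\<^sub>n dt\<close>; the first one is the identity if \<open>a\<^sub>1 = 1\<close>.
\<close>

definition dt_coeffs :: "(nat \<Rightarrow> 'k) \<Rightarrow> 'k::field_char_0 whitney list \<Rightarrow> 'k whitney"
  where "dt_coeffs a w =
    (if length w = 1 then fst (hd w) else 0, a (length w) * (dt_prod w))"

lemma dt_coeffs_multilinear:
  assumes "scal A = scal whitney_space" "scal B = scal whitney_space"
  shows "multilinear A B (dt_coeffs a)"
  unfolding multilinear_def dt_coeffs_def assms
  by (auto simp: coeff_dt_def algebra_simps zero_prod_def plus_prod_def split_beta)

lemma prod_list_0: "x \<in> set w \<Longrightarrow> g x = (0 :: 'k::field) \<Longrightarrow> (\<Prod>x\<leftarrow>w. g x) = 0"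
  by (induction w) auto

lemma dt_coeffs_single: "a 1 = 1 \<Longrightarrow> dt_coeffs a [x] = x"
  by (simp add: dt_coeffs_def coeff_dt_def)

lemma dt_coeffs_vanish: "length w \<ge> 2 \<Longrightarrow> x \<in> set w \<Longrightarrow> snd x = 0 \<Longrightarrow> dt_coeffs a w = 0"
  using prod_list_0[of x w coeff_dt] by (simp add: dt_coeffs_def coeff_dt_def zero_prod_def)

lemma fst_dt_coeffs: "length w \<ge> 2 \<Longrightarrow> fst (dt_coeffs a w) = 0"
  by (simp add: dt_coeffs_def)

lemma dt_coeffs_degree:
  assumes "proj A = proj01" "proj B = proj01"
  shows "degree_preserving A B (dt_coeffs a)"
  by (rule degree_preserving_01[where g = id and h = "\<lambda>c. a 1 * c", OF assms])
    (auto simp: dt_coeffs_vanish fst_dt_coeffs, simp add: dt_coeffs_def coeff_dt_def)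

lemma dt_coeffs_sign:
  assumes "proj A = proj01" "proj B = proj01"
  shows "w \<noteq> [] \<Longrightarrow> dt_coeffs a (map (susp_sign A) w) = susp_sign B (dt_coeffs a w)"
  by (auto simp: dt_coeffs_def susp_sign_01[OF assms(1)] susp_sign_01[OF assms(2)] deg_sign_01[OF
      assms(1)]
      deg_sign_01[OF assms(2)] coeff_dt_def o_def hd_map)

text \<open>
  Cuttings into \<open>k\<close> blocks are compositions of the length with \<open>k\<close> parts, the index set of the
  coefficients of a \<open>k\<close>-th power.
\<close>

lemma block_sum_power:
  fixes b :: "'k::field_char_0 fps"
  assumes "fps_nth b 0 = 0"
  shows "block_sum (\<lambda>bs. if length bs = k then (\<Prod>x\<leftarrow>bs. fps_nth b (length x)) else 0) w =
    fps_nth (b ^ k) (length w)"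
proof (induction k arbitrary: w)
  case 0
  show ?case by (cases "w = []") (auto simp: block_sum_first_block)
next
  case (Suc k)
  show ?case
  proof (cases "w = []")
    case True
    then show ?thesis using assms by simp
  next
    case False
    have "block_sum (\<lambda>bs. if length bs = Suc k then (\<Prod>x\<leftarrow>bs. fps_nth b (length x)) else 0) w =
        head_sum (\<lambda>u v. fps_nth b (length u) *
          block_sum (\<lambda>bs. if length bs = k then (\<Prod>x\<leftarrow>bs. fps_nth b (length x)) else 0) v) w"
      unfolding block_sum_first_block[OF False]
      by (intro head_sum_cong, subst block_sum_hom[of "(*) _"])
        (auto simp: algebra_simps intro!: block_sum_cong)
    also have "\<dots> = cut_sum (\<lambda>u v. fps_nth b (length u) * fps_nth (b ^ k) (length v)) w"
      by (simp add: Suc.IH cut_sum_first assms)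
    also have "\<dots> = fps_nth (b * b ^ k) (length w)"
      by (simp add: cut_sum_lengths[of "\<lambda>i j. fps_nth b i * fps_nth (b ^ k) j"] fps_mult_nth
          atLeast0AtMost)
    finally show ?thesis by simp
  qed
qed

lemma dt_coeffs_compose:
  fixes a b :: "'k::field_char_0 fps"
  assumes b: "fps_nth b 0 = 0" and w: "w \<noteq> []"
  shows "block_sum (\<lambda>bs. dt_coeffs (fps_nth a) (map (dt_coeffs (fps_nth b)) bs)) w =
    dt_coeffs (fps_nth (a oo b)) w"
proof (rule prod_eqI)
  have "fst (block_sum (\<lambda>bs. dt_coeffs (fps_nth a) (map (dt_coeffs (fps_nth b)) bs)) w) =
      block_sum (\<lambda>bs. if bs = [w] then fst (dt_coeffs (fps_nth b) w) else 0) w"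
    by (subst block_sum_hom[of fst])
      (auto simp: dt_coeffs_def length_Suc_conv intro!: block_sum_cong)
  also have "\<dots> = fst (dt_coeffs (fps_nth (a oo b)) w)"
    using w by (simp add: block_sum_def finite_blocks dt_coeffs_def)
  finally show "fst (block_sum (\<lambda>bs. dt_coeffs (fps_nth a) (map (dt_coeffs (fps_nth b)) bs)) w) =
      fst (dt_coeffs (fps_nth (a oo b)) w)" .
  let ?P = "\<lambda>bs. \<Prod>x\<leftarrow>bs. fps_nth b (length x)" and ?c = "dt_prod w"
  have prod: "(\<Prod>x\<leftarrow>map (dt_coeffs (fps_nth b)) bs. coeff_dt x) = ?P bs * (dt_prod (concat bs))"
      for bs
    by (induction bs) (simp_all add: dt_coeffs_def coeff_dt_def)
  have snd_eq: "snd (dt_coeffs (fps_nth a) (map (dt_coeffs (fps_nth b)) bs)) =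
      fps_nth a (length bs) * (?P bs * (dt_prod (concat bs)))" for bs
    by (subst dt_coeffs_def) (simp add: prod del: map_map)
  have "snd (block_sum (\<lambda>bs. dt_coeffs (fps_nth a) (map (dt_coeffs (fps_nth b)) bs)) w) =
      block_sum (\<lambda>bs. snd (dt_coeffs (fps_nth a) (map (dt_coeffs (fps_nth b)) bs))) w"
    by (rule block_sum_hom) auto
  also have "\<dots> = block_sum (\<lambda>bs. (\<Sum>k\<le>length w. fps_nth a k * (if length bs = k then ?P bs else
      0)) * ?c) w"
  proof (rule block_sum_cong)
    fix bs assume bs: "concat bs = w" "[] \<notin> set bs"
    have "(\<Sum>k\<le>length w. fps_nth a k * (if length bs = k then ?P bs else 0)) =
        (\<Sum>k\<in>{length bs}. fps_nth a k * ?P bs)"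
      using length_le_concat[OF bs(2)] bs(1) by (intro sum.mono_neutral_cong_right) auto
    then show "snd (dt_coeffs (fps_nth a) (map (dt_coeffs (fps_nth b)) bs)) =
        (\<Sum>k\<le>length w. fps_nth a k * (if length bs = k then ?P bs else 0)) * ?c"
      unfolding snd_eq bs(1) by simp
  qed
  also have "\<dots> = (\<Sum>k\<le>length w. fps_nth a k * fps_nth (b ^ k) (length w)) * ?c"
    unfolding block_sum_power[OF b, symmetric]
    by (simp add: block_sum_def sum_distrib_left sum_distrib_right sum.swap[of _ "{..length w}"])
  also have "\<dots> = snd (dt_coeffs (fps_nth (a oo b)) w)"
    by (simp add: dt_coeffs_def fps_compose_nth atLeast0AtMost)
  finally show "snd (block_sum (\<lambda>bs. dt_coeffs (fps_nth a) (map (dt_coeffs (fps_nth b)) bs)) w) =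
      snd (dt_coeffs (fps_nth (a oo b)) w)" .
qed

lemma dt_coeffs_X: "w \<noteq> [] \<Longrightarrow> dt_coeffs (fps_nth fps_X) w = (if length w = 1 then hd w else 0)"
  by (auto simp: dt_coeffs_def length_Suc_conv coeff_dt_def zero_prod_def)

abbreviation exp_fps :: "'k::field_char_0 fps"
  where "exp_fps \<equiv> fps_exp 1 - 1"

abbreviation log_fps :: "'k::field_char_0 fps"
  where "log_fps \<equiv> fps_ln 1"

lemma exp_log_compose: "exp_fps oo log_fps = (fps_X :: 'k::field_char_0 fps)"
    "log_fps oo exp_fps = (fps_X :: 'k::field_char_0 fps)"
  using fps_inv_fps_exp_compose[of "1 :: 'k"] by (simp_all add: fps_ln_fps_exp_inv)

section \<open>Bernoulli numbers\<close>

lemma bernoulli_fps_mult: "bernoulli_fps * (fps_exp 1 - 1) = (fps_X :: 'k::field_char_0 fps)"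
proof -
  let ?E = "fps_exp 1 - 1 :: 'k fps"
  have "fps_nth ?E 1 \<noteq> 0" by simp
  then have ne: "?E \<noteq> 0" by (metis fps_zero_nth)
  have "subdegree ?E = 1" by (rule subdegreeI) auto
  then have "?E dvd fps_X" using ne by (simp add: fps_dvd_iff)
  then show ?thesis unfolding bernoulli_fps_def by simp
qed

lemma bernoulli_sum:
  "(\<Sum>m\<le>n. fps_nth bernoulli_fps m * (if n - m = 0 then 0 else 1 / fact (n - m))) =
    (if n = 1 then 1 else 0 :: 'k::field_char_0)"
proof -
  have "(\<Sum>m\<le>n. fps_nth bernoulli_fps m * (if n - m = 0 then 0 else 1 / fact (n - m))) =
      fps_nth (bernoulli_fps * (fps_exp 1 - 1)) n"
    unfolding fps_mult_nth atLeast0AtMost by (intro sum.cong) auto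
  then show ?thesis by (simp add: bernoulli_fps_mult fps_X_nth)
qed

lemma bernoulli_fps_low: "fps_nth bernoulli_fps 0 = (1 :: 'k::field_char_0)"
    "fps_nth bernoulli_fps (Suc 0) = (- 1 / 2 :: 'k::field_char_0)"
proof -
  have 0: "fps_nth bernoulli_fps 0 = (1 :: 'k)" using bernoulli_sum[of 1] by simp
  then show "fps_nth bernoulli_fps 0 = (1 :: 'k)" .
  have "(\<Sum>m\<le>Suc (Suc 0). fps_nth bernoulli_fps m * (if 2 - m = 0 then 0 else 1 / fact (2 - m))) =
      (0 :: 'k)"
    using bernoulli_sum[of 2, where 'k = 'k] by (simp add: numeral_2_eq_2)
  then show "fps_nth bernoulli_fps (Suc 0) = (- 1 / 2 :: 'k)"
    using 0 by (simp add: numeral_2_eq_2 field_simps add_eq_0_iff)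
qed

lemma poly_bernoulli_poly:
  "poly (bernoulli_poly n) x = fact n * (\<Sum>j\<le>n. fps_nth bernoulli_fps j * (x ^ (n - j) / fact (n -
      j)))"
  by (simp add: bernoulli_poly_def fps_mult_nth atLeast0AtMost poly_sum poly_monom)

lemma poly_bernoulli_poly_0: "poly (bernoulli_poly n) 0 = bernoulli_number n"
proof -
  have "(\<Sum>j\<le>n. fps_nth bernoulli_fps j * (0 ^ (n - j) / fact (n - j))) =
      (\<Sum>j\<in>{n}. fps_nth bernoulli_fps j :: 'a)"
    by (rule sum.mono_neutral_cong_right) auto
  then show ?thesis by (simp add: poly_bernoulli_poly bernoulli_number_def)
qed

text \<open>
  This is why the values of the higher coefficients of \<open>\<mu>\<close> vanish at 1.
\<close>

lemma poly_bernoulli_poly_1: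
  assumes "n \<ge> 2"
  shows "poly (bernoulli_poly n) 1 = bernoulli_number n"
proof -
  have "(\<Sum>j\<le>n. fps_nth bernoulli_fps j * (1 ^ (n - j) / fact (n - j))) =
      (\<Sum>j\<le>n. fps_nth bernoulli_fps j * (if n - j = 0 then 0 else 1 / fact (n - j)) +
        (if j = n then fps_nth bernoulli_fps n else 0) :: 'a)"
    by (rule sum.cong) auto
  also have "\<dots> = fps_nth bernoulli_fps n"
    unfolding sum.distrib bernoulli_sum using assms by simp
  finally show ?thesis by (simp add: poly_bernoulli_poly bernoulli_number_def)
qed

text \<open>
  In the morphism equation for \<open>exp\<close>, this is up to sign the coefficient of a letter with \<open>K\<close>
  letters before and \<open>J\<close> letters behind it: the product of \<open>C\<^sub>\<infinity>\<close> takes in \<open>i\<close> of the former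
  and \<open>j\<close> of the latter, and the coefficient of \<open>exp\<close> is applied to the result.
\<close>

definition bernoulli_convolution :: "nat \<Rightarrow> nat \<Rightarrow> 'k::field_char_0"
  where "bernoulli_convolution K J = (\<Sum>i\<le>K. \<Sum>j\<le>J.
    (-1) ^ i * of_nat ((i + j) choose i) * fps_nth bernoulli_fps (i + j) / fact (K + J + 1 - (i +
        j)))"

text \<open>
  Grouping the terms by \<open>m = i + j\<close>, the sum over \<open>i\<close> is \<open>(1 - x)\<^sup>m\<close> by the binomial theorem,
  and the remaining letters give a geometric sum. Multiplied by \<open>y = 1 - x\<close> the latter becomes
  \<open>1 - x\<^sup>N\<^sup>+\<^sup>1\<^sup>-\<^sup>m\<close>, and the total is the coefficient of \<open>z\<^sup>N\<^sup>+\<^sup>1\<close> in \<open>(yz / (e\<^sup>y\<^sup>z - 1)) (e\<^sup>z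
  - e\<^sup>x\<^sup>z) = yz e\<^sup>x\<^sup>z\<close>.
\<close>

lemma bernoulli_convolution_gf:
  fixes x :: "'k::field_char_0"
  assumes "x \<noteq> 1"
  shows "(\<Sum>K\<le>N. bernoulli_convolution K (N - K) * x ^ K) = x ^ N / fact N"
proof -
  let ?b = "fps_nth (bernoulli_fps :: 'k fps)"
  let ?y = "1 - x"
  let ?t = "\<lambda>m i p. ?b m / fact (Suc N - m) * (of_nat (m choose i) * (- x) ^ i) * x ^ p"
  have "(\<Sum>K\<le>N. bernoulli_convolution K (N - K) * x ^ K) =
      (\<Sum>(K, i, j)\<in>Sigma {..N} (\<lambda>K. {..K} \<times> {..N - K}). ?t (i + j) i (K - i))"
  proof -
    have summand: "(-1) ^ i * of_nat ((i + j) choose i) * ?b (i + j) / fact (K + (N - K) + 1 -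
        (i + j)) * x ^ K =
        ?t (i + j) i (K - i)" if "i \<le> K" "K \<le> N" for i j K
      using that by (simp add: power_minus[of x] power_add[symmetric] mult_ac)
    have "(\<Sum>K\<le>N. bernoulli_convolution K (N - K) * x ^ K) =
        (\<Sum>K\<le>N. \<Sum>i\<le>K. \<Sum>j\<le>N - K. ?t (i + j) i (K - i))"
      unfolding bernoulli_convolution_def sum_distrib_right
      by (intro sum.cong refl summand) auto
    then show ?thesis
      by (subst sum.Sigma[symmetric]) (auto simp: sum.cartesian_product)
  qed
  also have "\<dots> = (\<Sum>(m, i, p)\<in>Sigma {..N} (\<lambda>m. {..m} \<times> {..N - m}). ?t m i p)"
    \<comment> \<open>The new index \<open>p = K - i\<close> counts the letters in front that are left over.\<close>
    by (rule sum.reindex_bij_witness[where i = "\<lambda>(m, i, p). (i + p, i, m - i)" and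
          j = "\<lambda>(K, i, j). (i + j, i, K - i)"]) auto
  also have "\<dots> = (\<Sum>m\<le>N. ?b m / fact (Suc N - m) *
      (\<Sum>i\<le>m. of_nat (m choose i) * (- x) ^ i) * (\<Sum>p\<le>N - m. x ^ p))"
  proof -
    have "(\<Sum>(m, i, p)\<in>Sigma {..N} (\<lambda>m. {..m} \<times> {..N - m}). ?t m i p) =
        (\<Sum>m\<le>N. \<Sum>i\<le>m. \<Sum>p\<le>N - m. ?t m i p)"
      by (subst sum.Sigma[symmetric]) (auto simp: sum.cartesian_product)
    then show ?thesis by (simp only: sum_distrib_left[symmetric] sum_distrib_right[symmetric])
  qed
  also have "\<dots> = (\<Sum>m\<le>N. ?b m / fact (Suc N - m) * ?y ^ m * (\<Sum>p\<le>N - m. x ^ p))"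
  proof (intro sum.cong refl arg_cong2[where f = "(*)"])
    show "(\<Sum>i\<le>m. of_nat (m choose i) * (- x) ^ i) = ?y ^ m" for m
      using binomial_ring[of "- x" 1 m] by simp
  qed
  finally have "?y * (\<Sum>K\<le>N. bernoulli_convolution K (N - K) * x ^ K) =
      (\<Sum>m\<le>N. ?b m / fact (Suc N - m) * ?y ^ m * (?y * (\<Sum>p\<le>N - m. x ^ p)))"
    by (simp add: sum_distrib_left algebra_simps)
  also have "\<dots> = (\<Sum>m\<le>N. ?b m * ?y ^ m * ((1 - x ^ (Suc N - m)) / fact (Suc N - m)))"
    by (intro sum.cong) (auto simp: sum_gp_basic Suc_diff_le)
  also have "\<dots> = fps_nth (Abs_fps (\<lambda>m. ?b m * ?y ^ m) * (fps_exp 1 - fps_exp x)) (Suc N)"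
    by (simp add: fps_mult_nth atLeast0AtMost diff_divide_distrib)
  also have "fps_exp 1 - fps_exp x = (fps_exp ?y - 1) * fps_exp x"
    by (simp add: algebra_simps fps_exp_add_mult[symmetric])
  also have "Abs_fps (\<lambda>m. ?b m * ?y ^ m) * ((fps_exp ?y - 1) * fps_exp x) =
      (fps_const ?y * fps_X) * fps_exp x"
  proof -
    have "Abs_fps (\<lambda>m. ?b m * ?y ^ m) * (fps_exp ?y - 1) = fps_const ?y * fps_X"
    proof (rule fps_ext)
      fix n
      have "fps_nth (Abs_fps (\<lambda>m. ?b m * ?y ^ m) * (fps_exp ?y - 1)) n =
          (\<Sum>m\<le>n. ?y ^ n * (?b m * (if n - m = 0 then 0 else 1 / fact (n - m))))"
        unfolding fps_mult_nth atLeast0AtMost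
        by (intro sum.cong) (auto simp: power_add[symmetric] mult_ac)
      also have "\<dots> = fps_nth (fps_const ?y * fps_X) n"
        unfolding sum_distrib_left[symmetric] bernoulli_sum
            by (cases "n = 1") (auto simp: fps_X_nth)
      finally show "fps_nth (Abs_fps (\<lambda>m. ?b m * ?y ^ m) * (fps_exp ?y - 1)) n =
          fps_nth (fps_const ?y * fps_X) n" .
    qed
    then show ?thesis by (simp only: mult.assoc[symmetric])
  qed
  also have "fps_nth (fps_const ?y * fps_X * fps_exp x) (Suc N) = ?y * (x ^ N / fact N)"
    by (simp add: mult.assoc)
  finally have eq: "?y * (\<Sum>K\<le>N. bernoulli_convolution K (N - K) * x ^ K) = ?y * (x ^ N / fact N)" .
  have "?y \<noteq> 0" using assms by simp
  from eq show ?thesis unfolding mult_left_cancel[OF \<open>?y \<noteq> 0\<close>] .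
qed

text \<open>
  Two polynomials that agree outside \<open>1\<close> have the same coefficients.
\<close>

lemma bernoulli_convolution_eq:
  "bernoulli_convolution K J = (if J = 0 then 1 / fact K else 0 :: 'k::field_char_0)"
proof -
  let ?N = "K + J"
  define p :: "'k poly" where "p = (\<Sum>K\<le>?N. monom (bernoulli_convolution K (?N - K)) K) -
      monom (1 / fact ?N) ?N"
  have "poly p x = 0" if "x \<noteq> 1" for x
    using bernoulli_convolution_gf[OF that, of ?N] by (simp add: p_def poly_sum poly_monom)
  then have "UNIV - {1} \<subseteq> {x. poly p x = 0}" by auto
  moreover have "infinite (UNIV - {1 :: 'k})" by (simp add: infinite_UNIV_char_0)
  ultimately have "p = 0" using poly_roots_finite finite_subset by blast
  then have "coeff p K = 0" by simp
  moreover have "coeff p K = bernoulli_convolution K J - (if J = 0 then 1 / fact K else 0)"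
    by (simp add: p_def coeff_sum)
  ultimately show ?thesis by simp
qed

section \<open>The exponential and the logarithm\<close>

lemma prod_list_nth: "(\<Prod>x\<leftarrow>w. c x) = (\<Prod>j<length w. c (w ! j))"
  for c :: "'a \<Rightarrow> 'k::comm_monoid_mult"
  by (simp add: prod.list_conv_set_nth lessThan_atLeast0)

lemma one_function_form_letter_sum:
  assumes "w \<noteq> []"
  shows "one_function_form wt w = letter_sum (\<lambda>p x s. wt (length p + length s) (length p) *
    ((dt_prod p) * coeff_t x * (dt_prod s))) w"
proof -
  have "(\<Prod>j\<in>{..length w - 1} - {i}. coeff_dt (w ! j)) =
      (dt_prod (take i w)) * (\<Prod>y\<leftarrow>drop (Suc i) w. coeff_dt y)" if i: "i < length w" for i
  proof -
    have eq: "{..length w - 1} - {i} = {..<i} \<union> {Suc i..<length w}" using i by auto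
    have "(\<Prod>j\<in>{..length w - 1} - {i}. coeff_dt (w ! j)) =
        (\<Prod>j<i. coeff_dt (w ! j)) * (\<Prod>j\<in>{Suc i..<length w}. coeff_dt (w ! j))"
      unfolding eq by (rule prod.union_disjoint) auto
    also have "(\<Prod>j\<in>{Suc i..<length w}. coeff_dt (w ! j)) = (\<Prod>j<length w - Suc i. coeff_dt (w !
        (Suc i + j)))"
      by (rule prod.reindex_bij_witness[where i = "\<lambda>j. Suc i + j" and j = "\<lambda>j. j - Suc i"]) auto
    finally show ?thesis using i by (simp add: prod_list_nth)
  qed
  moreover have "{..length w - 1} = {..<length w}" using assms by (cases w) auto
  ultimately show ?thesis
    by (auto simp: one_function_form_def letter_sum_nth Let_def algebra_simps intro!: sum.cong)
qed

text \<open>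
  Separating the terms in which the letter \<open>z\<close> is the function from those in which it is not
  shows the dependence on \<open>z\<close> to be linear.
\<close>

lemma one_function_form_insert:
  fixes u v :: "'k::field_char_0 whitney list"
  obtains K L where "\<And>z. one_function_form wt (u @ z # v) = coeff_dt z * K + coeff_t z * L"
proof -
  let ?c = "\<lambda>w :: 'k whitney list. dt_prod w"
  let ?K1 = "letter_sum (\<lambda>p x s. wt (length p + Suc (length s + length v)) (length p) * (?c p *
      coeff_t x * (?c s * ?c v))) u"
  let ?K2 = "letter_sum (\<lambda>p x s. wt (length u + Suc (length p) + length s) (length u +
      Suc (length p)) * (?c u * ?c p * coeff_t x * ?c s)) v"
  let ?L = "wt (length u + length v) (length u) * (?c u * ?c v)"
  have "one_function_form wt (u @ z # v) = coeff_dt z * (?K1 + ?K2) + coeff_t z * ?L" for z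
    by (simp add: one_function_form_letter_sum letter_sum_insert)
      (simp add: letter_sum_nth sum_distrib_left algebra_simps)
  then show ?thesis by (rule that)
qed

lemma one_function_form_add:
  "one_function_form wt (u @ (x + y) # v) = one_function_form wt (u @ x # v) + one_function_form
      wt (u @ y # v)"
  and one_function_form_scale:
  "one_function_form wt (u @ scal whitney_space c x # v) = c * one_function_form wt (u @ x # v)"
proof -
  obtain K L where *: "\<And>z. one_function_form wt (u @ z # v) = coeff_dt z * K + coeff_t z * L"
    using one_function_form_insert[of wt u v] by blast
  show "one_function_form wt (u @ (x + y) # v) = one_function_form wt (u @ x # v) +
      one_function_form wt (u @ y # v)"
    "one_function_form wt (u @ scal whitney_space c x # v) = c * one_function_form wt (u @ x # v)"
    by (simp_all add: * coeff_dt_def coeff_t_def algebra_simps)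
qed

lemma one_function_form_nonzero:
  assumes "w \<noteq> []" "one_function_form wt w \<noteq> 0"
  obtains p x s where "w = p @ x # s" "coeff_t x \<noteq> 0" "\<And>y. y \<in> set p \<union> set s \<Longrightarrow> coeff_dt y \<noteq> 0"
proof -
  obtain p x s where "p @ x # s = w"
    "wt (length p + length s) (length p) * ((dt_prod p) * coeff_t x * (dt_prod s)) \<noteq> 0"
    using assms(2) unfolding one_function_form_letter_sum[OF assms(1)] letter_sum_def
    by (elim sum.not_neutral_contains_not_neutral) auto
  then show ?thesis
    using prod_list_0[of _ p coeff_dt] prod_list_0[of _ s coeff_dt] by (intro that[of p x s]) auto
qed

lemma fst_coeff_Q_C_inf:
  "w \<noteq> [] \<Longrightarrow> fst (coeff_Q C_inf w) = (if length w = 2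
    then (fst (fst (hd w)) * fst (fst (last w)), snd (fst (hd w)) * snd (fst (last w))) else 0)"
  by (auto simp: C_inf_def split_beta zero_prod_def split: list.splits)

text \<open>
  The terms \<open>m\<^sub>2(1, dt) = dt\<close> and \<open>m\<^sub>2(dt, 1) = - dt\<close>; the coefficient of \<open>1\<close> is the value at
  0.
\<close>

abbreviation unit_term :: "'k::field_char_0 whitney list \<Rightarrow> 'k"
  where "unit_term w \<equiv> (if length w = 2
    then snd (fst (hd w)) * coeff_dt (last w) - coeff_dt (hd w) * snd (fst (last w)) else 0)"

text \<open>
  The Bernoulli formula extends to one and two arguments: \<open>B\<^sub>0 = 1\<close> and \<open>B\<^sub>1 = -1/2\<close> reproduce
  \<open>m\<^sub>1(t) = - dt\<close>, \<open>m\<^sub>2(t, dt) = dt/2\<close> and \<open>m\<^sub>2(dt, t) = - dt/2\<close>. The additional term comes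
  from the unit.
\<close>

lemma snd_coeff_Q_C_inf:
  fixes w :: "'k::field_char_0 whitney list"
  assumes "w \<noteq> []"
  shows "snd (coeff_Q C_inf w) =
    - letter_sum (\<lambda>p x s. (-1) ^ length p * of_nat ((length p + length s) choose length p) *
        fps_nth bernoulli_fps (length p + length s) *
        ((dt_prod p) * coeff_t x * (dt_prod s))) w +
    unit_term w"
proof -
  consider x where "w = [x]" | x y where "w = [x, y]" | "length w > 2"
    using assms by (cases w; cases "tl w"; cases "tl (tl w)") auto
  then show ?thesis
  proof cases
    case (1 x)
    then show ?thesis by (simp add: C_inf_def letter_sum_Cons bernoulli_fps_low)
  next
    case (2 x y)
    then show ?thesis
      by (cases x; cases "fst x"; cases y; cases "fst y")
        (simp add: C_inf_def letter_sum_Cons bernoulli_fps_low coeff_t_def coeff_dt_def field_simps)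
  next
    case 3
    then have "coeff_Q C_inf w = ((0, 0), one_function_form
          (\<lambda>n i. (-1) ^ (i + 1) * of_nat (n choose i) * bernoulli_number n / fact n) w)"
      by (auto simp: C_inf_def split: list.splits)
    then show ?thesis
      using 3 by (simp add: one_function_form_letter_sum[OF assms] bernoulli_number_def
          letter_sum_nth
          sum_negf[symmetric] mult.assoc)
  qed
qed

text \<open>
  Each letter with coefficient at the unit meets its left and its right neighbour with
  opposite signs.
\<close>

lemma unit_terms_telescope:
  fixes w :: "'k::field_char_0 whitney list"
  assumes "w \<noteq> []"
  shows "infix_sum (\<lambda>u b v. (dt_prod u) *
      unit_term b *
      (dt_prod v)) w =
    snd (fst (hd w)) * (dt_prod (tl w)) - (dt_prod (butlast w)) * snd (fst (last w))"
  using assms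
proof (induction w)
  case (Cons x w)
  let ?U = "unit_term :: 'k whitney list \<Rightarrow> 'k"
  let ?c = "\<lambda>w :: 'k whitney list. dt_prod w"
  have tail: "infix_sum (\<lambda>u b v. ?c (x # u) * ?U b * ?c v) w = coeff_dt x * infix_sum
      (\<lambda>u b v. ?c u * ?U b * ?c v) w"
    by (simp add: infix_sum_def sum_distrib_left split_beta mult.assoc)
  show ?case
  proof (cases w)
    case Nil
    then show ?thesis by (simp add: infix_sum_Cons head_sum_Cons)
  next
    case (Cons y w')
    have "head_sum (\<lambda>b v. ?c [] * ?U b * ?c v) (x # w) = ?U [x, y] * ?c w'"
    proof -
      have "head_sum (\<lambda>u v. ?U (x # y # u) * ?c v) w' = head_sum (\<lambda>u v. 0) w'"
        by (rule head_sum_cong) auto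
      then show ?thesis by (simp add: Cons head_sum_Cons cut_sum_first)
    qed
    moreover have "infix_sum (\<lambda>u b v. ?c u * ?U b * ?c v) w =
        snd (fst (hd w)) * ?c (tl w) - ?c (butlast w) * snd (fst (last w))"
      using Cons.IH Cons by blast
    ultimately have "infix_sum (\<lambda>u b v. ?c u * ?U b * ?c v) (x # w) = ?U [x, y] * ?c w' +
        coeff_dt x * (snd (fst (hd w)) * ?c (tl w) - ?c (butlast w) * snd (fst (last w)))"
      by (simp only: infix_sum_Cons tail)
    also have "\<dots> = snd (fst (hd (x # w))) * ?c (tl (x # w)) - ?c (butlast (x # w)) * snd (fst
        (last (x # w)))"
      by (simp add: Cons algebra_simps)
    finally show ?thesis .
  qed
qed simp

lemma exp_fps_nth: "fps_nth exp_fps n = (if n = 0 then 0 else 1 / fact n :: 'k::field_char_0)"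
  by simp

text \<open>
  Here \<open>P\<close> and \<open>S\<close> are the letters before and behind a given letter, and \<open>p\<close> and \<open>s\<close> are those
  of them on which the product of \<open>C\<^sub>\<infinity>\<close> acts together with it. The sum depends on \<open>P\<close> and \<open>S\<close>
  only through their coefficients at \<open>dt\<close> and their lengths.
\<close>

lemma blocks_around_letter:
  fixes c :: "'a list \<Rightarrow> 'k::field_char_0"
  assumes c: "\<And>u v. c (u @ v) = c u * c v"
  shows "cut_sum (\<lambda>u p. cut_sum (\<lambda>s v. 1 / fact (length u + 1 + length v) * (c u *
      ((-1) ^ length p * of_nat ((length p + length s) choose length p) *
        fps_nth bernoulli_fps (length p + length s) * (c p * t * c s)) * c v)) S) P =
    c P * t * c S * bernoulli_convolution (length P) (length S)"
proof -
  let ?k = "\<lambda>a i j b. (-1) ^ i * of_nat ((i + j) choose i) * fps_nth bernoulli_fps (i + j) /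
    fact (a + 1 + b) :: 'k"
  have "cut_sum (\<lambda>u p. cut_sum (\<lambda>s v. 1 / fact (length u + 1 + length v) * (c u *
      ((-1) ^ length p * of_nat ((length p + length s) choose length p) *
        fps_nth bernoulli_fps (length p + length s) * (c p * t * c s)) * c v)) S) P =
    cut_sum (\<lambda>u p. cut_sum (\<lambda>s v. c P * t * c S * ?k (length u) (length p) (length s) (length v))
        S) P"
  proof (intro cut_sum_cong)
    fix u p s v assume "u @ p = P" "s @ v = S"
    then have "c P = c u * c p" "c S = c s * c v" using c by auto
    then show "1 / fact (length u + 1 + length v) * (c u *
      ((-1) ^ length p * of_nat ((length p + length s) choose length p) *
        fps_nth bernoulli_fps (length p + length s) * (c p * t * c s)) * c v) =
      c P * t * c S * ?k (length u) (length p) (length s) (length v)"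
      by (simp add: mult_ac)
  qed
  also have "\<dots> = (\<Sum>i\<le>length P. \<Sum>j\<le>length S. c P * t * c S * ?k (length P - i) i j (length S - j))"
    using cut_sum_lengths_rev[of "\<lambda>a i. \<Sum>j\<le>length S. c P * t * c S * ?k a i j (length S - j)" P]
      cut_sum_lengths[of "\<lambda>j b. c P * t * c S * ?k _ _ j b" S] by simp
  also have "\<dots> = c P * t * c S * bernoulli_convolution (length P) (length S)"
    unfolding bernoulli_convolution_def sum_distrib_left
    by (intro sum.cong refl arg_cong2[where f = "(*)"] arg_cong2[where f = "(/)"] arg_cong[where f
        = fact]) auto
  finally show ?thesis .
qed

text \<open>
  On the left, the Bernoulli terms contribute only for the last letter
  (\<open>bernoulli_convolution_eq\<close>), and the unit terms only for the first and the last. Together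
  they give the value at 0 of the first and the value at 1 of the last letter, as in \<open>C\<^sub>\<union>\<close>.
\<close>

lemma exp_coeffs_equation:
  fixes w :: "'k::field_char_0 whitney list"
  assumes w: "w \<noteq> []"
  defines "e \<equiv> dt_coeffs (fps_nth exp_fps)"
  shows "infix_sum (\<lambda>u b v. e (map (susp_sign C_inf) u @ [coeff_Q C_inf b] @ v)) w =
    block_sum (\<lambda>bs. coeff_Q C_cup (map e bs)) w"
proof (cases "length w = 1")
  case True
  then obtain x where x: "w = [x]" by (auto simp: length_Suc_conv)
  have e1: "e [x] = x" for x by (simp add: e_def dt_coeffs_single)
  show ?thesis
    by (simp add: x infix_sum_Cons head_sum_Cons block_sum_first_block e1 coeff_Q_C_cup)
      (simp add: C_inf_def zero_prod_def)
next
  case False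
  then have len: "length w \<ge> 2" using w by (cases w; cases "tl w") auto
  let ?c = "\<lambda>w :: 'k whitney list. dt_prod w"
  let ?q = "coeff_Q C_inf :: 'k whitney list \<Rightarrow> _"
  let ?L = "\<lambda>u b v. e (map (susp_sign C_inf) u @ [?q b] @ v)"
  have fst_e: "fst (e w) = 0" if "length w \<ge> 2" for w
    using that by (simp add: e_def fst_dt_coeffs)
  have fstL: "fst (infix_sum ?L w) = fst (?q w)"
  proof -
    have "fst (infix_sum ?L w) = infix_sum (\<lambda>u b v. fst (?L u b v)) w" by (rule infix_sum_hom) auto
    also have "\<dots> = (\<Sum>(u, b, v)\<in>{([] :: 'k whitney list, w, [] :: 'k whitney list)}. fst (?q b))"
      unfolding infix_sum_def
      by (rule sum.mono_neutral_cong_right[OF finite_sub])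
        (use w in \<open>auto simp: e_def dt_coeffs_def split: if_splits\<close>)
    finally show ?thesis by simp
  qed
  let ?f = "\<lambda>n. 1 / fact n :: 'k"
  have map_c: "?c (map (susp_sign C_inf) u) = ?c u" for u
    by (induction u) (simp_all add: susp_sign_01 deg_sign_01 coeff_dt_def)
  let ?T = "\<lambda>p x s. (-1) ^ length p * of_nat ((length p + length s) choose length p) *
        fps_nth bernoulli_fps (length p + length s) * (?c p * coeff_t x * ?c s) :: 'k"
  let ?U = "unit_term :: 'k whitney list \<Rightarrow> 'k"
  have sndL: "snd (?L u b v) = ?f (length u + 1 + length v) * (?c u * (- letter_sum ?T b +
      ?U b) * ?c v)"
    if "b \<noteq> []" for u b v
  proof -
    have snd_dt: "snd (dt_coeffs a (map (susp_sign C_inf) u @ [y] @ v)) =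
        a (length u + 1 + length v) * (?c u * snd y * ?c v)" for a y
      using map_c[of u] by (simp add: dt_coeffs_def coeff_dt_def[of y] mult.assoc del: map_map)
    have nth: "fps_nth exp_fps (length u + 1 + length v) = ?f (length u + 1 + length v)"
      by (subst exp_fps_nth) simp
    show ?thesis
      unfolding e_def snd_dt nth snd_coeff_Q_C_inf[OF that] ..
  qed
  have "snd (infix_sum ?L w) = infix_sum (\<lambda>u b v. snd (?L u b v)) w" by (rule infix_sum_hom) auto
  also have "\<dots> = infix_sum (\<lambda>u b v. - letter_sum (\<lambda>p x s. ?f (length u + 1 + length v) * (?c u *
      ?T p x s * ?c v)) b +
      ?f (length w - 1) * (?c u * ?U b * ?c v)) w"
  proof (rule infix_sum_cong)
    fix u b v assume b: "u @ b @ v = w" "b \<noteq> []"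
    have "?f (length u + 1 + length v) * ?U b = ?f (length w - 1) * ?U b"
      using b(1) by auto
    then show "snd (?L u b v) = - letter_sum (\<lambda>p x s. ?f (length u + 1 + length v) * (?c u * ?T p
        x s * ?c v)) b +
      ?f (length w - 1) * (?c u * ?U b * ?c v)"
      unfolding sndL[OF b(2)]
      by (simp only: letter_sum_nth sum_distrib_left sum_distrib_right distrib_left distrib_right
          mult_minus_left mult_minus_right mult_ac)
  qed
  also have "\<dots> = - letter_sum (\<lambda>P x S. ?c P * coeff_t x * ?c S * bernoulli_convolution (length P)
      (length S)) w +
      ?f (length w - 1) * (snd (fst (hd w)) * ?c (tl w) - ?c (butlast w) * snd (fst (last w)))"
  proof -
    have "letter_sum (\<lambda>P x S. cut_sum (\<lambda>u p. cut_sum (\<lambda>s v.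
          ?f (length u + 1 + length v) * (?c u * ?T p x s * ?c v)) S) P) w =
        letter_sum (\<lambda>P x S. ?c P * coeff_t x * ?c S * bernoulli_convolution (length P) (length S))
            w"
      by (intro letter_sum_cong blocks_around_letter) simp
    moreover have "infix_sum (\<lambda>u b v. - letter_sum (\<lambda>p x s. ?f (length u + 1 + length v) * (?c u *
        ?T p x s * ?c v)) b) w =
        - infix_sum (\<lambda>u b v. letter_sum (\<lambda>p x s. ?f (length u + 1 + length v) * (?c u * ?T p x s *
            ?c v)) b) w"
      by (simp only: infix_sum_def case_prod_unfold sum_negf)
    moreover have "infix_sum (\<lambda>u b v. ?f (length w - 1) * (?c u * ?U b * ?c v)) w =
        ?f (length w - 1) * infix_sum (\<lambda>u b v. ?c u * ?U b * ?c v) w"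
      by (simp only: infix_sum_def case_prod_unfold sum_distrib_left)
    ultimately show ?thesis
      by (simp only: infix_sum_add infix_sum_letter_sum unit_terms_telescope[OF w])
  qed
  also have "letter_sum (\<lambda>P x S. ?c P * coeff_t x * ?c S * bernoulli_convolution (length P)
      (length S)) w =
      ?f (length w - 1) * (?c (butlast w) * coeff_t (last w))"
  proof -
    have "letter_sum (\<lambda>P x S. ?c P * coeff_t x * ?c S * bernoulli_convolution (length P) (length
        S)) w =
      letter_sum (\<lambda>P x S. if S = [] then ?c P * coeff_t x / fact (length P) else 0) w"
      by (rule letter_sum_cong) (simp add: bernoulli_convolution_eq)
    then show ?thesis using w by (simp add: letter_sum_last)
  qed
  finally have sndL': "snd (infix_sum ?L w) = ?f (length w - 1) *
      (snd (fst (hd w)) * ?c (tl w) - ?c (butlast w) * fst (fst (last w)))"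
    by (simp add: coeff_t_def algebra_simps)
  have e1: "e [x] = x" for x by (simp add: e_def dt_coeffs_single)
  have rhs: "block_sum (\<lambda>bs. coeff_Q C_cup (map e bs)) w =
    (if length w = 2 then (fst (fst (hd w)) * fst (fst (last w)), snd (fst (hd w)) * snd (fst
        (last w))) else 0,
     snd (fst (hd w)) * snd (e (tl w)) - snd (e (butlast w)) * fst (fst (last w)))"
    using C_cup_block_sum[OF len, of e] fst_e by (simp only: e1)
  have snd_e: "snd (e v) = ?f (length w - 1) * ?c v" if "length v = length w - 1" for v
    using that len by (simp add: e_def dt_coeffs_def)
  show ?thesis
  proof (rule prod_eqI)
    show "fst (infix_sum ?L w) = fst (block_sum (\<lambda>bs. coeff_Q C_cup (map e bs)) w)"
      unfolding fstL rhs using w by (simp add: fst_coeff_Q_C_inf)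
    show "snd (infix_sum ?L w) = snd (block_sum (\<lambda>bs. coeff_Q C_cup (map e bs)) w)"
      unfolding sndL' rhs by (simp add: snd_e algebra_simps)
  qed
qed

abbreviation exp_std :: "('k::field_char_0 whitney list \<Rightarrow>\<^sub>0 'k) \<Rightarrow> ('k whitney list \<Rightarrow>\<^sub>0 'k)"
  where "exp_std \<equiv> morphism_of (dt_coeffs (fps_nth exp_fps))"

abbreviation log_std :: "('k::field_char_0 whitney list \<Rightarrow>\<^sub>0 'k) \<Rightarrow> ('k whitney list \<Rightarrow>\<^sub>0 'k)"
  where "log_std \<equiv> morphism_of (dt_coeffs (fps_nth log_fps))"

lemma coalgebra_morphism_exp: "coalgebra_morphism C_inf C_cup exp_std"
  and coalgebra_morphism_log: "coalgebra_morphism C_cup C_inf log_std"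
  by (rule coalgebra_morphism_morphism_of; simp add: dt_coeffs_multilinear dt_coeffs_degree)+

lemma ainf_morphism_exp: "ainf_morphism C_inf C_cup exp_std"
  by (rule ainf_morphism_morphism_of; (rule dt_coeffs_multilinear dt_coeffs_degree dt_coeffs_sign
      exp_coeffs_equation)?; (rule C_cup_simps C_inf_simps)?)

lemma log_exp: "same_map C_inf (log_std \<circ> exp_std) id"
  by (intro coalgebra_morphism_eqI[OF _ coalgebra_morphism_id scalars_C(2)]
      coalgebra_morphism_compose[OF coalgebra_morphism_exp coalgebra_morphism_log])
    (simp add: taylor_compose_morphism_of[OF coalgebra_morphism_exp coalgebra_morphism_log
        scalars_C(1,2)]
      dt_coeffs_compose exp_log_compose dt_coeffs_X taylor_id[OF scalars_C(2)])

lemma exp_log: "same_map C_cup (exp_std \<circ> log_std) id"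
  by (intro coalgebra_morphism_eqI[OF _ coalgebra_morphism_id scalars_C(1)]
      coalgebra_morphism_compose[OF coalgebra_morphism_log coalgebra_morphism_exp])
    (simp add: taylor_compose_morphism_of[OF coalgebra_morphism_log coalgebra_morphism_exp
        scalars_C(2,1)]
      dt_coeffs_compose exp_log_compose dt_coeffs_X taylor_id[OF scalars_C(1)])

lemma ainf_with_linear_part_dt_coeffs:
  fixes F :: "('k::field_char_0 whitney list \<Rightarrow>\<^sub>0 'k) \<Rightarrow> ('k whitney list \<Rightarrow>\<^sub>0 'k)"
  assumes F: "ainf_morphism A B F" and eq: "same_map B F (morphism_of (dt_coeffs a))"
    and a: "a 1 = 1" and B: "scalars B"
  shows "ainf_with_linear_part A B id F"
proof -
  have tay: "taylor B F w = dt_coeffs a w" if "w \<noteq> []" for w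
    using taylor_same_map[OF B eq that] taylor_morphism_of[OF B that] by metis
  show ?thesis
    unfolding ainf_with_linear_part_def
  proof (intro conjI allI impI)
    show "taylor B F [x] = id x" for x using dt_coeffs_single[of a, OF a] by (simp add: tay)
    fix xs :: "'k whitney list" assume xs: "2 \<le> length xs \<and> (\<exists>x\<in>set xs. zero_form x)"
    then have "xs \<noteq> []" by auto
    then show "taylor B F xs = 0" using xs by (auto simp: tay zero_form_def intro: dt_coeffs_vanish)
  qed (rule F)
qed

text \<open>
  For any representative \<open>E\<close> of the exponential, such as \<open>\<lambda> \<circ> \<mu>\<close>, the explicit logarithm is an
  inverse.
\<close>

lemma log_for_exp:
  fixes E :: "('k::field_char_0 whitney list \<Rightarrow>\<^sub>0 'k) \<Rightarrow> ('k whitney list \<Rightarrow>\<^sub>0 'k)"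
  assumes E: "ainf_morphism C_inf C_cup E" and eq: "same_map C_cup E exp_std"
  shows "\<exists>L. ainf_morphism C_cup C_inf L \<and> same_map C_inf (L \<circ> E) id \<and> same_map C_cup (E \<circ> L) id"
proof -
  have 1: "same_map C_inf (log_std \<circ> E) id"
    unfolding same_map_def null_eq_def[symmetric]
  proof
    fix x :: "'k whitney list \<Rightarrow>\<^sub>0 'k" assume x: "x \<in> words"
    have "null_eq C_inf (log_std (E x)) (log_std (exp_std x))"
      by (rule coalgebra_morphismD(3)[OF coalgebra_morphism_log same_mapD[OF eq x]])
    also have "null_eq C_inf \<dots> x" using same_mapD[OF log_exp x] by simp
    finally show "null_eq C_inf ((log_std \<circ> E) x) (id x)" by simp
  qed
  have 2: "same_map C_cup (E \<circ> log_std) id"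
    unfolding same_map_def null_eq_def[symmetric]
  proof
    fix x :: "'k whitney list \<Rightarrow>\<^sub>0 'k" assume x: "x \<in> words"
    have "null_eq C_cup (E (log_std x)) (exp_std (log_std x))"
      by (rule same_mapD[OF eq coalgebra_morphismD(2)[OF coalgebra_morphism_log x]])
    also have "null_eq C_cup \<dots> x" using same_mapD[OF exp_log x] by simp
    finally show "null_eq C_cup ((E \<circ> log_std) x) (id x)" by simp
  qed
  show ?thesis
    using ainf_morphism_inverse[OF E coalgebra_morphism_log 1 2 codiff_respects_null_C_cup] 1 2
        by blast
qed

text \<open>
  An inverse of \<open>E\<close> agrees with the explicit logarithm, hence has its coefficients.
\<close>

lemma log_for_exp_linear_part:
  fixes E :: "('k::field_char_0 whitney list \<Rightarrow>\<^sub>0 'k) \<Rightarrow> ('k whitney list \<Rightarrow>\<^sub>0 'k)"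
  assumes eq: "same_map C_cup E exp_std" and L: "ainf_morphism C_cup C_inf L"
    and LE: "same_map C_inf (L \<circ> E) id"
  shows "ainf_with_linear_part C_cup C_inf id L"
proof (rule ainf_with_linear_part_dt_coeffs[OF L])
  show "same_map C_inf L log_std"
    unfolding same_map_def null_eq_def[symmetric]
  proof
    fix x :: "'k whitney list \<Rightarrow>\<^sub>0 'k" assume x: "x \<in> words"
    note lx = coalgebra_morphismD(2)[OF coalgebra_morphism_log x]
    have "null_eq C_cup (exp_std (log_std x)) x" using same_mapD[OF exp_log x] by simp
    then have "null_eq C_cup (E (log_std x)) x" by (rule null_eq_trans[OF same_mapD[OF eq lx]])
    then have "null_eq C_inf (L x) (L (E (log_std x)))"
      by (rule coalgebra_morphismD(3)[OF ainf_morphismD(1)[OF L] null_eq_sym])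
    also have "null_eq C_inf \<dots> (log_std x)" using same_mapD[OF LE lx] by simp
    finally show "null_eq C_inf (L x) (log_std x)" .
  qed
qed (simp_all add: fps_ln_nth scalars_C)

text \<open>
  The formal part of the argument, for any \<open>\<lambda>\<close> that is unique in the required sense and any
  \<open>\<mu>\<close> such that \<open>\<lambda> \<circ> \<mu>\<close> represents the exponential.
\<close>

theorem exp_log_phi_only:
  fixes A :: "('k::field_char_0, 'p::ab_group_add \<times> 'q::ab_group_add) ainf"
    and lam mu L
  defines "E \<equiv> lam \<circ> mu"
  assumes A: "scalars A" and lam: "is_the_only A C_cup \<pi> lam"
    and mu: "coalgebra_morphism C_inf A mu" and eq: "same_map C_cup E exp_std"
    and \<pi>: "\<And>x. zero_form x \<Longrightarrow> zero_form (\<pi> x)"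
    and L_def: "L = (SOME L. ainf_morphism C_cup C_inf L \<and> same_map C_inf (L \<circ> E) id \<and>
        same_map C_cup (E \<circ> L) id)"
  shows "is_the_only C_inf C_cup id E" and "is_the_only A C_inf \<pi> (L \<circ> lam)"
proof -
  have lam1: "ainf_with_linear_part A C_cup \<pi> lam"
    and lam2: "\<And>F. ainf_with_linear_part A C_cup \<pi> F \<Longrightarrow> same_map C_cup F lam"
    using lam unfolding is_the_only_def by blast+
  have lam3: "ainf_morphism A C_cup lam" using lam1 by (simp add: ainf_with_linear_part_def)
  have E: "ainf_morphism C_inf C_cup E"
    by (rule ainf_morphism_same_map[OF ainf_morphism_exp _ eq codiff_respects_null_C_cup])
      (unfold E_def, rule coalgebra_morphism_compose[OF mu ainf_morphismD(1)[OF lam3]])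
  have E1: "ainf_with_linear_part C_inf C_cup id E"
    by (rule ainf_with_linear_part_dt_coeffs[OF E eq]) (simp_all add: scalars_C)
  have L: "ainf_morphism C_cup C_inf L" "same_map C_inf (L \<circ> E) id" "same_map C_cup (E \<circ> L) id"
    using someI_ex[OF log_for_exp[OF E eq]] unfolding L_def by blast+
  note coL = ainf_morphismD(1)[OF L(1)]
  have L1: "ainf_with_linear_part C_cup C_inf id L"
    by (rule log_for_exp_linear_part[OF eq L(1,2)])
  have phi: "ainf_with_linear_part A C_inf \<pi> (L \<circ> lam)"
    using ainf_with_linear_part_compose[OF lam1 L1 scalars_C(1,2) \<pi>] by simp
  show "is_the_only A C_inf \<pi> (L \<circ> lam)"
    unfolding is_the_only_def
  proof (intro conjI allI impI phi)
    fix F assume F: "ainf_with_linear_part A C_inf \<pi> F"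
    have "ainf_with_linear_part A C_cup \<pi> (E \<circ> F)"
      using ainf_with_linear_part_compose[OF F E1 scalars_C(2,1) \<pi>] by simp
    then have EF: "same_map C_cup (E \<circ> F) lam" by (rule lam2)
    have coF: "coalgebra_morphism A C_inf F"
      using F ainf_morphismD(1) by (auto simp: ainf_with_linear_part_def)
    show "same_map C_inf F (L \<circ> lam)"
      unfolding same_map_def null_eq_def[symmetric]
    proof
      fix x :: "('p \<times> 'q) list \<Rightarrow>\<^sub>0 'k" assume x: "x \<in> words"
      have "null_eq C_inf (F x) (L (E (F x)))"
        using same_mapD[OF L(2) coalgebra_morphismD(2)[OF coF x]] by (simp add: null_eq_sym)
      also have "null_eq C_inf \<dots> (L (lam x))"
        using coalgebra_morphismD(3)[OF coL same_mapD[OF EF x]] by simp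
      finally show "null_eq C_inf (F x) ((L \<circ> lam) x)" by simp
    qed
  qed
  show "is_the_only C_inf C_cup id E"
    unfolding is_the_only_def
  proof (intro conjI allI impI E1)
    fix F :: "('k whitney list \<Rightarrow>\<^sub>0 'k) \<Rightarrow> ('k whitney list \<Rightarrow>\<^sub>0 'k)"
    assume F: "ainf_with_linear_part C_inf C_cup id F"
    have "ainf_with_linear_part A C_cup \<pi> (F \<circ> (L \<circ> lam))"
      using ainf_with_linear_part_compose[OF phi F scalars_C(2,1) \<pi>] by simp
    then have FL: "same_map C_cup (F \<circ> (L \<circ> lam)) lam" by (rule lam2)
    have coF: "coalgebra_morphism C_inf C_cup F"
      using F ainf_morphismD(1) by (auto simp: ainf_with_linear_part_def)
    show "same_map C_cup F E"
      unfolding same_map_def null_eq_def[symmetric]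
    proof
      fix x :: "'k whitney list \<Rightarrow>\<^sub>0 'k" assume x: "x \<in> words"
      have "null_eq C_cup (F x) (F (L (E x)))"
        using coalgebra_morphismD(3)[OF coF same_mapD[OF L(2) x]] by (simp add: null_eq_sym)
      also have "null_eq C_cup \<dots> (E x)"
        using same_mapD[OF FL coalgebra_morphismD(2)[OF mu x]] by (simp add: E_def)
      finally show "null_eq C_cup (F x) (E x)" .
    qed
  qed
qed

section \<open>Iterated integrals of forms on the interval\<close>

text \<open>
  What the argument uses of the functions on the interval: they form a differential algebra
  with evaluations at 0 and 1 and a primitive vanishing at 0, which satisfies the fundamental
  theorem of calculus and computes the integrals, and they receive the polynomials. The ring
  of functions has no unit in its type; the unit is the constant polynomial 1.
\<close>

locale interval_calculus =
  fixes M :: "('k::field_char_0, 'f::comm_ring) interval_functions" and antideriv :: "'f \<Rightarrow> 'f"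
  assumes fn_vector_space: "vector_space (fn_scale M)"
    and scale_mult: "fn_scale M c (f * g) = fn_scale M c f * g"
    and deriv_add: "fn_deriv M (f + g) = fn_deriv M f + fn_deriv M g"
    and deriv_scale: "fn_deriv M (fn_scale M c f) = fn_scale M c (fn_deriv M f)"
    and deriv_mult: "fn_deriv M (f * g) = fn_deriv M f * g + f * fn_deriv M g"
    and eval_add: "x \<in> {0, 1} \<Longrightarrow> fn_eval M (f + g) x = fn_eval M f x + fn_eval M g x"
    and eval_scale: "x \<in> {0, 1} \<Longrightarrow> fn_eval M (fn_scale M c f) x = c * fn_eval M f x"
    and eval_mult: "x \<in> {0, 1} \<Longrightarrow> fn_eval M (f * g) x = fn_eval M f x * fn_eval M g x"
    and deriv_antideriv: "fn_deriv M (antideriv f) = f"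
    and eval_antideriv_0: "fn_eval M (antideriv f) 0 = 0"
    and antideriv_deriv:
      "antideriv (fn_deriv M f) = f - fn_scale M (fn_eval M f 0) (fn_of_poly M 1)"
    and integral_eq: "fn_integral M f = fn_eval M (antideriv f) 1"
    and simplex_integral_eq: "fn_simplex_integral M as =
      fn_eval M (foldl (\<lambda>I a. antideriv (I * a)) (fn_of_poly M 1) as) 1"
    and one_mult: "fn_of_poly M 1 * f = f"
    and of_poly_add: "fn_of_poly M (p + q) = fn_of_poly M p + fn_of_poly M q"
    and of_poly_smult: "fn_of_poly M (smult c p) = fn_scale M c (fn_of_poly M p)"
    and of_poly_mult: "fn_of_poly M (p * q) = fn_of_poly M p * fn_of_poly M q"
    and deriv_of_poly: "fn_deriv M (fn_of_poly M p) = fn_of_poly M (pderiv p)"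
    and eval_of_poly: "x \<in> {0, 1} \<Longrightarrow> fn_eval M (fn_of_poly M p) x = poly p x"

begin

abbreviation "D \<equiv> fn_deriv M"

abbreviation "one \<equiv> fn_of_poly M 1"

abbreviation "ev \<equiv> fn_eval M"

sublocale fn: vector_space "fn_scale M" by (rule fn_vector_space)

lemma deriv_0 [simp]: "D 0 = 0"
  using deriv_add[of 0 0] by simp

lemma deriv_minus: "D (- f) = - D f"
  using deriv_add[of f "- f"] by (simp add: add_eq_0_iff)

lemma eval_0 [simp]: "x \<in> {0, 1} \<Longrightarrow> ev 0 x = 0"
  using eval_scale[of x 0 0] by simp

lemma eval_minus: "x \<in> {0, 1} \<Longrightarrow> ev (- f) x = - ev f x"
  using eval_scale[of x "-1" f] by simp

lemma eval_diff: "x \<in> {0, 1} \<Longrightarrow> ev (f - g) x = ev f x - ev g x"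
  using eval_add[of x f "- g"] by (simp add: eval_minus)

lemma antideriv_unique: "D g = f \<Longrightarrow> ev g 0 = 0 \<Longrightarrow> antideriv f = g"
  using antideriv_deriv[of g] by simp

lemma antideriv_add: "antideriv (f + g) = antideriv f + antideriv g"
  by (rule antideriv_unique) (simp_all add: deriv_add deriv_antideriv eval_add eval_antideriv_0)

lemma antideriv_scale: "antideriv (fn_scale M c f) = fn_scale M c (antideriv f)"
  by (rule antideriv_unique) (simp_all add: deriv_scale deriv_antideriv eval_scale eval_antideriv_0)

lemma antideriv_0 [simp]: "antideriv 0 = 0"
  by (rule antideriv_unique) simp_all

lemma antideriv_minus: "antideriv (- f) = - antideriv f"
  by (rule antideriv_unique) (simp_all add: deriv_minus deriv_antideriv eval_minus eval_antideriv_0)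

lemma antideriv_diff: "antideriv (f - g) = antideriv f - antideriv g"
  using antideriv_add[of f "- g"] by (simp add: antideriv_minus)

lemma scale_mult_right: "f * fn_scale M c g = fn_scale M c (f * g)"
  by (simp add: mult.commute[of f] scale_mult)

text \<open>
  The function \<open>x \<mapsto> \<integral> a\<^sub>1(t\<^sub>1) \<cdots> a\<^sub>n(t\<^sub>n)\<close> over \<open>0 \<le> t\<^sub>1 \<le> \<dots> \<le> t\<^sub>n \<le> x\<close> is obtained for \<open>f =
  1\<close>. A general start \<open>f\<close> is needed for linearity in an inner argument.
\<close>

definition iterated_from :: "'f \<Rightarrow> 'f list \<Rightarrow> 'f"
  where "iterated_from = foldl (\<lambda>I a. antideriv (I * a))"

abbreviation "iterated \<equiv> iterated_from one"

lemma iterated_from_simps [simp]: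
  "iterated_from f [] = f" "iterated_from f (a # as) = iterated_from (antideriv (f * a)) as"
  "iterated_from f (as @ [a]) = antideriv (iterated_from f as * a)"
  "iterated_from f (as @ bs) = iterated_from (iterated_from f as) bs"
  by (simp_all add: iterated_from_def)

lemma iterated_from_add: "iterated_from (f + g) as = iterated_from f as + iterated_from g as"
  by (induction as arbitrary: f g) (simp_all add: algebra_simps antideriv_add)

lemma iterated_from_scale: "iterated_from (fn_scale M c f) as = fn_scale M c (iterated_from f as)"
  by (induction as arbitrary: f) (simp_all add: scale_mult[symmetric] antideriv_scale)

lemma iterated_from_0 [simp]: "iterated_from 0 as = 0"
  by (induction as) simp_all

lemma eval_iterated_0: "as \<noteq> [] \<Longrightarrow> ev (iterated as) 0 = 0"
  by (cases as rule: rev_cases) (simp_all add: eval_antideriv_0 del: iterated_from_simps(4))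

lemma forms_simps [simp]: "scal (forms M) c x = (fn_scale M c (fst x), fn_scale M c (snd x))"
    "proj (forms M) = proj01"
  by (simp_all add: forms_def ainf_of_dga_def)

lemma scalars_forms: "scalars (forms M)"
  by unfold_locales (auto simp: fn.scale_right_distrib fn.scale_left_distrib)

lemma coeff_Q_forms:
  "coeff_Q (forms M) [x] = (0, - D (fst x))"
  "coeff_Q (forms M) [x, y] = (fst x * fst y, fst x * snd y - snd x * fst y)"
  "length w > 2 \<Longrightarrow> coeff_Q (forms M) w = 0"
  by (auto simp: forms_def ainf_of_dga_def deg_sign_01 zero_prod_def split: list.splits)

definition lam_coeffs :: "('f \<times> 'f) list \<Rightarrow> 'k whitney"
  where "lam_coeffs w = (if length w = 1 then fst (whitney_proj M (hd w)) else 0,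
    ev (iterated (map snd w)) 1)"

lemma lam_coeffs_single: "lam_coeffs [x] = whitney_proj M x"
  by (simp add: lam_coeffs_def whitney_proj_def integral_eq one_mult)

lemma lam_eq: "lam M x = morphism_of lam_coeffs x"
  unfolding lam_def
proof (rule morphism_of_cong)
  fix w :: "('f \<times> 'f) list" assume "w \<noteq> []"
  then consider x where "w = [x]" | x y v where "w = x # y # v"
    by (cases w; cases "tl w") auto
  then show "(case w of [] \<Rightarrow> 0 | [x] \<Rightarrow> whitney_proj M x
      | _ \<Rightarrow> ((0, 0), fn_simplex_integral M (map snd w))) = lam_coeffs w"
    by cases (auto simp: lam_coeffs_single,
      simp add: lam_coeffs_def simplex_integral_eq iterated_from_def zero_prod_def)
qed

lemma lam_coeffs_multilinear: "multilinear (forms M) C_cup lam_coeffs"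
  unfolding multilinear_def lam_coeffs_def
  by (auto simp: whitney_proj_def algebra_simps antideriv_add iterated_from_add eval_add eval_scale
      scale_mult[symmetric] scale_mult_right antideriv_scale iterated_from_scale zero_prod_def)

lemma iterated_zero: "0 \<in> set as \<Longrightarrow> iterated as = 0"
  by (auto simp: in_set_conv_decomp)

lemma lam_coeffs_vanish: "length w \<ge> 2 \<Longrightarrow> x \<in> set w \<Longrightarrow> snd x = 0 \<Longrightarrow> lam_coeffs w = 0"
  using iterated_zero[of "map snd w"] by (force simp: lam_coeffs_def zero_prod_def)

lemma fst_lam_coeffs: "length w \<ge> 2 \<Longrightarrow> fst (lam_coeffs w) = 0"
  by (simp add: lam_coeffs_def)

lemma lam_coeffs_degree: "degree_preserving (forms M) C_cup lam_coeffs"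
  by (rule degree_preserving_01[where g = "\<lambda>f. (ev f 1, ev f 0)" and h = "fn_integral M"])
    (auto simp: lam_coeffs_vanish fst_lam_coeffs lam_coeffs_single whitney_proj_def integral_eq
        zero_prod_def)

lemma lam_coeffs_sign:
  "w \<noteq> [] \<Longrightarrow> lam_coeffs (map (susp_sign (forms M)) w) = susp_sign C_cup (lam_coeffs w)"
  by (auto simp: lam_coeffs_def deg_sign_01 o_def hd_map whitney_proj_def eval_minus)

text \<open>
  Stokes' theorem for iterated integrals with variable upper end point, by induction on the
  last form. The faces \<open>t\<^sub>i = t\<^sub>i\<^sub>+\<^sub>1\<close> of the simplex are the products of neighbours, the face
  \<open>t\<^sub>1 = 0\<close> gives the value at 0 of the first function, and the face at the upper end gives
  the last function.
\<close>

lemma stokes: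
  assumes "w \<noteq> []"
  shows "infix_sum (\<lambda>u b v. iterated (map snd u @ [snd (coeff_Q (forms M) b)] @ map snd v)) w =
    fn_scale M (ev (fst (hd w)) 0) (iterated (map snd (tl w))) -
    iterated (map snd (butlast w)) * fst (last w)"
  using assms
proof (induction w rule: rev_induct)
  case (snoc x w)
  let ?q = "coeff_Q (forms M)"
  let ?J = "\<lambda>w. iterated (map snd w)"
  let ?g = "\<lambda>u b v. iterated (map snd u @ [snd (?q b)] @ map snd v)"
  show ?case
  proof (cases w rule: rev_cases)
    case Nil
    have "antideriv (one * - D (fst x)) = - (fst x - fn_scale M (ev (fst x) 0) one)"
      by (simp add: antideriv_minus antideriv_deriv mult_minus_right one_mult)
    then show ?thesis
      by (simp add: Nil infix_sum_Cons head_sum_Cons coeff_Q_forms one_mult)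
  next
    case wv: (snoc v y)
    have ne: "w \<noteq> []" using wv by simp
    have IH: "infix_sum ?g w = fn_scale M (ev (fst (hd w)) 0) (?J (tl w)) - ?J v * fst y"
      using snoc.IH[OF ne] unfolding wv by (simp del: iterated_from_simps)
    have A: "infix_sum (\<lambda>u b v. ?g u b (v @ [x])) w = antideriv (infix_sum ?g w * snd x)"
      by (subst infix_sum_hom[of "\<lambda>f. antideriv (f * snd x)"])
        (simp_all add: algebra_simps antideriv_add)
    \<comment> \<open>The terms in which the codifferential reaches the last form \<open>x\<close>: it acts on \<open>x\<close> alone or on
      \<open>x\<close> and its neighbour \<open>y\<close>.\<close>
    have B: "cut_sum (\<lambda>u b. ?g u (b @ [x]) []) w =
        antideriv (?J w * - D (fst x)) + antideriv (?J v * (fst y * snd x - snd y * fst x))"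
    proof -
      have "cut_sum (\<lambda>u b. ?g u (b @ [x]) []) w =
          cut_sum (\<lambda>u b. ?g u (b @ [y, x]) []) v + ?g w [x] []"
        by (simp add: wv cut_sum_snoc)
      also have "cut_sum (\<lambda>u b. ?g u (b @ [y, x]) []) v =
          cut_sum (\<lambda>u b. if b = [] then ?g u [y, x] [] else 0) v"
      proof (rule cut_sum_cong)
        fix u b :: "('f \<times> 'f) list"
        have "length (b @ [y, x]) > 2" if "b \<noteq> []" using that by (cases b) auto
        then show "?g u (b @ [y, x]) [] = (if b = [] then ?g u [y, x] [] else 0)"
          using coeff_Q_forms(3)[of "b @ [y, x]"] by auto
      qed
      finally show ?thesis
        by (simp add: cut_sum_whole coeff_Q_forms add.commute del: iterated_from_simps(4))
    qed
    have "infix_sum ?g (w @ [x]) = antideriv ((fn_scale M (ev (fst (hd w)) 0) (?J (tl w)) -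
        ?J v * fst y) * snd x + ?J w * - D (fst x) + ?J v * (fst y * snd x - snd y * fst x))"
      by (simp only: infix_sum_snoc A B IH antideriv_add add.assoc)
    \<comment> \<open>The products with \<open>fst y\<close> cancel, and the rest is the product rule, as the derivative of
      \<open>?J w\<close> is \<open>?J v * snd y\<close>.\<close>
    also have "\<dots> = antideriv (fn_scale M (ev (fst (hd w)) 0) (?J (tl w) * snd x) -
        D (?J w * fst x))"
      by (rule arg_cong[where f = antideriv])
        (simp add: wv deriv_mult deriv_antideriv algebra_simps scale_mult[symmetric]
            scale_mult_right del: iterated_from_simps(4))
    also have "\<dots> = fn_scale M (ev (fst (hd w)) 0) (?J (tl w @ [x])) - ?J w * fst x"
      by (simp add: antideriv_diff antideriv_scale antideriv_deriv eval_mult eval_iterated_0 ne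
        del: iterated_from_simps(4))
    finally show ?thesis using ne by simp
  qed
qed simp

text \<open>
  For words of length at least two, the 1-form part is Stokes' theorem at the end point 1, and
  the 0-form part says that evaluation is multiplicative.
\<close>

lemma lam_coeffs_equation:
  assumes w: "w \<noteq> []"
  shows "infix_sum (\<lambda>u b v. lam_coeffs (map (susp_sign (forms M)) u @ [coeff_Q (forms M) b] @ v))
      w =
    block_sum (\<lambda>bs. coeff_Q C_cup (map lam_coeffs bs)) w"
proof (cases "length w = 1")
  case True
  then obtain x where x: "w = [x]" by (auto simp: length_Suc_conv)
  show ?thesis
    by (simp add: x infix_sum_Cons head_sum_Cons block_sum_first_block lam_coeffs_single
        coeff_Q_C_cup
        coeff_Q_forms whitney_proj_def integral_eq antideriv_minus antideriv_deriv eval_minus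
            eval_diff
        eval_scale eval_of_poly coeff_t_def zero_prod_def)
next
  case False
  then have len: "length w \<ge> 2" using w by (cases w; cases "tl w") auto
  let ?q = "coeff_Q (forms M)"
  let ?L = "\<lambda>u b v. lam_coeffs (map (susp_sign (forms M)) u @ [?q b] @ v)"
  have "fst (infix_sum ?L w) = infix_sum (\<lambda>u b v. fst (?L u b v)) w" by (rule infix_sum_hom) auto
  also have "\<dots> = (\<Sum>(u, b, v)\<in>{([] :: ('f \<times> 'f) list, w, [] :: ('f \<times> 'f) list)}. fst (whitney_proj
      M (?q b)))"
    unfolding infix_sum_def
    by (rule sum.mono_neutral_cong_right[OF finite_sub])
      (use w in \<open>auto simp: lam_coeffs_def split: if_splits\<close>)
  finally have fstL: "fst (infix_sum ?L w) = fst (whitney_proj M (?q w))" by simp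
  have "snd (infix_sum ?L w) = infix_sum (\<lambda>u b v. ev (iterated (map snd u @ [snd (?q b)] @ map snd
      v)) 1) w"
    by (subst infix_sum_hom[of snd]) (auto simp: lam_coeffs_def deg_sign_01 o_def intro!:
        infix_sum_cong)
  also have "\<dots> = ev (infix_sum (\<lambda>u b v. iterated (map snd u @ [snd (?q b)] @ map snd v)) w) 1"
    by (rule infix_sum_hom[symmetric]) (auto simp: eval_add)
  finally have sndL: "snd (infix_sum ?L w) = ev (fst (hd w)) 0 * ev (iterated (map snd (tl w))) 1 -
      ev (iterated (map snd (butlast w))) 1 * ev (fst (last w)) 1"
    unfolding stokes[OF w] by (simp add: eval_diff eval_scale eval_mult)
  have rhs: "block_sum (\<lambda>bs. coeff_Q C_cup (map lam_coeffs bs)) w =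
    (if length w = 2 then (ev (fst (hd w)) 1 * ev (fst (last w)) 1, ev (fst (hd w)) 0 * ev (fst
        (last w)) 0) else 0,
     ev (fst (hd w)) 0 * snd (lam_coeffs (tl w)) - snd (lam_coeffs (butlast w)) * ev (fst (last
         w)) 1)"
    using C_cup_block_sum[OF len, of lam_coeffs] fst_lam_coeffs
    by (simp add: lam_coeffs_single whitney_proj_def)
  show ?thesis
  proof (rule prod_eqI)
    show "fst (infix_sum ?L w) = fst (block_sum (\<lambda>bs. coeff_Q C_cup (map lam_coeffs bs)) w)"
    proof (cases "length w = 2")
      case True
      then obtain x y where "w = [x, y]" by (auto simp: length_Suc_conv numeral_2_eq_2)
      then show ?thesis unfolding fstL rhs by (simp add: coeff_Q_forms whitney_proj_def eval_mult)
    next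
      case False
      then show ?thesis
        using len unfolding fstL rhs by (simp add: coeff_Q_forms(3) whitney_proj_def zero_prod_def)
    qed
    show "snd (infix_sum ?L w) = snd (block_sum (\<lambda>bs. coeff_Q C_cup (map lam_coeffs bs)) w)"
      unfolding sndL rhs by (simp add: lam_coeffs_def)
  qed
qed

lemma zero_form_whitney_proj: "zero_form x \<Longrightarrow> zero_form (whitney_proj M x)"
  by (simp add: zero_form_def whitney_proj_def integral_eq)

lemma lam_linear_part: "ainf_with_linear_part (forms M) C_cup (whitney_proj M) (lam M)"
proof -
  have lam: "lam M = morphism_of lam_coeffs" by (rule ext) (rule lam_eq)
  have tay: "taylor C_cup (lam M) w = lam_coeffs w" if "w \<noteq> []" for w
    unfolding lam by (rule taylor_morphism_of[OF scalars_C(1) that])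
  show ?thesis
    unfolding ainf_with_linear_part_def
  proof (intro conjI allI impI)
    show "ainf_morphism (forms M) C_cup (lam M)"
      unfolding lam
      by (rule ainf_morphism_morphism_of)
        (rule lam_coeffs_multilinear lam_coeffs_degree lam_coeffs_sign lam_coeffs_equation;
            assumption?)+
    show "taylor C_cup (lam M) [x] = whitney_proj M x" for x by (simp add: tay lam_coeffs_single)
    fix xs :: "('f \<times> 'f) list" assume xs: "2 \<le> length xs \<and> (\<exists>x\<in>set xs. zero_form x)"
    then have "xs \<noteq> []" by auto
    then show "taylor C_cup (lam M) xs = 0" using xs
        by (auto simp: tay zero_form_def intro: lam_coeffs_vanish)
  qed
qed

text \<open>
  By degree: a word of 1-forms has degree zero in the suspension, and so has its image.
\<close>

lemma taylor_one_forms: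
  assumes F: "coalgebra_morphism (forms M) C_cup F" and w: "w \<noteq> []" "\<And>x. x \<in> set w \<Longrightarrow> fst x = 0"
  shows "fst (taylor C_cup F w) = 0"
proof -
  have sum: "(\<Sum>i\<leftarrow>replicate (length w) (1 :: int). i - 1) = 0" by (simp add: sum_list_replicate)
  have "list_all2 (\<lambda>i v. proj (forms M) i v = v) (replicate (length w) 1) w"
    using w(2) by (auto simp: list_all2_conv_all_nth prod_eq_iff)
  then have "free_of w \<in> tensor_degree (forms M) 0"
    unfolding tensor_degree_def using w(1) sum by (intro free.span_base) blast
  then obtain y where y: "y \<in> tensor_degree C_cup 0" "null_eq C_cup (F (free_of w)) y"
    using coalgebra_morphismD(5)[OF F] by blast
  have "tensor_degree C_cup 0 \<subseteq> {x. fst (corestriction C_cup x :: 'k whitney) = 0}"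
    unfolding tensor_degree_def
  proof (rule free.span_minimal)
    show "free.subspace {x. fst (corestriction C_cup x :: 'k whitney) = 0}"
      by (rule free.subspaceI)
        (simp_all add: corestriction_add[OF scalars_C(1)] corestriction_scale[OF scalars_C(1)]
            zero_prod_def)
    show "{free_of w | w. w \<noteq> [] \<and>
      (\<exists>is. list_all2 (\<lambda>i v. proj C_cup i v = v) is w \<and> (\<Sum>i\<leftarrow>is. i - 1) = 0)}
      \<subseteq> {x. fst (corestriction C_cup x :: 'k whitney) = 0}"
      by (auto simp: corestriction_of[OF scalars_C(1)] length_Suc_conv list_all2_Cons2 proj01_def
          prod_eq_iff)
  qed
  then have "fst (corestriction C_cup y) = 0" using y(1) by auto
  then show ?thesis
    using corestriction_null_eq[OF scalars_C(1) y(2)] by (simp add: taylor_def)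
qed

text \<open>
  By multilinearity, since the terms with a 0-form vanish.
\<close>

lemma taylor_one_form_parts:
  assumes f: "multilinear (forms M) C_cup f"
    and van: "\<And>xs. length xs \<ge> 2 \<Longrightarrow> \<exists>x\<in>set xs. zero_form x \<Longrightarrow> f xs = 0"
    and len: "length (u @ w) \<ge> 2"
  shows "f (u @ w) = f (u @ map (\<lambda>x. (0, snd x)) w)"
  using len
proof (induction w arbitrary: u)
  case (Cons x w)
  have "f (u @ [(fst x, 0) + (0, snd x)] @ w) = f (u @ [(fst x, 0)] @ w) + f (u @ [(0, snd x)] @ w)"
    using f unfolding multilinear_def by blast
  moreover have "f (u @ [(fst x, 0)] @ w) = 0"
    using Cons.prems by (intro van) (auto simp: zero_form_def)
  ultimately have "f (u @ x # w) = f ((u @ [(0, snd x)]) @ w)" by simp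
  also have "\<dots> = f ((u @ [(0, snd x)]) @ map (\<lambda>x. (0, snd x)) w)"
    using Cons.prems by (intro Cons.IH) simp
  finally show ?case by simp
qed simp

text \<open>
  The morphism equation for \<open>g \<otimes> a\<^sub>2 dt \<otimes> \<dots> \<otimes> a\<^sub>n dt\<close>, where \<open>g\<close> is the primitive of \<open>a\<^sub>1\<close>
  with \<open>g(0) = 0\<close>, reduces to \<open>F\<^sub>n(a\<^sub>1 dt, a\<^sub>2 dt, \<dots>) = F\<^sub>n\<^sub>-\<^sub>1(g a\<^sub>2 dt, a\<^sub>3 dt, \<dots>)\<close>.
\<close>

lemma taylor_unique:
  assumes F: "ainf_with_linear_part (forms M) C_cup (whitney_proj M) F"
  shows "w \<noteq> [] \<Longrightarrow> taylor C_cup F w = lam_coeffs w"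
proof (induction w rule: length_induct)
  case (1 w)
  let ?f = "taylor C_cup F"
  let ?q = "coeff_Q (forms M)"
  have F1: "ainf_morphism (forms M) C_cup F" and single: "\<And>x. ?f [x] = whitney_proj M x"
    and van: "\<And>xs. length xs \<ge> 2 \<Longrightarrow> \<exists>x\<in>set xs. zero_form x \<Longrightarrow> ?f xs = 0"
    using F by (auto simp: ainf_with_linear_part_def)
  have mult: "multilinear (forms M) C_cup ?f"
    by (rule multilinear_taylor[OF ainf_morphismD(1)[OF F1] scalars_C(1)])
  have parts: "?f w = ?f (map (\<lambda>x. (0, snd x)) w)" if "length w \<ge> 2" for w
    using taylor_one_form_parts[OF mult van, of "[]" w] that by simp
  have fst0: "fst (?f w) = 0" if len: "length w \<ge> 2" for w
    unfolding parts[OF len]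
    by (rule taylor_one_forms[OF ainf_morphismD(1)[OF F1]]) (use len in auto)
  show ?case
  proof (cases "length w \<ge> 2")
    case False
    then obtain x where "w = [x]" using 1(2) by (cases w; cases "tl w") auto
    then show ?thesis by (simp add: single lam_coeffs_single)
  next
    case len: True
    then obtain x1 x2 v where w: "w = x1 # x2 # v" by (cases w; cases "tl w") auto
    \<comment> \<open>As \<open>f\<close> only sees the 1-form parts of \<open>w\<close>, the word \<open>y\<close> may be chosen without 0-forms
      behind its first letter.\<close>
    define r where "r = map (\<lambda>x. (0 :: 'f, snd x)) v"
    let ?g = "antideriv (snd x1)"
    let ?y = "(?g, 0) # (0, snd x2) # r"
    let ?L = "\<lambda>u b v. ?f (map (susp_sign (forms M)) u @ [?q b] @ v)"
    have "infix_sum ?L ?y = block_sum (\<lambda>bs. coeff_Q C_cup (map ?f bs)) ?y"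
      by (rule ainf_morphism_taylor[OF F1 scalars_C(1) codiff_respects_null_C_cup]) simp
    also have "\<dots> = 0"
    proof -
      have last0: "fst (last ((0, snd x2) # r)) = 0" by (simp add: r_def last_map)
      show ?thesis
        by (subst C_cup_block_sum) (simp_all add: fst0 single last0[simplified] whitney_proj_def
            eval_antideriv_0 zero_prod_def)
    qed
    finally have zero: "infix_sum ?L ?y = 0" .
    \<comment> \<open>Terms in which the codifferential does not touch \<open>g\<close> keep a 0-form.\<close>
    have "infix_sum (\<lambda>u b v. ?L ((?g, 0) # u) b v) ((0, snd x2) # r) = infix_sum (\<lambda>u b v. 0) ((0,
        snd x2) # r)"
      by (rule infix_sum_cong) (auto simp: zero_form_def deg_sign_01 intro!: van)
    moreover have "head_sum (?L []) ?y = ?f ((0, - snd x1) # (0, snd x2) # r) +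
        ?f ((0, ?g * snd x2) # r)"
    proof -
      have "head_sum (\<lambda>u v. ?L [] ((?g, 0) # (0, snd x2) # u) v) r = head_sum (\<lambda>u v. 0) r"
        by (rule head_sum_cong)
          (auto simp: coeff_Q_forms(3) multilinear_zero[OF mult])
      then show ?thesis
        by (simp add: head_sum_Cons cut_sum_first coeff_Q_forms deriv_antideriv)
    qed
    moreover have "?f ((0, - snd x1) # (0, snd x2) # r) = - ?f ((0, snd x1) # (0, snd x2) # r)"
      using multilinear_uminus[OF mult, of "[]" "(0, snd x1)"]
      by simp
    ultimately have "?f ((0, snd x1) # (0, snd x2) # r) = ?f ((0, ?g * snd x2) # r)"
      using zero by (simp add: infix_sum_Cons)
    moreover have "?f w = ?f ((0, snd x1) # (0, snd x2) # r)"
      using parts[OF len] by (simp add: w r_def)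
    moreover have "?f ((0, ?g * snd x2) # r) = lam_coeffs ((0, ?g * snd x2) # r)"
      using 1(1) by (simp add: w r_def)
    moreover have "lam_coeffs ((0, ?g * snd x2) # r) = lam_coeffs w"
      by (auto simp: lam_coeffs_def w r_def o_def one_mult whitney_proj_def zero_prod_def)
    ultimately show ?thesis by simp
  qed
qed

theorem lam_only: "is_the_only (forms M) C_cup (whitney_proj M) (lam M)"
  unfolding is_the_only_def
proof (intro conjI allI impI lam_linear_part)
  fix F assume F: "ainf_with_linear_part (forms M) C_cup (whitney_proj M) F"
  have co: "coalgebra_morphism (forms M) C_cup G" if "ainf_with_linear_part (forms M) C_cup
      (whitney_proj M) G" for G
    using that ainf_morphismD(1) by (auto simp: ainf_with_linear_part_def)
  show "same_map C_cup F (lam M)"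
    by (rule coalgebra_morphism_eqI[OF co[OF F] co[OF lam_linear_part] scalars_C(1)])
      (simp add: taylor_unique[OF F] taylor_unique[OF lam_linear_part])
qed

definition mu_coeffs :: "'k whitney list \<Rightarrow> 'f \<times> 'f"
  where "mu_coeffs w = (if length w = 1 then whitney_incl M (hd w) else
    (fn_of_poly M (smult (one_function_form (\<lambda>n i. (-1) ^ i * of_nat (n choose i)) w / fact
        (length w))
      (bernoulli_poly (length w) - [:bernoulli_number (length w):])), 0))"

lemma mu_eq: "mu M x = morphism_of mu_coeffs x"
  unfolding mu_def
proof (rule morphism_of_cong)
  fix w :: "'k whitney list" assume "w \<noteq> []"
  then consider x where "w = [x]" | x y v where "w = x # y # v"
    by (cases w; cases "tl w") auto
  then show "(case w of [] \<Rightarrow> 0 | [x] \<Rightarrow> whitney_incl M x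
      | _ \<Rightarrow> let n = length w - 1 in
          (fn_of_poly M (smult
            (one_function_form (\<lambda>n i. (-1) ^ i * of_nat (n choose i)) w / fact (n + 1))
            (bernoulli_poly (n + 1) - [:bernoulli_number (n + 1):])), 0)) = mu_coeffs w"
    by cases (auto simp: mu_coeffs_def Let_def)
qed

lemma of_poly_0 [simp]: "fn_of_poly M 0 = 0"
  using of_poly_add[of 0 0] by simp

lemma whitney_incl_eq: "whitney_incl M x =
    (fn_of_poly M (smult (fst (fst x)) [:0, 1:] + smult (snd (fst x)) [:1, -1:]),
        fn_of_poly M [:snd x:])"
  by (simp add: whitney_incl_def split_beta)

lemma mu_coeffs_multilinear: "multilinear C_inf (forms M) mu_coeffs"
  unfolding multilinear_def
proof (intro conjI allI)
  fix u v :: "'k whitney list" and x y c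
  have single: "whitney_incl M (x + y) = whitney_incl M x + whitney_incl M y"
    "whitney_incl M (scal C_inf c x) = scal (forms M) c (whitney_incl M x)"
    by (simp_all add: whitney_incl_eq of_poly_add[symmetric] of_poly_smult[symmetric] algebra_simps)
  show "mu_coeffs (u @ [x + y] @ v) = mu_coeffs (u @ [x] @ v) + mu_coeffs (u @ [y] @ v)"
    using single
    by (auto simp: mu_coeffs_def one_function_form_add add_divide_distrib smult_add_left
        of_poly_add)
  show "mu_coeffs (u @ [scal C_inf c x] @ v) = scal (forms M) c (mu_coeffs (u @ [x] @ v))"
    using single one_function_form_scale[of _ u c x v]
    by (auto simp: mu_coeffs_def of_poly_smult[symmetric] simp del: whitney_scal)
qed

text \<open>
  A homogeneous word on which a higher coefficient of \<open>\<mu>\<close> is not zero consists of one function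
  and of 1-forms, so that its degree in the suspension is \<open>-1\<close>, which is the degree of
  functions.
\<close>

lemma mu_coeffs_degree: "degree_preserving C_inf (forms M) mu_coeffs"
  unfolding degree_preserving_def
proof (intro allI impI, elim conjE)
  fix "is" and w :: "'k whitney list"
  assume w: "w \<noteq> []" "list_all2 (\<lambda>i v. proj C_inf i v = v) is w"
  show "proj (forms M) ((\<Sum>i\<leftarrow>is. i - 1) + 1) (mu_coeffs w) = mu_coeffs w"
  proof (cases "length w = 1")
    case True
    then obtain x where x: "w = [x]" by (auto simp: length_Suc_conv)
    then obtain i where "is = [i]" "proj01 i x = x" using w(2) by (auto simp: list_all2_Cons2)
    then show ?thesis
      by (cases x) (auto simp: x mu_coeffs_def whitney_incl_eq proj01_def zero_prod_def split:
          if_splits)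
  next
    case len: False
    show ?thesis
    proof (cases "one_function_form (\<lambda>n i. (-1) ^ i * of_nat (n choose i)) w = (0 :: 'k)")
      case True
      then show ?thesis using len by (simp add: mu_coeffs_def zero_prod_def[symmetric])
    next
      case False
      obtain p x s where pxs: "w = p @ x # s" "coeff_t x \<noteq> 0" "\<And>y. y \<in> set p \<union> set s
          \<Longrightarrow> coeff_dt y \<noteq> 0"
        using one_function_form_nonzero[OF w(1) False] by metis
      obtain is1 i is2 where is': "is = is1 @ i # is2" "list_all2 (\<lambda>i v. proj01 i v = v) is1 p"
        "proj01 i x = x" "list_all2 (\<lambda>i v. proj01 i v = v) is2 s"
        using w(2) by (auto simp: pxs(1) list_all2_append2 list_all2_Cons2)
      have "i = 0" using is'(3) pxs(2) by (cases x) (auto simp: proj01_def coeff_t_def split: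
          if_splits)
      moreover have "(\<Sum>i\<leftarrow>is1. i - 1) = 0" "(\<Sum>i\<leftarrow>is2. i - 1) = 0"
        using degrees_of_one_forms[OF is'(2)] degrees_of_one_forms[OF is'(4)] pxs(3)
        by (auto simp: coeff_dt_def)
      ultimately have "(\<Sum>i\<leftarrow>is. i - 1) + 1 = 0" by (simp add: is'(1))
      then show ?thesis using len by (simp only: forms_simps) (simp add: mu_coeffs_def)
    qed
  qed
qed

lemma iterated_constants:
  "iterated (map (\<lambda>c. fn_of_poly M [:c:]) cs) = fn_of_poly M (monom (prod_list cs / fact (length
      cs)) (length cs))"
proof (induction cs rule: rev_induct)
  case Nil
  show ?case by (simp add: one_pCons monom_0)
next
  case (snoc c cs)
  let ?n = "length cs" and ?P = "monom (prod_list cs * c / fact (Suc (length cs))) (Suc (length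
      cs))"
  have pderiv_P: "pderiv ?P = monom (prod_list cs / fact ?n) ?n * [:c:]"
    by (simp add: pderiv_monom smult_monom mult.commute divide_simps del: of_nat_Suc)
  have "antideriv (fn_of_poly M (monom (prod_list cs / fact ?n) ?n) * fn_of_poly M [:c:]) =
      fn_of_poly M ?P"
  proof (rule antideriv_unique)
    show "D (fn_of_poly M ?P) = fn_of_poly M (monom (prod_list cs / fact ?n) ?n) * fn_of_poly M
        [:c:]"
      by (simp only: deriv_of_poly pderiv_P of_poly_mult)
  qed (simp add: eval_of_poly poly_monom)
  then show ?case using snoc.IH by (simp del: iterated_from_simps(4))
qed

text \<open>
  If some block has length at least two, then \<open>\<mu>\<close> sends it to a function. Unless it is the
  only block, \<open>\<lambda>\<close> kills the term; and if it is the only block, the term is the projection of a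
  function that vanishes at 0 and 1. There remains the iterated integral of constants.
\<close>

lemma exp_coeffs:
  assumes w: "w \<noteq> []"
  shows "block_sum (\<lambda>bs. lam_coeffs (map mu_coeffs bs)) w = dt_coeffs (fps_nth exp_fps) w"
proof -
  have "lam_coeffs (map mu_coeffs bs) = 0"
    if bs: "concat bs = w" "[] \<notin> set bs" "bs \<noteq> map (\<lambda>x. [x]) w" for bs
  proof (cases "length bs = 1")
    case True
    then have bw: "bs = [w]" using bs(1) by (auto simp: length_Suc_conv)
    then have len: "length w \<ge> 2" using bs(3) w by (cases w; cases "tl w") auto
    then show ?thesis
      by (simp add: bw lam_coeffs_single mu_coeffs_def whitney_proj_def eval_of_poly integral_eq
          poly_bernoulli_poly_0 poly_bernoulli_poly_1 zero_prod_def)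
  next
    case False
    then have len: "length bs \<ge> 2" using bs(1) w by (cases bs; cases "tl bs") auto
    obtain b where b: "b \<in> set bs" "length b \<noteq> 1"
    proof (rule ccontr)
      assume "\<not> thesis"
      then have "\<forall>b\<in>set bs. length b = 1" using that by blast
      then have "bs = map (\<lambda>x. [x]) (concat bs)"
        by (induction bs) (auto simp: length_Suc_conv)
      then show False using bs(1,3) by simp
    qed
    show ?thesis
      by (rule lam_coeffs_vanish[where x = "mu_coeffs b"]) (use len b in \<open>auto simp: mu_coeffs_def\<close>)
  qed
  then have "block_sum (\<lambda>bs. lam_coeffs (map mu_coeffs bs)) w =
      (\<Sum>bs\<in>{map (\<lambda>x. [x]) w}. lam_coeffs (map mu_coeffs bs))"
    unfolding block_sum_def by (intro sum.mono_neutral_right[OF finite_blocks]) (auto simp: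
        concat_map_singleton)
  also have "\<dots> = lam_coeffs (map (whitney_incl M) w)"
    by (simp add: o_def mu_coeffs_def)
  also have "\<dots> = dt_coeffs (fps_nth exp_fps) w"
  proof -
    have "iterated (map snd (map (whitney_incl M) w)) = iterated (map (\<lambda>c. fn_of_poly M [:c:])
        (map coeff_dt w))"
      by (simp add: o_def whitney_incl_eq coeff_dt_def)
    then have "ev (iterated (map snd (map (whitney_incl M) w))) 1 = (dt_prod w) / fact (length w)"
      unfolding iterated_constants by (simp add: eval_of_poly poly_monom)
    then show ?thesis
      using w by (auto simp: lam_coeffs_def dt_coeffs_def whitney_proj_def whitney_incl_eq
          eval_of_poly hd_map
        simp del: map_map)
  qed
  finally show ?thesis .
qed

theorem lam_exp_phi_only:
  "is_the_only (forms M) C_cup (whitney_proj M) (lam M) \<and>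
   is_the_only C_inf C_cup id (exp_mor M) \<and>
   is_the_only (forms M) C_inf (whitney_proj M) (phi M)"
proof -
  have lam: "lam M = morphism_of lam_coeffs" and mu: "mu M = morphism_of mu_coeffs"
    by (rule ext, rule lam_eq mu_eq)+
  have comu: "coalgebra_morphism C_inf (forms M) (mu M)"
    unfolding mu by (rule coalgebra_morphism_morphism_of[OF mu_coeffs_multilinear mu_coeffs_degree])
  have colam: "coalgebra_morphism (forms M) C_cup (lam M)"
    unfolding lam by (rule coalgebra_morphism_morphism_of[OF lam_coeffs_multilinear
        lam_coeffs_degree])
  have exp: "same_map C_cup (lam M \<circ> mu M) exp_std"
  proof (rule coalgebra_morphism_eqI[OF coalgebra_morphism_compose[OF comu colam]
      coalgebra_morphism_exp scalars_C(1)])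
    fix w :: "'k whitney list" assume w: "w \<noteq> []"
    show "taylor C_cup (lam M \<circ> mu M) w = taylor C_cup exp_std w"
      unfolding taylor_morphism_of[OF scalars_C(1) w]
      using taylor_compose_morphism_of[OF comu[unfolded mu] colam[unfolded lam] scalars_forms
          scalars_C(1) w]
        exp_coeffs[OF w] by (simp only: lam mu)
  qed
  show ?thesis
    using exp_log_phi_only[OF scalars_forms lam_only comu exp zero_form_whitney_proj
        log_mor_def[of M, unfolded exp_mor_def]] lam_only
    by (simp only: exp_mor_def phi_def)
qed

end

section \<open>Polynomial functions\<close>

lemma coeff_poly_antideriv:
  "coeff (poly_antideriv p) n = (case n of 0 \<Rightarrow> 0 | Suc m \<Rightarrow> coeff p m / of_nat (Suc m))"
proof (cases n)
  case (Suc m)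
  have "coeff (poly_antideriv p) (Suc m) =
      (\<Sum>i\<le>degree p. if i = m then coeff p m / of_nat (Suc m) else 0)"
    unfolding poly_antideriv_def coeff_sum by (intro sum.cong) (auto simp: coeff_monom)
  also have "\<dots> = coeff p m / of_nat (Suc m)"
    by (simp add: coeff_eq_0 del: of_nat_Suc)
  finally show ?thesis by (simp add: Suc)
qed (simp add: poly_antideriv_def coeff_sum)

interpretation polynomial: interval_calculus
  "polynomial_functions :: ('k::field_char_0, 'k poly) interval_functions" poly_antideriv
proof (unfold_locales, goal_cases)
  case (12 f)
  show ?case
    by (rule poly_eqI) (simp add: polynomial_functions_def coeff_pderiv coeff_poly_antideriv del:
        of_nat_Suc)
next
  case (13 f)
  show ?case
    by (simp add: polynomial_functions_def poly_0_coeff_0 coeff_poly_antideriv)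
next
  case (14 f)
  show ?case
    by (rule poly_eqI)
      (auto simp: polynomial_functions_def coeff_pderiv coeff_poly_antideriv poly_0_coeff_0
        simp del: of_nat_Suc split: nat.splits)
qed (auto simp: polynomial_functions_def algebra_simps pderiv_add pderiv_smult pderiv_mult
    smult_add_left smult_add_right)

section \<open>Smooth functions\<close>

lemma smooth_has_derivative:
  assumes x: "x \<in> {0..1}"
  shows "(smooth_eval f has_real_derivative smooth_eval (smooth_deriv f) x) (at x within {0..1})"
proof -
  have "smooth01 (smooth_eval f)" using smooth_eval by auto
  then obtain d where d: "(smooth_eval f has_real_derivative d) (at x within {0..1})"
    using x unfolding smooth01_def by metis
  then have "vector_derivative (smooth_eval f) (at x within {0..1}) = d"
    using vector_derivative_within_cbox[of 0 1 x "smooth_eval f" d] x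
    by (simp add: has_real_derivative_iff_has_vector_derivative)
  then show ?thesis using d x by (simp add: smooth_deriv.rep_eq)
qed

lemma smooth_eqI: "(\<And>x. x \<in> {0..1} \<Longrightarrow> smooth_eval f x = smooth_eval g x) \<Longrightarrow> f = g"
  using smooth_eval[of f] smooth_eval[of g]
  by (intro smooth_eval_inject[THEN iffD1] ext) (auto, metis atLeastAtMost_iff)

lemma smooth_deriv_eqI:
  assumes "\<And>x. x \<in> {0..1} \<Longrightarrow> (smooth_eval f has_real_derivative smooth_eval g x) (at x within
      {0..1})"
  shows "smooth_deriv f = g"
proof (rule smooth_eqI)
  fix x :: real assume x: "x \<in> {0..1}"
  then show "smooth_eval (smooth_deriv f) x = smooth_eval g x"
    using vector_derivative_within_cbox[of 0 1 x "smooth_eval f" "smooth_eval g x"] assms[OF x]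
    by (simp add: has_real_derivative_iff_has_vector_derivative smooth_deriv.rep_eq)
qed

lemma continuous_on_smooth_eval: "continuous_on {0..1} (smooth_eval f)"
  using smooth_has_derivative[of _ f]
  by (metis DERIV_continuous continuous_on_eq_continuous_within)

lemma smooth01_integral:
  assumes "smooth01 f"
  shows "smooth01 (\<lambda>x. if x \<in> {0..1} then integral {0..x} f else 0)"
proof -
  obtain D where D: "D 0 = f"
    "\<And>n x. x \<in> {0..1} \<Longrightarrow> (D n has_real_derivative D (Suc n) x) (at x within {0..1})"
    using assms unfolding smooth01_def by blast
  have "continuous_on {0..1} f"
    using D by (metis DERIV_continuous continuous_on_eq_continuous_within)
  then have "((\<lambda>x. integral {0..x} f) has_real_derivative f x) (at x within {0..1})"
      if "x \<in> {0..1}" for x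
    using that by (rule integral_has_real_derivative)
  then have "smooth01 (\<lambda>x. integral {0..x} f)"
    unfolding smooth01_def
    using D by (intro exI[of _ "\<lambda>n. case n of 0 \<Rightarrow> (\<lambda>x. integral {0..x} f) | Suc m \<Rightarrow> D m"])
      (auto split: nat.splits)
  then show ?thesis by (rule smooth01_cong) simp
qed

lift_definition smooth_antideriv :: "smooth \<Rightarrow> smooth"
  is "\<lambda>f x. if x \<in> {0..1} then integral {0..x} f else 0"
  using smooth01_integral by auto

lemma smooth_deriv_antideriv: "smooth_deriv (smooth_antideriv f) = f"
proof (rule smooth_deriv_eqI)
  fix x :: real assume x: "x \<in> {0..1}"
  show "(smooth_eval (smooth_antideriv f) has_real_derivative smooth_eval f x) (at x within {0..1})"
    by (rule has_field_derivative_transform_within[OF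
          integral_has_real_derivative[OF continuous_on_smooth_eval x] zero_less_one x])
      (simp add: smooth_antideriv.rep_eq)
qed

lemma smooth_eval_poly: "x \<in> {0..1} \<Longrightarrow> smooth_eval (smooth_of_poly p) x = poly p x"
  by (simp add: smooth_of_poly.rep_eq)

lemma smooth_antideriv_deriv:
  "smooth_antideriv (smooth_deriv f) = f - smooth_scale (smooth_eval f 0) (smooth_of_poly 1)"
proof (rule smooth_eqI)
  fix x :: real assume x: "x \<in> {0..1}"
  have "(smooth_eval (smooth_deriv f) has_integral smooth_eval f x - smooth_eval f 0) {0..x}"
  proof (rule fundamental_theorem_of_calculus)
    fix y assume "y \<in> {0..x}"
    then have "(smooth_eval f has_real_derivative smooth_eval (smooth_deriv f) y) (at y within
        {0..x})"
      using x by (intro has_field_derivative_subset[OF smooth_has_derivative]) auto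
    then show "(smooth_eval f has_vector_derivative smooth_eval (smooth_deriv f) y) (at y within
        {0..x})"
      by (simp add: has_real_derivative_iff_has_vector_derivative)
  qed (use x in simp)
  then show "smooth_eval (smooth_antideriv (smooth_deriv f)) x =
      smooth_eval (f - smooth_scale (smooth_eval f 0) (smooth_of_poly 1)) x"
    using x by (simp add: smooth_antideriv.rep_eq minus_smooth.rep_eq smooth_scale.rep_eq
        smooth_eval_poly integral_unique)
qed

lemma smooth_deriv_ring:
  "smooth_deriv (f + g) = smooth_deriv f + smooth_deriv g"
  "smooth_deriv (smooth_scale c f) = smooth_scale c (smooth_deriv f)"
  "smooth_deriv (f * g) = smooth_deriv f * g + f * smooth_deriv g"
  "smooth_deriv (smooth_of_poly p) = smooth_of_poly (pderiv p)"
proof -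
  show "smooth_deriv (f + g) = smooth_deriv f + smooth_deriv g"
    by (rule smooth_deriv_eqI) (auto simp: plus_smooth.rep_eq[abs_def] intro!: DERIV_add
        smooth_has_derivative)
  show "smooth_deriv (smooth_scale c f) = smooth_scale c (smooth_deriv f)"
    by (rule smooth_deriv_eqI) (auto simp: smooth_scale.rep_eq[abs_def] intro!: DERIV_cmult
        smooth_has_derivative)
  show "smooth_deriv (f * g) = smooth_deriv f * g + f * smooth_deriv g"
  proof (rule smooth_deriv_eqI)
    fix x :: real assume x: "x \<in> {0..1}"
    show "(smooth_eval (f * g) has_real_derivative smooth_eval (smooth_deriv f * g +
        f * smooth_deriv g) x)
        (at x within {0..1})"
      using DERIV_mult[OF smooth_has_derivative[OF x, of f] smooth_has_derivative[OF x, of g]]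
      by (simp add: plus_smooth.rep_eq times_smooth.rep_eq[abs_def] mult.commute)
  qed
  show "smooth_deriv (smooth_of_poly p) = smooth_of_poly (pderiv p)"
  proof (rule smooth_deriv_eqI)
    fix x :: real assume x: "x \<in> {0..1}"
    show "(smooth_eval (smooth_of_poly p) has_real_derivative smooth_eval (smooth_of_poly (pderiv
        p)) x)
        (at x within {0..1})"
      unfolding smooth_eval_poly[OF x]
      by (rule has_field_derivative_transform_within[OF
            has_field_derivative_at_within[OF poly_DERIV] zero_less_one x])
        (simp add: smooth_eval_poly)
  qed
qed

lemma smooth_algebra:
  "smooth_scale c (f + g) = smooth_scale c f + smooth_scale c g"
  "smooth_scale (c + d) f = smooth_scale c f + smooth_scale d f"
  "smooth_scale c (smooth_scale d f) = smooth_scale (c * d) f"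
  "smooth_scale 1 f = f"
  "smooth_scale c (f * g) = smooth_scale c f * g"
  "smooth_of_poly 1 * f = f"
  "smooth_of_poly (p + q) = smooth_of_poly p + smooth_of_poly q"
  "smooth_of_poly (smult c p) = smooth_scale c (smooth_of_poly p)"
  "smooth_of_poly (p * q) = smooth_of_poly p * smooth_of_poly q"
  by (rule smooth_eqI; simp add: plus_smooth.rep_eq times_smooth.rep_eq smooth_scale.rep_eq
      smooth_of_poly.rep_eq algebra_simps)+

lemma integrable_smooth_eval: "integrable lborel (smooth_eval f)"
proof -
  have "set_integrable lborel {0..1} (smooth_eval f)"
    by (rule borel_integrable_atLeastAtMost'[OF continuous_on_smooth_eval])
  moreover have "(\<lambda>x. indicator {0..1} x *\<^sub>R smooth_eval f x) = smooth_eval f"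
    using smooth_eval[of f] by (auto simp: indicator_def fun_eq_iff)
  ultimately show ?thesis by (simp add: set_integrable_def)
qed

text \<open>
  The integrand for the simplex with upper end point \<open>x\<close>. It is kept as a function on all
  sequences, of which only the first coordinates matter.
\<close>

definition simplex_integrand :: "smooth list \<Rightarrow> real \<Rightarrow> (nat \<Rightarrow> real) \<Rightarrow> real"
  where "simplex_integrand as x t = (if t \<in> ordered_simplex (length as) \<and> (\<forall>i<length as. t i \<le> x)
    then \<Prod>i<length as. smooth_eval (as ! i) (t i) else 0)"

lemma simplex_integrand_cong:
  assumes "\<And>i. i < length as \<Longrightarrow> t i = t' i"
  shows "simplex_integrand as x t = simplex_integrand as x t'"
proof -
  have "t \<in> ordered_simplex (length as) \<longleftrightarrow> t' \<in> ordered_simplex (length as)"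
    using assms by (auto simp: ordered_simplex_def)
  moreover have "(\<forall>i<length as. t i \<le> x) \<longleftrightarrow> (\<forall>i<length as. t' i \<le> x)"
    "(\<Prod>i<length as. smooth_eval (as ! i) (t i)) = (\<Prod>i<length as. smooth_eval (as ! i) (t' i))"
    using assms by simp_all
  ultimately show ?thesis by (simp only: simplex_integrand_def)
qed

lemma integrable_simplex_integrand:
  "integrable (PiM {..<length as} (\<lambda>_. lborel)) (simplex_integrand as x)"
proof -
  interpret product_sigma_finite "\<lambda>_ :: nat. lborel :: real measure" by standard
  let ?I = "{..<length as}" and ?M = "PiM {..<length as} (\<lambda>_. lborel :: real measure)"
  let ?P = "\<lambda>t. \<Prod>i\<in>?I. smooth_eval (as ! i) (t i)"
  have P: "integrable ?M ?P"
    by (rule product_integrable_prod) (auto intro: integrable_smooth_eval)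
  have comp: "(\<lambda>t. t i) \<in> borel_measurable ?M" if "i \<in> ?I" for i
    using measurable_component_singleton[OF that, of "\<lambda>_. lborel :: real measure"] by simp
  have set: "{t \<in> space ?M. (\<forall>i\<in>?I. 0 \<le> t i \<and> t i \<le> 1) \<and> (\<forall>i\<in>?I. \<forall>j\<in>?I. i \<le> j \<longrightarrow> t i \<le> t j) \<and>
      (\<forall>i\<in>?I. t i \<le> x)} \<in> sets ?M"
    by (intro sets.sets_Collect_conj sets.sets_Collect_finite_All sets.sets_Collect_imp
        sets.sets_Collect_const borel_measurable_le comp borel_measurable_const finite_lessThan)
  have eq: "simplex_integrand as x = (\<lambda>t. if (\<forall>i\<in>?I. 0 \<le> t i \<and> t i \<le> 1) \<and>
      (\<forall>i\<in>?I. \<forall>j\<in>?I. i \<le> j \<longrightarrow> t i \<le> t j) \<and> (\<forall>i\<in>?I. t i \<le> x) then ?P t else 0)"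
    by (auto simp: simplex_integrand_def ordered_simplex_def fun_eq_iff)
  have "simplex_integrand as x \<in> borel_measurable ?M"
    unfolding eq by (rule measurable_If[OF borel_measurable_integrable[OF P]
        borel_measurable_const set])
  then show ?thesis
    by (rule Bochner_Integration.integrable_bound[OF P]) (auto simp: simplex_integrand_def)
qed

text \<open>
  The last variable is the upper end point for the others.
\<close>

lemma simplex_integrand_snoc:
  assumes "x \<in> {0..1}"
  shows "simplex_integrand (as @ [a]) x t =
    indicator {0..x} (t (length as)) * (smooth_eval a (t (length as)) * simplex_integrand as
        (t (length as)) t)"
proof -
  let ?n = "length as"
  have simplex: "t \<in> ordered_simplex (Suc ?n) \<and> (\<forall>i<Suc ?n. t i \<le> x) \<longleftrightarrow>
      t ?n \<in> {0..x} \<and> t \<in> ordered_simplex ?n \<and> (\<forall>i<?n. t i \<le> t ?n)"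
    using assms by (auto simp: ordered_simplex_def less_Suc_eq All_less_Suc)
  have prod: "(\<Prod>i<Suc ?n. smooth_eval ((as @ [a]) ! i) (t i)) =
      (\<Prod>i<?n. smooth_eval (as ! i) (t i)) * smooth_eval a (t ?n)"
    by (simp add: nth_append)
  show ?thesis
    unfolding simplex_integrand_def length_append_singleton simplex prod
        by (auto simp: indicator_def)
qed

text \<open>
  Fubini's theorem, with the largest variable outermost.
\<close>

lemma simplex_integral:
  assumes "x \<in> {0..1}"
  shows "(LINT t | PiM {..<length as} (\<lambda>_. lborel). simplex_integrand as x t) =
    smooth_eval (foldl (\<lambda>I a. smooth_antideriv (I * a)) (smooth_of_poly 1) as) x"
  using assms
proof (induction as arbitrary: x rule: rev_induct)
  case Nil
  interpret product_sigma_finite "\<lambda>_ :: nat. lborel :: real measure" by standard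
  show ?case
    using Nil by (simp add: simplex_integrand_def ordered_simplex_def smooth_eval_poly PiM_empty
      lebesgue_integral_count_space_finite)
next
  case (snoc a as)
  interpret product_sigma_finite "\<lambda>_ :: nat. lborel :: real measure" by standard
  let ?n = "length as" and ?J = "foldl (\<lambda>I a. smooth_antideriv (I * a)) (smooth_of_poly 1) as"
  let ?g = "\<lambda>s. indicator {0..x} s * (smooth_eval a s * smooth_eval ?J s)"
  have un: "{..<length (as @ [a])} = {?n} \<union> {..<?n}" by auto
  have cont: "continuous_on {0..x} (\<lambda>s. smooth_eval a s * smooth_eval ?J s)"
    using snoc.prems
    by (intro continuous_on_mult continuous_on_subset[OF continuous_on_smooth_eval]) auto
  note int = borel_integrable_atLeastAtMost'[OF cont]
  have "(LINT t | PiM {..<length (as @ [a])} (\<lambda>_. lborel). simplex_integrand (as @ [a]) x t) =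
      (LINT u | PiM {?n} (\<lambda>_. lborel). LINT v | PiM {..<?n} (\<lambda>_. lborel).
        simplex_integrand (as @ [a]) x (merge {?n} {..<?n} (u, v)))"
    using integrable_simplex_integrand[of "as @ [a]" x] unfolding un
    by (intro product_integral_fold) auto
  also have "\<dots> = (LINT u | PiM {?n} (\<lambda>_. lborel). ?g (u ?n))"
  proof (intro Bochner_Integration.integral_cong refl)
    fix u :: "nat \<Rightarrow> real"
    have "simplex_integrand (as @ [a]) x (merge {?n} {..<?n} (u, v)) =
        indicator {0..x} (u ?n) * smooth_eval a (u ?n) * simplex_integrand as (u ?n) v" for v
      unfolding simplex_integrand_snoc[OF snoc.prems]
      using simplex_integrand_cong[of as "merge {?n} {..<?n} (u, v)" v "u ?n"]
          by (simp add: merge_def)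
    then show "(LINT v | PiM {..<?n} (\<lambda>_. lborel). simplex_integrand (as @ [a]) x (merge {?n}
        {..<?n} (u, v))) = ?g (u ?n)"
      using snoc.IH[of "u ?n"] snoc.prems by (cases "u ?n \<in> {0..x}") (simp_all add: mult.assoc)
  qed
  also have "\<dots> = (LINT s | lborel. ?g s)"
    using int by (intro product_integral_singleton) (auto simp: set_integrable_def)
  also have "\<dots> = integral {0..x} (\<lambda>s. smooth_eval a s * smooth_eval ?J s)"
    using set_borel_integral_eq_integral(2)[OF int] by (simp add: set_lebesgue_integral_def)
  also have "\<dots> = smooth_eval (smooth_antideriv (?J * a)) x"
    using snoc.prems by (simp add: smooth_antideriv.rep_eq times_smooth.rep_eq[abs_def]
        mult.commute)
  finally show ?case by simp
qed

interpretation smooth: interval_calculus smooth_functions smooth_antideriv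
proof (unfold_locales, goal_cases)
  case (16 as)
  have "indicator (ordered_simplex (length as)) t * (\<Prod>i<length as. smooth_eval (as ! i) (t i)) =
      simplex_integrand as 1 t" for t
    by (auto simp: simplex_integrand_def indicator_def ordered_simplex_def)
  then show ?case using simplex_integral[of 1 as] by (simp add: smooth_functions_def)
qed (simp_all add: smooth_functions_def smooth_deriv_ring smooth_deriv_antideriv
    smooth_antideriv_deriv
    smooth_algebra smooth_antideriv.rep_eq plus_smooth.rep_eq times_smooth.rep_eq
        smooth_scale.rep_eq
    smooth_of_poly.rep_eq, auto)

section \<open>The three morphisms\<close>

theorem corollary2p12:
  shows
    "(let P = (polynomial_functions :: ('k::field_char_0, 'k poly) interval_functions) in
       is_the_only (forms P) C_cup (whitney_proj P) (lam P) \<and>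
       is_the_only C_inf C_cup id (exp_mor P) \<and>
       is_the_only (forms P) C_inf (whitney_proj P) (phi P)) \<and>
     (let S = smooth_functions in
       is_the_only (forms S) C_cup (whitney_proj S) (lam S) \<and>
       is_the_only C_inf C_cup id (exp_mor S) \<and>
       is_the_only (forms S) C_inf (whitney_proj S) (phi S))"
  unfolding Let_def
  by (rule conjI[OF polynomial.lam_exp_phi_only smooth.lam_exp_phi_only])

end
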